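(* Let $(\psi,u,w,j,\rho,p,v_{||})$, with $p=\rho T$, be a sufficiently smooth solution on $\Omega=D\times[0,2\pi[$ ($2\pi$-periodic in $\phi$) of the reduced MHD system with parallel velocity consisting of equations (a)-(g) given in the context, with constant resistivity $\eta$ and constant viscosity $\nu$, and assume the boundary conditions $$\psi=u=T=\rho=0 \quad\text{and}\quad \frac{\partial u}{\partial \mathbf{n}}=\frac{\partial\psi}{\partial\mathbf{n}}=0\quad\text{on }\partial\Omega,$$ where $\mathbf{n}$ is the outgoing normal to the domain. Define the energy density $$E=\frac{|\mathbf{B}|^2}{2}+\rho\frac{|\mathbf{v}|^2}{2}+\frac{1}{\gamma-1}p .$$ If $\eta=\nu=0$, then $$\frac{d}{dt}\int_{\Omega}E\,dW=\frac{d}{dt}\int_\Omega R\,E\,dV=0 .$$ If $\eta\neq0$ and $\nu\neq0$, then $$\frac{d}{dt}\int_{\Omega}E\,dW=-\nu\int_{\Omega}w^2\,dW-\eta\int_{\Omega}\frac{j^2}{R^2}\,dW-\eta\int_{\Omega}\left|\nabla_{pol}\left(\frac{\partial_\phi\psi}{R^2}\right)\right|^2dW .$$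
   Context: **Coordinates and operators.** Cylindrical coordinates $(R,\phi,Z)$ are given by $X=R\cos\phi$, $Y=-R\sin\phi$, $Z=Z$, with $R>0$; the orthonormal frame is $\mathbf{e}_R=\nabla R$, $\mathbf{e}_\phi=R\nabla\phi$, $\mathbf{e}_Z=\nabla Z$, with $\mathbf{e}_R\times\mathbf{e}_\phi=-\mathbf{e}_Z$, $\mathbf{e}_\phi\times\mathbf{e}_Z=-\mathbf{e}_R$, $\mathbf{e}_Z\times\mathbf{e}_R=-\mathbf{e}_\phi$. The domain is $\Omega=D\times[0,2\pi[$ with $(R,Z)\in D$ and $\phi\in[0,2\pi[$; all functions are $2\pi$-periodic in $\phi$, and $\partial\Omega$ means $\partial D\times[0,2\pi[$. Integrals over $\Omega$ are over $(R,Z)\in D$ and $\phi\in[0,2\pi[$; $dV$ is the measure $dR\,dZ$ (together with $d\phi$) and $dW=R\,dV$. For scalars $f,a,b$ and vector fields $\mathbf f$: $$\nabla_{pol}f=\partial_Rf\,\mathbf{e}_R+\partial_Zf\,\mathbf{e}_Z,\qquad \nabla\cdot\mathbf f=\tfrac1R\partial_R(Rf_R)+\tfrac1R\partial_\phi f_\phi+\partial_Zf_Z,$$ $$\triangle^*f=R\,\partial_R\left(\tfrac1R\partial_Rf\right)+\partial_{ZZ}f,\qquad \triangle_{pol}f=\tfrac1R\partial_R(R\,\partial_Rf)+\partial_{ZZ}f,\qquad [a,b]=\partial_Ra\,\partial_Zb-\partial_Za\,\partial_Rb .$$ **Unknowns and fields.** The unknowns are the poloidal magnetic flux $\psi$,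 the electric potential $u$, the density $\rho$, the temperature $T$ (with pressure $p=\rho T$), the parallel velocity $v_{||}$, and the auxiliary variables $w$ (vorticity) and $j$ (toroidal current); all are functions of time $t$ and $(R,\phi,Z)$. $F_0$ is a constant and $\gamma=\frac53$. The magnetic and velocity fields are $$\mathbf{B}=\frac{F_0}{R}\mathbf{e}_\phi+\mathbf{B}_{pol},\quad \mathbf{B}_{pol}=\frac1R\nabla\psi\times\mathbf{e}_\phi=\frac1R\partial_Z\psi\,\mathbf{e}_R-\frac1R\partial_R\psi\,\mathbf{e}_Z,$$ $$\mathbf{v}=-R\nabla u\times\mathbf{e}_\phi+v_{||}\mathbf{B}=-R\,\partial_Zu\,\mathbf{e}_R+R\,\partial_Ru\,\mathbf{e}_Z+v_{||}\mathbf{B}.$$ Set $\widehat\rho=R^2\rho$. **Reduced MHD system with parallel velocity.** (a) $$\frac{1}{R^2}\partial_t\psi=\frac1R[\psi,u]+\frac{\eta}{R^2}\left(j+\frac{\partial_{\phi\phi}\psi}{R^2}\right)-\frac{F_0}{R^2}\partial_\phi u.$$ (b) $$\begin{aligned}&\nabla\cdot(\widehat\rho\,\nabla_{pol}\partial_tu)-\nabla\cdot\big(\rho\,\partial_t(v_{||}\nabla_{pol}\psi)\big)=\frac{1}{2R}[R^2|\nabla_{pol}u|^2,\widehat\rho]+\frac1R[\widehat\rho R^2w,u]-\frac1R[R^2,p]+\frac1R[\psi,j]-\frac{F_0}{R^2}\partial_\phi j\\ &\quad+\nu\triangle_{pol}w+\frac1R[\rho v_{||}^2j,\psi]+\frac1R[\rho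 v_{||}(\nabla_{pol}v_{||}\cdot\nabla_{pol}\psi),\psi]-\nabla\cdot\left(\widehat\rho\frac{F_0}{R^2}v_{||}\nabla_{pol}(\partial_\phi u)\right)\\ &\quad+\frac1R[\widehat\rho,v_{||}(\nabla_{pol}\psi\cdot\nabla_{pol}u)]-\frac{1}{2R}[\widehat\rho,v_{||}^2|\mathbf{B}_{pol}|^2]-\frac1R[\widehat\rho v_{||}w,\psi]+\frac1R[u,\widehat\rho v_{||}j]+\frac1R[u,\widehat\rho(\nabla_{pol}\psi\cdot\nabla_{pol}v_{||})]\\ &\quad+\frac1R\partial_Z\left(\widehat\rho\frac{F_0}{R^3}v_{||}\partial_\phi(v_{||}\partial_Z\psi)\right)+\frac1R\partial_R\left(\widehat\rho\frac{F_0}{R^3}v_{||}\partial_\phi(v_{||}\partial_R\psi)\right)-\frac1R\partial_Z\left(\widehat\rho\frac{F_0^2}{R^3}v_{||}^2\right).\end{aligned}$$ (c) $w=\triangle_{pol}u$. (d) $j=\triangle^*\psi$. (e) $$\partial_t\rho=R[\rho,u]+2\rho\,\partial_Zu-\frac{v_{||}F_0}{R^2}\partial_\phi\rho-\frac{v_{||}}{R}[\rho,\psi]-\frac{\rho}{R}[v_{||},\psi]-\frac{\rho F_0}{R^2}\partial_\phi v_{||}.$$ (f) $$\partial_tp=R[p,u]+2\gamma p\,\partial_Zu-\frac{v_{||}F_0}{R^2}\partial_\phi p-\frac{v_{||}}{R}[p,\psi]-\frac{\gamma p}{R}[v_{||},\psi]-\frac{\gamma pF_0}{R^2}\partial_\phi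 v_{||}.$$ (g) $$\begin{aligned}&\rho|\mathbf{B}|^2\partial_tv_{||}+\rho v_{||}\frac{1}{R^2}\nabla_{pol}\psi\cdot\nabla_{pol}(\partial_t\psi)-\rho\,\nabla_{pol}\psi\cdot\nabla_{pol}(\partial_tu)=-\frac1R[p,\psi]-\frac{F_0}{R^2}\partial_\phi p+\frac\rho R\left[\psi,\frac{v_{||}^2|\mathbf{B}|^2}{2}\right]\\ &\quad-\frac{F_0}{R}\rho\,\partial_\phi\left(\frac{v_{||}^2|\mathbf{B}|^2}{2R}\right)-\frac{1}{2R}\rho[R^2|\nabla_{pol}u|^2,\psi]-\frac{\widehat\rho}{R}w[\psi,u]-R\rho|\mathbf{B}|^2[u,v_{||}]-R\rho v_{||}\left[u,\frac{|\mathbf{B}|^2}{2}\right]+R\rho v_{||}\left[u,\frac{|\mathbf{B}_{pol}|^2}{2}\right]\\ &\quad-\rho v_{||}\frac{\triangle^*\psi}{R}[u,\psi]-\frac{\rho v_{||}}{R}[\psi,(\nabla_{pol}\psi\cdot\nabla_{pol}u)]+\frac{\rho v_{||}F_0}{R^2}(\nabla_{pol}\psi\cdot\nabla_{pol}(\partial_\phi u))+\rho v_{||}\frac{F_0^2}{R^2}\partial_Zu.\end{aligned}$$ Solutions and the domain $D$ (contained in $\{R>0\}$) are assumed regular enough for all expressions and integrations by parts to make sense. *)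

theory Defs
  imports "HOL-Analysis.Analysis"
begin

text \<open>
  Fields are functions of the cylindrical coordinates in the order \<open>R\<close>, \<open>\<phi>\<close>, \<open>Z\<close>; a time-dependent
  field takes the time as its first argument. A vector is given by its components, in this
  order, in the orthonormal frame \<open>e\<^sub>R\<close>, \<open>e\<^sub>\<phi>\<close>, \<open>e\<^sub>Z\<close>, so its length is the Euclidean norm of
  the component vector.
\<close>

type_synonym scalar_field = "real \<Rightarrow> real \<Rightarrow> real \<Rightarrow> real"
type_synonym vector_field = "real \<Rightarrow> real \<Rightarrow> real \<Rightarrow> real ^ 3"


section \<open>Differential operators\<close>

definition partial_R :: "scalar_field \<Rightarrow> scalar_field"  (\<open>\<partial>\<^sub>R\<close>)
  where "\<partial>\<^sub>R f R \<phi> Z = deriv (\<lambda>r. f r \<phi> Z) R"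

definition partial_phi :: "scalar_field \<Rightarrow> scalar_field"  (\<open>\<partial>\<^sub>\<phi>\<close>)
  where "\<partial>\<^sub>\<phi> f R \<phi> Z = deriv (\<lambda>s. f R s Z) \<phi>"

definition partial_Z :: "scalar_field \<Rightarrow> scalar_field"  (\<open>\<partial>\<^sub>Z\<close>)
  where "\<partial>\<^sub>Z f R \<phi> Z = deriv (\<lambda>z. f R \<phi> z) Z"

text \<open>The time derivative is applied to scalar and to vector fields.\<close>

definition partial_t ::
    "(real \<Rightarrow> real \<Rightarrow> real \<Rightarrow> real \<Rightarrow> 'a::real_normed_vector) \<Rightarrow> real \<Rightarrow> real \<Rightarrow> real \<Rightarrow> real \<Rightarrow> 'a"  (\<open>\<partial>\<^sub>t\<close>)
  where "\<partial>\<^sub>t f t R \<phi> Z = vector_derivative (\<lambda>s. f s R \<phi> Z) (at t)"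

definition grad :: "scalar_field \<Rightarrow> vector_field"
  where "grad f R \<phi> Z = vector [\<partial>\<^sub>R f R \<phi> Z, (1 / R) * \<partial>\<^sub>\<phi> f R \<phi> Z, \<partial>\<^sub>Z f R \<phi> Z]"

definition grad_pol :: "scalar_field \<Rightarrow> vector_field"
  where "grad_pol f R \<phi> Z = vector [\<partial>\<^sub>R f R \<phi> Z, 0, \<partial>\<^sub>Z f R \<phi> Z]"

definition divg :: "vector_field \<Rightarrow> scalar_field"
  where "divg f R \<phi> Z =
     (1 / R) * \<partial>\<^sub>R (\<lambda>R \<phi> Z. R * f R \<phi> Z $ 1) R \<phi> Z
   + (1 / R) * \<partial>\<^sub>\<phi> (\<lambda>R \<phi> Z. f R \<phi> Z $ 2) R \<phi> Z
   + \<partial>\<^sub>Z (\<lambda>R \<phi> Z. f R \<phi> Z $ 3) R \<phi> Z"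

definition lap_star :: "scalar_field \<Rightarrow> scalar_field"
  where "lap_star f R \<phi> Z =
     R * \<partial>\<^sub>R (\<lambda>R \<phi> Z. (1 / R) * \<partial>\<^sub>R f R \<phi> Z) R \<phi> Z + \<partial>\<^sub>Z (\<partial>\<^sub>Z f) R \<phi> Z"

definition lap_pol :: "scalar_field \<Rightarrow> scalar_field"
  where "lap_pol f R \<phi> Z =
     (1 / R) * \<partial>\<^sub>R (\<lambda>R \<phi> Z. R * \<partial>\<^sub>R f R \<phi> Z) R \<phi> Z + \<partial>\<^sub>Z (\<partial>\<^sub>Z f) R \<phi> Z"

definition pbracket :: "scalar_field \<Rightarrow> scalar_field \<Rightarrow> scalar_field"
  where "pbracket a b R \<phi> Z =
     \<partial>\<^sub>R a R \<phi> Z * \<partial>\<^sub>Z b R \<phi> Z - \<partial>\<^sub>Z a R \<phi> Z * \<partial>\<^sub>R b R \<phi> Z"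

text \<open>
  Since \<open>Y = - R sin \<phi>\<close>, the frame \<open>(e\<^sub>R, e\<^sub>\<phi>, e\<^sub>Z)\<close> is left-handed (\<open>e\<^sub>R \<times> e\<^sub>\<phi> = - e\<^sub>Z\<close> and
  cyclically), so in components the vector product is the negative of the standard one.
\<close>

definition cyl_cross :: "real ^ 3 \<Rightarrow> real ^ 3 \<Rightarrow> real ^ 3"
  where "cyl_cross a b = - cross3 a b"

definition e_phi :: "real ^ 3"
  where "e_phi = vector [0, 1, 0]"


section \<open>Magnetic field, velocity and energy density\<close>

definition B_pol :: "scalar_field \<Rightarrow> vector_field"
  where "B_pol \<psi> R \<phi> Z = (1 / R) *\<^sub>R cyl_cross (grad \<psi> R \<phi> Z) e_phi"

definition B_field :: "real \<Rightarrow> scalar_field \<Rightarrow> vector_field"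
  where "B_field F0 \<psi> R \<phi> Z = (F0 / R) *\<^sub>R e_phi + B_pol \<psi> R \<phi> Z"

definition velocity :: "real \<Rightarrow> scalar_field \<Rightarrow> scalar_field \<Rightarrow> scalar_field \<Rightarrow> vector_field"
  where "velocity F0 \<psi> u v R \<phi> Z =
     - (R *\<^sub>R cyl_cross (grad u R \<phi> Z) e_phi) + v R \<phi> Z *\<^sub>R B_field F0 \<psi> R \<phi> Z"

lemma B_pol_components:
  "B_pol \<psi> R \<phi> Z = vector [(1 / R) * \<partial>\<^sub>Z \<psi> R \<phi> Z, 0, - (1 / R) * \<partial>\<^sub>R \<psi> R \<phi> Z]"
  by (simp add: B_pol_def cyl_cross_def grad_def e_phi_def cross3_def vec_eq_iff forall_3)

lemma velocity_components:
  "velocity F0 \<psi> u v R \<phi> Z =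
     vector [- R * \<partial>\<^sub>Z u R \<phi> Z, 0, R * \<partial>\<^sub>R u R \<phi> Z] + v R \<phi> Z *\<^sub>R B_field F0 \<psi> R \<phi> Z"
  by (simp add: velocity_def cyl_cross_def grad_def e_phi_def cross3_def vec_eq_iff forall_3)

definition gam :: real
  where "gam = 5 / 3"

definition energy_density ::
    "real \<Rightarrow> scalar_field \<Rightarrow> scalar_field \<Rightarrow> scalar_field \<Rightarrow> scalar_field \<Rightarrow> scalar_field \<Rightarrow> scalar_field"
  where "energy_density F0 \<psi> u \<rho> p v R \<phi> Z =
     (norm (B_field F0 \<psi> R \<phi> Z))^2 / 2
   + \<rho> R \<phi> Z * ((norm (velocity F0 \<psi> u v R \<phi> Z))^2 / 2)
   + 1 / (gam - 1) * p R \<phi> Z"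

definition rho_hat :: "scalar_field \<Rightarrow> scalar_field"
  where "rho_hat \<rho> R \<phi> Z = R^2 * \<rho> R \<phi> Z"


section \<open>Reduced MHD system with parallel velocity\<close>

text \<open>
  Each equation is a relation at one time and one point. The unknowns are time-dependent;
  \<open>v\<close> is the parallel velocity.
\<close>

type_synonym evolution = "real \<Rightarrow> scalar_field"

definition eq_flux :: "real \<Rightarrow> real \<Rightarrow> evolution \<Rightarrow> evolution \<Rightarrow> evolution
    \<Rightarrow> real \<Rightarrow> real \<Rightarrow> real \<Rightarrow> real \<Rightarrow> bool"
  where "eq_flux \<eta> F0 \<psi> u j t R \<phi> Z \<longleftrightarrow>
     (1 / R^2) * \<partial>\<^sub>t \<psi> t R \<phi> Z =
       (1 / R) * pbracket (\<psi> t) (u t) R \<phi> Z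
     + (\<eta> / R^2) * (j t R \<phi> Z + \<partial>\<^sub>\<phi> (\<partial>\<^sub>\<phi> (\<psi> t)) R \<phi> Z / R^2)
     - (F0 / R^2) * \<partial>\<^sub>\<phi> (u t) R \<phi> Z"

definition eq_vorticity :: "real \<Rightarrow> real \<Rightarrow> evolution \<Rightarrow> evolution \<Rightarrow> evolution \<Rightarrow> evolution
    \<Rightarrow> evolution \<Rightarrow> evolution \<Rightarrow> evolution \<Rightarrow> real \<Rightarrow> real \<Rightarrow> real \<Rightarrow> real \<Rightarrow> bool"
  where "eq_vorticity \<nu> F0 \<psi> u w j \<rho> p v t R \<phi> Z \<longleftrightarrow>
     divg (\<lambda>R \<phi> Z. rho_hat (\<rho> t) R \<phi> Z *\<^sub>R grad_pol (\<partial>\<^sub>t u t) R \<phi> Z) R \<phi> Z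
   - divg (\<lambda>R \<phi> Z. \<rho> t R \<phi> Z *\<^sub>R
         \<partial>\<^sub>t (\<lambda>t R \<phi> Z. v t R \<phi> Z *\<^sub>R grad_pol (\<psi> t) R \<phi> Z) t R \<phi> Z) R \<phi> Z
   =
     1 / (2 * R) * pbracket (\<lambda>R \<phi> Z. R^2 * (norm (grad_pol (u t) R \<phi> Z))^2) (rho_hat (\<rho> t)) R \<phi> Z
   + (1 / R) * pbracket (\<lambda>R \<phi> Z. rho_hat (\<rho> t) R \<phi> Z * R^2 * w t R \<phi> Z) (u t) R \<phi> Z
   - (1 / R) * pbracket (\<lambda>R \<phi> Z. R^2) (p t) R \<phi> Z
   + (1 / R) * pbracket (\<psi> t) (j t) R \<phi> Z
   - (F0 / R^2) * \<partial>\<^sub>\<phi> (j t) R \<phi> Z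
   + \<nu> * lap_pol (w t) R \<phi> Z
   + (1 / R) * pbracket (\<lambda>R \<phi> Z. \<rho> t R \<phi> Z * (v t R \<phi> Z)^2 * j t R \<phi> Z) (\<psi> t) R \<phi> Z
   + (1 / R) * pbracket (\<lambda>R \<phi> Z. \<rho> t R \<phi> Z * v t R \<phi> Z
         * (grad_pol (v t) R \<phi> Z \<bullet> grad_pol (\<psi> t) R \<phi> Z)) (\<psi> t) R \<phi> Z
   - divg (\<lambda>R \<phi> Z. (rho_hat (\<rho> t) R \<phi> Z * (F0 / R^2) * v t R \<phi> Z)
         *\<^sub>R grad_pol (\<partial>\<^sub>\<phi> (u t)) R \<phi> Z) R \<phi> Z
   + (1 / R) * pbracket (rho_hat (\<rho> t)) (\<lambda>R \<phi> Z. v t R \<phi> Z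
         * (grad_pol (\<psi> t) R \<phi> Z \<bullet> grad_pol (u t) R \<phi> Z)) R \<phi> Z
   - 1 / (2 * R) * pbracket (rho_hat (\<rho> t))
         (\<lambda>R \<phi> Z. (v t R \<phi> Z)^2 * (norm (B_pol (\<psi> t) R \<phi> Z))^2) R \<phi> Z
   - (1 / R) * pbracket (\<lambda>R \<phi> Z. rho_hat (\<rho> t) R \<phi> Z * v t R \<phi> Z * w t R \<phi> Z) (\<psi> t) R \<phi> Z
   + (1 / R) * pbracket (u t) (\<lambda>R \<phi> Z. rho_hat (\<rho> t) R \<phi> Z * v t R \<phi> Z * j t R \<phi> Z) R \<phi> Z
   + (1 / R) * pbracket (u t) (\<lambda>R \<phi> Z. rho_hat (\<rho> t) R \<phi> Z
         * (grad_pol (\<psi> t) R \<phi> Z \<bullet> grad_pol (v t) R \<phi> Z)) R \<phi> Z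
   + (1 / R) * \<partial>\<^sub>Z (\<lambda>R \<phi> Z. rho_hat (\<rho> t) R \<phi> Z * (F0 / R^3) * v t R \<phi> Z
         * \<partial>\<^sub>\<phi> (\<lambda>R \<phi> Z. v t R \<phi> Z * \<partial>\<^sub>Z (\<psi> t) R \<phi> Z) R \<phi> Z) R \<phi> Z
   + (1 / R) * \<partial>\<^sub>R (\<lambda>R \<phi> Z. rho_hat (\<rho> t) R \<phi> Z * (F0 / R^3) * v t R \<phi> Z
         * \<partial>\<^sub>\<phi> (\<lambda>R \<phi> Z. v t R \<phi> Z * \<partial>\<^sub>R (\<psi> t) R \<phi> Z) R \<phi> Z) R \<phi> Z
   - (1 / R) * \<partial>\<^sub>Z (\<lambda>R \<phi> Z. rho_hat (\<rho> t) R \<phi> Z * (F0^2 / R^3) * (v t R \<phi> Z)^2) R \<phi> Z"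

definition eq_density :: "real \<Rightarrow> evolution \<Rightarrow> evolution \<Rightarrow> evolution \<Rightarrow> evolution
    \<Rightarrow> real \<Rightarrow> real \<Rightarrow> real \<Rightarrow> real \<Rightarrow> bool"
  where "eq_density F0 \<psi> u \<rho> v t R \<phi> Z \<longleftrightarrow>
     \<partial>\<^sub>t \<rho> t R \<phi> Z =
       R * pbracket (\<rho> t) (u t) R \<phi> Z
     + 2 * \<rho> t R \<phi> Z * \<partial>\<^sub>Z (u t) R \<phi> Z
     - v t R \<phi> Z * F0 / R^2 * \<partial>\<^sub>\<phi> (\<rho> t) R \<phi> Z
     - v t R \<phi> Z / R * pbracket (\<rho> t) (\<psi> t) R \<phi> Z
     - \<rho> t R \<phi> Z / R * pbracket (v t) (\<psi> t) R \<phi> Z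
     - \<rho> t R \<phi> Z * F0 / R^2 * \<partial>\<^sub>\<phi> (v t) R \<phi> Z"

definition eq_pressure :: "real \<Rightarrow> evolution \<Rightarrow> evolution \<Rightarrow> evolution \<Rightarrow> evolution
    \<Rightarrow> real \<Rightarrow> real \<Rightarrow> real \<Rightarrow> real \<Rightarrow> bool"
  where "eq_pressure F0 \<psi> u p v t R \<phi> Z \<longleftrightarrow>
     \<partial>\<^sub>t p t R \<phi> Z =
       R * pbracket (p t) (u t) R \<phi> Z
     + 2 * gam * p t R \<phi> Z * \<partial>\<^sub>Z (u t) R \<phi> Z
     - v t R \<phi> Z * F0 / R^2 * \<partial>\<^sub>\<phi> (p t) R \<phi> Z
     - v t R \<phi> Z / R * pbracket (p t) (\<psi> t) R \<phi> Z
     - gam * p t R \<phi> Z / R * pbracket (v t) (\<psi> t) R \<phi> Z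
     - gam * p t R \<phi> Z * F0 / R^2 * \<partial>\<^sub>\<phi> (v t) R \<phi> Z"

definition eq_parallel :: "real \<Rightarrow> evolution \<Rightarrow> evolution \<Rightarrow> evolution \<Rightarrow> evolution
    \<Rightarrow> evolution \<Rightarrow> evolution \<Rightarrow> real \<Rightarrow> real \<Rightarrow> real \<Rightarrow> real \<Rightarrow> bool"
  where "eq_parallel F0 \<psi> u w \<rho> p v t R \<phi> Z \<longleftrightarrow>
     \<rho> t R \<phi> Z * (norm (B_field F0 (\<psi> t) R \<phi> Z))^2 * \<partial>\<^sub>t v t R \<phi> Z
   + \<rho> t R \<phi> Z * v t R \<phi> Z * (1 / R^2)
         * (grad_pol (\<psi> t) R \<phi> Z \<bullet> grad_pol (\<partial>\<^sub>t \<psi> t) R \<phi> Z)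
   - \<rho> t R \<phi> Z * (grad_pol (\<psi> t) R \<phi> Z \<bullet> grad_pol (\<partial>\<^sub>t u t) R \<phi> Z)
   =
   - (1 / R) * pbracket (p t) (\<psi> t) R \<phi> Z
   - (F0 / R^2) * \<partial>\<^sub>\<phi> (p t) R \<phi> Z
   + \<rho> t R \<phi> Z / R * pbracket (\<psi> t)
         (\<lambda>R \<phi> Z. (v t R \<phi> Z)^2 * (norm (B_field F0 (\<psi> t) R \<phi> Z))^2 / 2) R \<phi> Z
   - (F0 / R) * \<rho> t R \<phi> Z * \<partial>\<^sub>\<phi>
         (\<lambda>R \<phi> Z. (v t R \<phi> Z)^2 * (norm (B_field F0 (\<psi> t) R \<phi> Z))^2 / (2 * R)) R \<phi> Z
   - 1 / (2 * R) * \<rho> t R \<phi> Z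
         * pbracket (\<lambda>R \<phi> Z. R^2 * (norm (grad_pol (u t) R \<phi> Z))^2) (\<psi> t) R \<phi> Z
   - rho_hat (\<rho> t) R \<phi> Z / R * w t R \<phi> Z * pbracket (\<psi> t) (u t) R \<phi> Z
   - R * \<rho> t R \<phi> Z * (norm (B_field F0 (\<psi> t) R \<phi> Z))^2 * pbracket (u t) (v t) R \<phi> Z
   - R * \<rho> t R \<phi> Z * v t R \<phi> Z
         * pbracket (u t) (\<lambda>R \<phi> Z. (norm (B_field F0 (\<psi> t) R \<phi> Z))^2 / 2) R \<phi> Z
   + R * \<rho> t R \<phi> Z * v t R \<phi> Z
         * pbracket (u t) (\<lambda>R \<phi> Z. (norm (B_pol (\<psi> t) R \<phi> Z))^2 / 2) R \<phi> Z
   - \<rho> t R \<phi> Z * v t R \<phi> Z * (lap_star (\<psi> t) R \<phi> Z / R) * pbracket (u t) (\<psi> t) R \<phi> Z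
   - \<rho> t R \<phi> Z * v t R \<phi> Z / R * pbracket (\<psi> t)
         (\<lambda>R \<phi> Z. grad_pol (\<psi> t) R \<phi> Z \<bullet> grad_pol (u t) R \<phi> Z) R \<phi> Z
   + \<rho> t R \<phi> Z * v t R \<phi> Z * F0 / R^2
         * (grad_pol (\<psi> t) R \<phi> Z \<bullet> grad_pol (\<partial>\<^sub>\<phi> (u t)) R \<phi> Z)
   + \<rho> t R \<phi> Z * v t R \<phi> Z * (F0^2 / R^2) * \<partial>\<^sub>Z (u t) R \<phi> Z"

definition reduced_mhd :: "real \<Rightarrow> real \<Rightarrow> real \<Rightarrow> evolution \<Rightarrow> evolution \<Rightarrow> evolution \<Rightarrow> evolution
    \<Rightarrow> evolution \<Rightarrow> evolution \<Rightarrow> evolution \<Rightarrow> real \<Rightarrow> real \<Rightarrow> real \<Rightarrow> real \<Rightarrow> bool"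
  where "reduced_mhd \<eta> \<nu> F0 \<psi> u w j \<rho> p v t R \<phi> Z \<longleftrightarrow>
     eq_flux \<eta> F0 \<psi> u j t R \<phi> Z
   \<and> eq_vorticity \<nu> F0 \<psi> u w j \<rho> p v t R \<phi> Z
   \<and> w t R \<phi> Z = lap_pol (u t) R \<phi> Z
   \<and> j t R \<phi> Z = lap_star (\<psi> t) R \<phi> Z
   \<and> eq_density F0 \<psi> u \<rho> v t R \<phi> Z
   \<and> eq_pressure F0 \<psi> u p v t R \<phi> Z
   \<and> eq_parallel F0 \<psi> u w \<rho> p v t R \<phi> Z"


section \<open>Regularity, domain and boundary\<close>

text \<open>Meaningful for open \<open>S\<close>.\<close>

primrec C_k_on :: "nat \<Rightarrow> 'a::euclidean_space set \<Rightarrow> ('a \<Rightarrow> real) \<Rightarrow> bool" where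
  "C_k_on 0 S f \<longleftrightarrow> continuous_on S f"
| "C_k_on (Suc k) S f \<longleftrightarrow>
     f differentiable_on S \<and> (\<forall>b\<in>Basis. C_k_on k S (\<lambda>x. frechet_derivative f (at x) b))"

text \<open>
  Outward unit normal at a boundary point near which \<open>D\<close> is the sublevel set \<open>g < 0\<close> of a
  \<open>C\<^sup>1\<close> function with non-vanishing gradient at that point.
\<close>

definition outward_normal :: "(real \<times> real) set \<Rightarrow> real \<times> real \<Rightarrow> real \<times> real \<Rightarrow> bool"
  where "outward_normal D x n \<longleftrightarrow> x \<in> frontier D \<and>
     (\<exists>U g G. open U \<and> x \<in> U \<and> C_k_on 1 U g \<and> D \<inter> U = {y \<in> U. g y < 0}
        \<and> GDERIV g x :> G \<and> G \<noteq> 0 \<and> n = sgn G)"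

text \<open>
  The boundary is \<open>C\<^sup>1\<close> up to a set of exceptional points without interior in the boundary, so
  that for instance corners are allowed. The closure, and not only \<open>D\<close>, avoids the axis, so
  that the coefficients \<open>1 / R\<close> are bounded.
\<close>

definition regular_domain :: "(real \<times> real) set \<Rightarrow> bool"
  where "regular_domain D \<longleftrightarrow> open D \<and> bounded D \<and> closure D \<subseteq> {(R, Z). R > 0}
     \<and> frontier D \<subseteq> closure {x. \<exists>n. outward_normal D x n}"

text \<open>
  Smooth up to the boundary, in the sense of a smooth extension to a neighbourhood of
  \<open>closure D\<close>. The order 3 is the highest order of differentiation that occurs in the
  equations when \<open>w\<close> and \<open>j\<close> count as unknowns.
\<close>

definition sufficiently_smooth :: "real set \<Rightarrow> (real \<times> real) set \<Rightarrow> evolution \<Rightarrow> bool"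
  where "sufficiently_smooth J D f \<longleftrightarrow>
     (\<exists>U. open U \<and> closure D \<subseteq> U
        \<and> C_k_on 3 {(t, R, \<phi>, Z). t \<in> J \<and> (R, Z) \<in> U} (\<lambda>(t, R, \<phi>, Z). f t R \<phi> Z))"

definition phi_periodic :: "real set \<Rightarrow> (real \<times> real) set \<Rightarrow> evolution \<Rightarrow> bool"
  where "phi_periodic J D f \<longleftrightarrow>
     (\<forall>t\<in>J. \<forall>(R, Z)\<in>closure D. \<forall>\<phi>. f t R (\<phi> + 2 * pi) Z = f t R \<phi> Z)"

definition cyl :: "(real \<times> real) set \<Rightarrow> (real \<times> real \<times> real) set"
  where "cyl A = {(R, \<phi>, Z). (R, Z) \<in> A \<and> 0 \<le> \<phi> \<and> \<phi> < 2 * pi}"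

definition normal_derivative :: "scalar_field \<Rightarrow> real \<times> real \<Rightarrow> scalar_field"
  where "normal_derivative f n R \<phi> Z = grad f R \<phi> Z \<bullet> vector [fst n, 0, snd n]"


section \<open>Integration\<close>

definition dV :: "(real \<times> real \<times> real) measure"
  where "dV = lborel"

definition dW :: "(real \<times> real \<times> real) measure"
  where "dW = density dV (\<lambda>(R, \<phi>, Z). ennreal R)"

definition integral_over :: "(real \<times> real) set \<Rightarrow> (real \<times> real \<times> real) measure \<Rightarrow> scalar_field \<Rightarrow> real"
  where "integral_over D M f = set_lebesgue_integral M (cyl D) (\<lambda>(R, \<phi>, Z). f R \<phi> Z)"

end

theory Submission
  imports Defs
begin

text \<open>
  Multiply the flux equation by \<open>- j\<close>, the vorticity equation by \<open>- R u\<close>, the parallel momentum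
  equation by \<open>R v\<close>, the density equation by \<open>R |\<^bold>v|\<^sup>2 / 2\<close> and the pressure equation by \<open>R / (\<gamma> - 1)\<close>: the
  left-hand sides then add up to the time derivative of \<open>R E\<close>, up to divergences. On the right-hand
  sides the brackets are integrated by parts in the form \<open>a [h, b] = [a h, b] - h [a, b]\<close>, where
  \<open>[a h, b]\<close> is a divergence. Afterwards \<open>w\<close> and \<open>j\<close> are no longer differentiated and cancel, the
  pressure terms are a divergence, and the remaining terms are \<open>\<rho>\<close> times an expression that vanishes
  pointwise by the identity \<open>[v, \<psi>] \<nabla>\<psi> \<bullet> \<nabla>u - (\<nabla>v \<bullet> \<nabla>\<psi>) [u, \<psi>] + |\<nabla>\<psi>|\<^sup>2 [u, v] = 0\<close> in the plane.
  The fluxes vanish on the boundary because \<open>\<psi>\<close>, \<open>u\<close>, \<open>\<rho>\<close>, \<open>p\<close> do; only the viscous flux \<open>w \<nabla>u\<close> needs the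
  condition on the normal derivative. The resistive term with \<open>g = \<partial>\<^sub>\<phi> \<psi> / R\<^sup>2\<close> uses
  \<open>\<nabla>(R\<^sup>2 g) \<bullet> \<nabla>g / R = R |\<nabla>g|\<^sup>2 + \<partial>\<^sub>R (g\<^sup>2)\<close>.
\<close>

section \<open>Functions of class \<open>C\<^sup>k\<close>\<close>

text \<open>The shape of the vorticity and momentum equations follows from the cross term - 2 v
  \<nabla>\<psi> \<bullet> \<nabla>u in the squared velocity. Its time derivative splits in two: the
  part that differentiates v \<nabla>\<psi> is the second divergence of the vorticity equation
  tested with u, the part that differentiates \<nabla>u is the last term on the left of the parallel
  momentum equation times v. One obstacle is the boundary, which is regular only on a dense set. No
  divergence theorem is invoked: every flux that is integrated vanishes on the frontier, so each
  single partial derivative integrates to zero line by line, by Fubini and the fundamental theorem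
  on open subsets of the real line. Normals serve only to turn the condition on the normal
  derivative of u into a vanishing gradient. The other obstacle is size. The balance is cut into
  seven fields \<open>N1\<close> to \<open>N7\<close> of zero integral, differentiated products stay
  opaque wherever possible, and the remaining algebra is isolated in lemmas about real
  numbers.\<close>

lemma C_k_on_cong:
  assumes "open S" "\<And>x. x \<in> S \<Longrightarrow> f x = g x" "C_k_on k S f"
  shows "C_k_on k S g"
  using assms(2,3)
proof (induction k arbitrary: f g)
  case 0
  then show ?case by (auto cong: continuous_on_cong)
next
  case (Suc k)
  have d: "f differentiable at x" if "x \<in> S" for x
    using Suc.prems(2) that \<open>open S\<close> by (auto simp: differentiable_on_eq_differentiable_at)
  have fr: "frechet_derivative f (at x) = frechet_derivative g (at x)" if "x \<in> S" for x
    using frechet_derivative_transform_within_open[OF d \<open>open S\<close> that Suc.prems(1)] that by auto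
  have "g differentiable_on S"
    unfolding differentiable_on_eq_differentiable_at[OF \<open>open S\<close>]
  proof
    fix x assume x: "x \<in> S"
    from d[OF x] obtain f' where "(f has_derivative f') (at x)" by (auto simp: differentiable_def)
    from has_derivative_transform_within_open[OF this \<open>open S\<close> x Suc.prems(1)]
    show "g differentiable at x" by (auto simp: differentiable_def)
  qed
  moreover have "C_k_on k S (\<lambda>x. frechet_derivative g (at x) b)" if "b \<in> Basis" for b
    using Suc.IH[of "\<lambda>x. frechet_derivative f (at x) b" "\<lambda>x. frechet_derivative g (at x) b"]
      Suc.prems(2) fr that by auto
  ultimately show ?case by simp
qed

lemma C_k_on_subset: "C_k_on k S f \<Longrightarrow> T \<subseteq> S \<Longrightarrow> C_k_on k T f"
  by (induction k arbitrary: f) (auto intro: continuous_on_subset differentiable_on_subset)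

lemma C_k_on_Suc_D: "C_k_on (Suc k) S f \<Longrightarrow> C_k_on k S f"
  by (induction k arbitrary: f) (auto intro: differentiable_imp_continuous_on)

lemma C_k_on_mono: "C_k_on n S f \<Longrightarrow> m \<le> n \<Longrightarrow> C_k_on m S f"
  by (induction n) (auto simp: le_Suc_eq dest: C_k_on_Suc_D simp del: C_k_on.simps(2))

lemma C_k_on_differentiable_at:
  "C_k_on (Suc k) S f \<Longrightarrow> open S \<Longrightarrow> x \<in> S \<Longrightarrow> f differentiable at x"
  by (auto simp: differentiable_on_eq_differentiable_at)

lemma C_k_on_has_derivative:
  "C_k_on (Suc k) S f \<Longrightarrow> open S \<Longrightarrow> x \<in> S \<Longrightarrow> (f has_derivative frechet_derivative f (at x)) (at x)"
  by (metis C_k_on_differentiable_at frechet_derivative_works)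

text \<open>The recursion speaks of the chosen \<open>frechet_derivative\<close>. Uniqueness of
  derivatives lets any explicit \<open>f'\<close> take its place, which makes the calculus rules
  below plain inductions on the order.\<close>

lemma C_k_on_SucI:
  assumes "open S" "\<And>x. x \<in> S \<Longrightarrow> (f has_derivative f' x) (at x)"
    and "\<And>b. b \<in> Basis \<Longrightarrow> C_k_on k S (\<lambda>x. f' x b)"
  shows "C_k_on (Suc k) S f"
proof -
  have "f differentiable_on S"
    using assms(1,2) by (auto simp: differentiable_on_eq_differentiable_at differentiable_def)
  moreover have "C_k_on k S (\<lambda>x. frechet_derivative f (at x) b)" if "b \<in> Basis" for b
    by (rule C_k_on_cong[OF assms(1) _ assms(3)[OF that]]) (metis assms(2) frechet_derivative_at)
  ultimately show ?thesis by simp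
qed

lemma C_k_on_const: "C_k_on k S (\<lambda>x. c)"
  by (induction k arbitrary: c) auto

lemma C_k_on_linear:
  assumes "bounded_linear f" "open S" shows "C_k_on k S f"
proof (cases k)
  case 0
  then show ?thesis using assms by (simp add: linear_continuous_on)
next
  case (Suc n)
  show ?thesis unfolding Suc
    by (rule C_k_on_SucI[OF assms(2), where f'="\<lambda>x. f"])
      (auto intro: bounded_linear_imp_has_derivative assms C_k_on_const)
qed

lemma C_k_on_add:
  assumes "open S" shows "C_k_on k S f \<Longrightarrow> C_k_on k S g \<Longrightarrow> C_k_on k S (\<lambda>x. f x + g x)"
proof (induction k arbitrary: f g)
  case 0
  then show ?case by (auto intro: continuous_intros)
next
  case (Suc k)
  show ?case
    by (rule C_k_on_SucI[OF assms, where f'="\<lambda>x h. frechet_derivative f (at x) h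
        + frechet_derivative g (at x) h"])
      (use Suc in \<open>auto intro!: has_derivative_add C_k_on_has_derivative[of k S] assms\<close>)
qed

lemma C_k_on_mult:
  assumes "open S" shows "C_k_on k S f \<Longrightarrow> C_k_on k S g \<Longrightarrow> C_k_on k S (\<lambda>x. f x * g x)"
proof (induction k arbitrary: f g)
  case 0
  then show ?case by (auto intro: continuous_intros)
next
  case (Suc k)
  show ?case
  proof (rule C_k_on_SucI[OF assms])
    fix x assume "x \<in> S"
    then show "((\<lambda>x. f x * g x) has_derivative
        (\<lambda>h. f x * frechet_derivative g (at x) h + frechet_derivative f (at x) h * g x)) (at x)"
      using Suc.prems by (intro has_derivative_mult C_k_on_has_derivative[of k S] assms)
  next
    fix b :: 'a assume "b \<in> Basis"
    with Suc show "C_k_on k S (\<lambda>x. f x * frechet_derivative g (at x) b + frechet_derivative f (at x) b * g x)"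
      by (intro C_k_on_add assms Suc.IH) (auto dest: C_k_on_Suc_D simp del: C_k_on.simps, auto)
  qed
qed

lemma C_k_on_minus: "open S \<Longrightarrow> C_k_on k S f \<Longrightarrow> C_k_on k S (\<lambda>x. - f x)"
  using C_k_on_mult[OF _ C_k_on_const[of k S "-1"], of f] by simp

lemma C_k_on_diff: "open S \<Longrightarrow> C_k_on k S f \<Longrightarrow> C_k_on k S g \<Longrightarrow> C_k_on k S (\<lambda>x. f x - g x)"
  using C_k_on_add[OF _ _ C_k_on_minus, of S k f g] by simp

text \<open>The derivative of the inverse contains the inverse itself, so the statement at order
  \<open>k\<close> feeds the product rule that proves it at order \<open>Suc k\<close>.\<close>

lemma C_k_on_inverse:
  assumes "open S" "\<And>x. x \<in> S \<Longrightarrow> f x \<noteq> 0"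
  shows "C_k_on k S f \<Longrightarrow> C_k_on k S (\<lambda>x. inverse (f x))"
proof (induction k)
  case 0
  then show ?case using assms(2) by (auto intro!: continuous_intros)
next
  case (Suc k)
  have lower: "C_k_on k S f" by (rule C_k_on_Suc_D[OF Suc.prems])
  show ?case
  proof (rule C_k_on_SucI[OF assms(1)])
    fix x assume "x \<in> S"
    then show "((\<lambda>x. inverse (f x)) has_derivative
        (\<lambda>h. - (inverse (f x) * frechet_derivative f (at x) h * inverse (f x)))) (at x)"
      using Suc.prems assms by (intro Deriv.has_derivative_inverse C_k_on_has_derivative[of k S])
  next
    fix b :: 'a assume "b \<in> Basis"
    with Suc lower show "C_k_on k S (\<lambda>x. - (inverse (f x) * frechet_derivative f (at x) b * inverse (f x)))"
      by (intro C_k_on_minus C_k_on_mult assms) auto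
  qed
qed

text \<open>Basis vectors of the second factor are basis vectors \<open>(0, b)\<close> of the
  product, so the derivatives of a slice are slices of derivatives. Used to freeze the time.\<close>

lemma C_k_on_slice:
  fixes f :: "'a::euclidean_space \<times> 'b::euclidean_space \<Rightarrow> real"
  assumes "open S"
  shows "C_k_on k S f \<Longrightarrow> C_k_on k {x. (t, x) \<in> S} (\<lambda>x. f (t, x))"
proof (induction k arbitrary: f)
  case 0
  then show ?case
    by (auto intro!: continuous_on_compose2[of S f] continuous_intros)
next
  case (Suc k)
  have "open ((\<lambda>x. (t, x)) -` S)"
    by (intro open_vimage assms continuous_intros)
  then have o: "open {x. (t, x) \<in> S}" by (simp add: vimage_def)
  show ?case
  proof (rule C_k_on_SucI[OF o])
    fix x assume "x \<in> {x. (t, x) \<in> S}"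
    then have "(f has_derivative frechet_derivative f (at (t, x))) (at (t, x))"
      using Suc.prems assms by (intro C_k_on_has_derivative) auto
    moreover have "((\<lambda>x. (t, x)) has_derivative (\<lambda>h. (0, h))) (at x)"
      by (auto intro!: derivative_eq_intros)
    ultimately show "((\<lambda>x. f (t, x)) has_derivative (\<lambda>h. frechet_derivative f (at (t, x)) (0, h))) (at x)"
      by (rule has_derivative_compose[rotated])
  next
    fix b :: 'b assume "b \<in> Basis"
    then have "(0, b) \<in> Basis" by (auto simp: Basis_prod_def)
    with Suc.prems Suc.IH[of "\<lambda>x. frechet_derivative f (at x) (0, b)"]
    show "C_k_on k {x. (t, x) \<in> S} (\<lambda>x. frechet_derivative f (at (t, x)) (0, b))"
      by auto
  qed
qed

text \<open>The mean value theorem is applied twice: to the increment in direction \<open>b\<close>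
  as a function of the step along \<open>a\<close>, then to the derivative along \<open>a\<close> as
  a function of the step along \<open>b\<close>. The left side is symmetric in \<open>a\<close> and
  \<open>b\<close>. The parallelogram stays within distance \<open>2 * t\<close> of
  \<open>x\<close>, hence inside the ball of radius \<open>3 * t\<close>.\<close>

lemma second_difference_eq:
  fixes f :: "'a::euclidean_space \<Rightarrow> real"
  assumes S: "open S" and f: "C_k_on 2 S f" and a: "a \<in> Basis" and b: "b \<in> Basis"
    and t: "0 < t" and ball: "ball x (3 * t) \<subseteq> S"
  shows "\<exists>p. dist x p < 3 * t \<and>
    f (x + t *\<^sub>R a + t *\<^sub>R b) - f (x + t *\<^sub>R a) - f (x + t *\<^sub>R b) + f x
     = t * t * frechet_derivative (\<lambda>y. frechet_derivative f (at y) a) (at p) b"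
proof -
  let ?fa = "\<lambda>y. frechet_derivative f (at y) a"
  have fa1: "C_k_on 1 S ?fa" and f1: "C_k_on (Suc 1) S f"
    using f a by (auto simp: numeral_2_eq_2)
  have in_ball: "dist x (x + s *\<^sub>R a + r *\<^sub>R b) < 3 * t" if "0 \<le> s" "s \<le> t" "0 \<le> r" "r \<le> t" for s r
  proof -
    have "dist x (x + s *\<^sub>R a + r *\<^sub>R b) = norm (s *\<^sub>R a + r *\<^sub>R b)"
      by (metis add.assoc add_diff_cancel_left' dist_commute dist_norm)
    also have "\<dots> \<le> s + r"
      using norm_triangle_ineq[of "s *\<^sub>R a" "r *\<^sub>R b"] a b that by simp
    finally show ?thesis using that t by linarith
  qed
  have mem: "x + s *\<^sub>R a + r *\<^sub>R b \<in> S" if "0 \<le> s" "s \<le> t" "0 \<le> r" "r \<le> t" for s r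
    using in_ball[OF that] ball by auto
  have Da: "((\<lambda>s. f (x + s *\<^sub>R a + r *\<^sub>R b)) has_real_derivative ?fa (x + s *\<^sub>R a + r *\<^sub>R b)) (at s)"
    if "0 \<le> s" "s \<le> t" "0 \<le> r" "r \<le> t" for s r
  proof -
    have h: "(f has_derivative frechet_derivative f (at (x + s *\<^sub>R a + r *\<^sub>R b))) (at (x + s *\<^sub>R a + r
        *\<^sub>R b))"
      by (rule C_k_on_has_derivative[OF f1 S mem[OF that]])
    have g: "((\<lambda>s. x + s *\<^sub>R a + r *\<^sub>R b) has_derivative (\<lambda>h. h *\<^sub>R a)) (at s)"
      by (auto intro!: derivative_eq_intros)
    have "((\<lambda>s. f (x + s *\<^sub>R a + r *\<^sub>R b)) has_derivative
       (\<lambda>k. frechet_derivative f (at (x + s *\<^sub>R a + r *\<^sub>R b)) (k *\<^sub>R a))) (at s)"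
      by (rule has_derivative_compose[OF g h])
    then show ?thesis
      using linear_cmul[OF has_derivative_linear[OF h]]
      by (simp add: has_field_derivative_def mult.commute[of "frechet_derivative _ _ _"] mult_commute_abs)
  qed
  have Db: "((\<lambda>r. ?fa (x + s *\<^sub>R a + r *\<^sub>R b)) has_real_derivative
      frechet_derivative ?fa (at (x + s *\<^sub>R a + r *\<^sub>R b)) b) (at r)"
    if "0 \<le> s" "s \<le> t" "0 \<le> r" "r \<le> t" for s r
  proof -
    have h: "(?fa has_derivative frechet_derivative ?fa (at (x + s *\<^sub>R a + r *\<^sub>R b))) (at (x + s *\<^sub>R a + r
        *\<^sub>R b))"
      using C_k_on_has_derivative[of 0 S ?fa] fa1 S mem[OF that] by simp
    have g: "((\<lambda>r. x + s *\<^sub>R a + r *\<^sub>R b) has_derivative (\<lambda>h. h *\<^sub>R b)) (at r)"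
      by (auto intro!: derivative_eq_intros)
    have "((\<lambda>r. ?fa (x + s *\<^sub>R a + r *\<^sub>R b)) has_derivative
       (\<lambda>k. frechet_derivative ?fa (at (x + s *\<^sub>R a + r *\<^sub>R b)) (k *\<^sub>R b))) (at r)"
      by (rule has_derivative_compose[OF g h])
    then show ?thesis
      using linear_cmul[OF has_derivative_linear[OF h]]
      by (simp add: has_field_derivative_def mult.commute[of "frechet_derivative _ _ _"] mult_commute_abs)
  qed
  have "((\<lambda>s. f (x + s *\<^sub>R a + t *\<^sub>R b) - f (x + s *\<^sub>R a)) has_real_derivative
      ?fa (x + s *\<^sub>R a + t *\<^sub>R b) - ?fa (x + s *\<^sub>R a)) (at s)" if "0 \<le> s" "s \<le> t" for s
    using DERIV_diff[OF Da[of s t] Da[of s 0]] that t by auto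
  from MVT2[OF t, of "\<lambda>s. f (x + s *\<^sub>R a + t *\<^sub>R b) - f (x + s *\<^sub>R a)", OF this]
  obtain s where s: "0 < s" "s < t"
    and 1: "f (x + t *\<^sub>R a + t *\<^sub>R b) - f (x + t *\<^sub>R a) - (f (x + t *\<^sub>R b) - f x)
      = t * (?fa (x + s *\<^sub>R a + t *\<^sub>R b) - ?fa (x + s *\<^sub>R a))"
    by auto
  from MVT2[OF t, of "\<lambda>r. ?fa (x + s *\<^sub>R a + r *\<^sub>R b)", OF Db[of s]] s
  obtain r where r: "0 < r" "r < t"
    and 2: "?fa (x + s *\<^sub>R a + t *\<^sub>R b) - ?fa (x + s *\<^sub>R a)
      = t * frechet_derivative ?fa (at (x + s *\<^sub>R a + r *\<^sub>R b)) b"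
    by auto
  show ?thesis
    using in_ball[of s r] s r 1 2 by (intro exI[of _ "x + s *\<^sub>R a + r *\<^sub>R b"]) auto
qed

text \<open>One and the same second difference equals \<open>t * t\<close> times either mixed
  derivative, taken at two points near \<open>x\<close>. Continuity then leaves no room for a gap at
  \<open>x\<close>.\<close>

lemma mixed_derivatives_commute:
  fixes f :: "'a::euclidean_space \<Rightarrow> real"
  assumes S: "open S" and f: "C_k_on 2 S f" and a: "a \<in> Basis" and b: "b \<in> Basis" and x: "x \<in> S"
  shows "frechet_derivative (\<lambda>y. frechet_derivative f (at y) a) (at x) b
       = frechet_derivative (\<lambda>y. frechet_derivative f (at y) b) (at x) a"
    (is "?fab x = ?fba x")
proof (rule ccontr)
  assume ne: "?fab x \<noteq> ?fba x"
  \<comment> \<open>Half of the gap: values within \<open>e\<close> of the two limits cannot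
    coincide.\<close>
  define e where "e = \<bar>?fab x - ?fba x\<bar> / 2"
  have e: "e > 0" using ne by (simp add: e_def)
  have "continuous_on S ?fab" "continuous_on S ?fba"
    using f a b by (auto simp: numeral_2_eq_2)
  then have "isCont ?fab x" "isCont ?fba x"
    using S x by (auto simp: continuous_on_eq_continuous_at)
  then have "\<forall>\<^sub>F p in nhds x. dist (?fab p) (?fab x) < e \<and> dist (?fba p) (?fba x) < e"
    using e by (intro eventually_conj) (auto simp: isCont_def tendsto_iff eventually_nhds_conv_at)
  then obtain d where d: "d > 0"
    "\<And>p. dist p x < d \<Longrightarrow> dist (?fab p) (?fab x) < e \<and> dist (?fba p) (?fba x) < e"
    by (auto simp: eventually_nhds_metric)
  obtain r where r: "r > 0" "ball x r \<subseteq> S"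
    using S x openE by blast
  define t where "t = min d r / 3"
  have t: "0 < t" "3 * t \<le> d" "ball x (3 * t) \<subseteq> S"
    using d(1) r by (auto simp: t_def)
  obtain p where p: "dist x p < 3 * t"
    "f (x + t *\<^sub>R a + t *\<^sub>R b) - f (x + t *\<^sub>R a) - f (x + t *\<^sub>R b) + f x = t * t * ?fab p"
    using second_difference_eq[OF S f a b t(1,3)] by blast
  obtain q where q: "dist x q < 3 * t"
    "f (x + t *\<^sub>R b + t *\<^sub>R a) - f (x + t *\<^sub>R b) - f (x + t *\<^sub>R a) + f x = t * t * ?fba q"
    using second_difference_eq[OF S f b a t(1,3)] by blast
  have "t * t * ?fab p = t * t * ?fba q"
    using p(2) q(2) by (simp add: algebra_simps)
  then have "?fab p = ?fba q" using t by simp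
  moreover have "dist (?fab p) (?fab x) < e" "dist (?fba q) (?fba x) < e"
    using d(2)[of p] d(2)[of q] p(1) q(1) t by (auto simp: dist_commute)
  ultimately show False
    unfolding e_def dist_real_def by (auto simp: abs_if field_simps split: if_splits)
qed

section \<open>Smooth fields and their partial derivatives\<close>

text \<open>Along coordinate lines this ties the one-variable derivatives in the definitions of the
  partial derivatives to the Frechet derivatives in \<open>C_k_on\<close>.\<close>

lemma curve_derivative:
  fixes F :: "'a::real_normed_vector \<Rightarrow> real"
  assumes "(F has_derivative F') (at (g r))" "(g has_vector_derivative b) (at r)"
  shows "((\<lambda>r. F (g r)) has_real_derivative F' b) (at r)"
proof -
  have "((\<lambda>r. F (g r)) has_derivative (\<lambda>h. F' (h *\<^sub>R b))) (at r)"
    using has_derivative_compose[OF assms(2)[unfolded has_vector_derivative_def] assms(1)] .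
  then show ?thesis
    using linear_cmul[OF has_derivative_linear[OF assms(1)]]
    by (simp add: has_field_derivative_def mult_commute_abs)
qed

text \<open>The angle is unrestricted although integrals only run over one period. This keeps the
  set open, so two-sided \<phi>-derivatives exist at the angle 0 as well.\<close>

definition smooth_field :: "(real \<times> real) set \<Rightarrow> nat \<Rightarrow> scalar_field \<Rightarrow> bool"
  where "smooth_field U k f \<longleftrightarrow> C_k_on k {(R, \<phi>, Z). (R, Z) \<in> U} (\<lambda>(R, \<phi>, Z). f R \<phi> Z)"

definition smooth_evolution :: "real set \<Rightarrow> (real \<times> real) set \<Rightarrow> nat \<Rightarrow> evolution \<Rightarrow> bool"
  where "smooth_evolution J U k f \<longleftrightarrow>
    C_k_on k (J \<times> {(R, \<phi>, Z). (R, Z) \<in> U}) (\<lambda>(t, R, \<phi>, Z). f t R \<phi> Z)"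

text \<open>\<open>U\<close> is a neighbourhood of the closed poloidal domain to which all fields
  extend; positivity of R makes the coefficients 1 / R smooth there.\<close>

locale poloidal_region =
  fixes U :: "(real \<times> real) set"
  assumes open_U: "open U" and R_pos: "(R, Z) \<in> U \<Longrightarrow> R > 0"
begin

abbreviation "sm \<equiv> smooth_field U"
abbreviation "\<Omega> \<equiv> {(R, \<phi>::real, Z). (R, Z) \<in> U}"
abbreviation uncurry3 :: "scalar_field \<Rightarrow> real \<times> real \<times> real \<Rightarrow> real"
  where "uncurry3 f \<equiv> (\<lambda>(R, \<phi>, Z). f R \<phi> Z)"

lemma open_\<Omega>: "open \<Omega>"
proof -
  have "\<Omega> = (\<lambda>x. (fst x, snd (snd x))) -` U" by auto
  then show ?thesis by (simp add: open_vimage open_U continuous_intros)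
qed

lemma sm_lower: "sm n f \<Longrightarrow> m \<le> n \<Longrightarrow> sm m f"
  unfolding smooth_field_def by (rule C_k_on_mono)

lemma sm_has_derivative:
  "sm (Suc k) f \<Longrightarrow> (R, Z) \<in> U \<Longrightarrow>
    (uncurry3 f has_derivative frechet_derivative (uncurry3 f) (at (R, \<phi>, Z))) (at (R, \<phi>, Z))"
  unfolding smooth_field_def by (rule C_k_on_has_derivative) (auto simp: open_\<Omega>)

lemma sm_deriv_frechet:
  assumes "sm (Suc k) f" "(R, Z) \<in> U"
  shows "((\<lambda>r. f r \<phi> Z) has_real_derivative frechet_derivative (uncurry3 f) (at (R, \<phi>, Z)) (1, 0, 0)) (at R)"
    and "((\<lambda>s. f R s Z) has_real_derivative frechet_derivative (uncurry3 f) (at (R, \<phi>, Z)) (0, 1, 0)) (at \<phi>)"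
    and "((\<lambda>z. f R \<phi> z) has_real_derivative frechet_derivative (uncurry3 f) (at (R, \<phi>, Z)) (0, 0, 1)) (at Z)"
proof -
  note F = sm_has_derivative[OF assms, of \<phi>]
  have "((\<lambda>r. (r, \<phi>, Z)) has_vector_derivative (1, 0, 0)) (at R)"
    unfolding has_vector_derivative_def by (auto intro!: derivative_eq_intros simp: zero_prod_def)
  from curve_derivative[OF F this]
  show "((\<lambda>r. f r \<phi> Z) has_real_derivative frechet_derivative (uncurry3 f) (at (R, \<phi>, Z)) (1, 0, 0)) (at R)"
    by simp
  have "((\<lambda>s. (R, s, Z)) has_vector_derivative (0, 1, 0)) (at \<phi>)"
    unfolding has_vector_derivative_def by (auto intro!: derivative_eq_intros simp: zero_prod_def)
  from curve_derivative[OF F this]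
  show "((\<lambda>s. f R s Z) has_real_derivative frechet_derivative (uncurry3 f) (at (R, \<phi>, Z)) (0, 1, 0)) (at \<phi>)"
    by simp
  have "((\<lambda>z. (R, \<phi>, z)) has_vector_derivative (0, 0, 1)) (at Z)"
    unfolding has_vector_derivative_def by (auto intro!: derivative_eq_intros simp: zero_prod_def)
  from curve_derivative[OF F this]
  show "((\<lambda>z. f R \<phi> z) has_real_derivative frechet_derivative (uncurry3 f) (at (R, \<phi>, Z)) (0, 0, 1)) (at Z)"
    by simp
qed

lemma partial_frechet:
  assumes "sm (Suc k) f" "(R, Z) \<in> U"
  shows "\<partial>\<^sub>R f R \<phi> Z = frechet_derivative (uncurry3 f) (at (R, \<phi>, Z)) (1, 0, 0)"
    and "\<partial>\<^sub>\<phi> f R \<phi> Z = frechet_derivative (uncurry3 f) (at (R, \<phi>, Z)) (0, 1, 0)"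
    and "\<partial>\<^sub>Z f R \<phi> Z = frechet_derivative (uncurry3 f) (at (R, \<phi>, Z)) (0, 0, 1)"
  unfolding partial_R_def partial_phi_def partial_Z_def
  by (auto intro!: DERIV_imp_deriv sm_deriv_frechet assms)

lemma sm_deriv:
  assumes "sm (Suc k) f" "(R, Z) \<in> U"
  shows "((\<lambda>r. f r \<phi> Z) has_real_derivative \<partial>\<^sub>R f R \<phi> Z) (at R)"
    and "((\<lambda>s. f R s Z) has_real_derivative \<partial>\<^sub>\<phi> f R \<phi> Z) (at \<phi>)"
    and "((\<lambda>z. f R \<phi> z) has_real_derivative \<partial>\<^sub>Z f R \<phi> Z) (at Z)"
  using sm_deriv_frechet[OF assms] partial_frechet[OF assms] by simp_all

lemma Basis3: "(1, 0, 0) \<in> (Basis :: (real \<times> real \<times> real) set)"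
  "(0, 1, 0) \<in> (Basis :: (real \<times> real \<times> real) set)"
  "(0, 0, 1) \<in> (Basis :: (real \<times> real \<times> real) set)"
  by (auto simp: Basis_prod_def zero_prod_def)

lemma sm_frechet:
  assumes "sm (Suc k) f" "b \<in> Basis"
  shows "C_k_on k \<Omega> (\<lambda>x. frechet_derivative (uncurry3 f) (at x) b)"
  using assms unfolding smooth_field_def by simp

lemma sm_partial:
  assumes "sm (Suc k) f"
  shows "sm k (\<partial>\<^sub>R f)" "sm k (\<partial>\<^sub>\<phi> f)" "sm k (\<partial>\<^sub>Z f)"
proof -
  show "sm k (\<partial>\<^sub>R f)" unfolding smooth_field_def
    by (rule C_k_on_cong[OF open_\<Omega> _ sm_frechet[OF assms Basis3(1)]]) (auto simp: partial_frechet[OF assms])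
  show "sm k (\<partial>\<^sub>\<phi> f)" unfolding smooth_field_def
    by (rule C_k_on_cong[OF open_\<Omega> _ sm_frechet[OF assms Basis3(2)]]) (auto simp: partial_frechet[OF assms])
  show "sm k (\<partial>\<^sub>Z f)" unfolding smooth_field_def
    by (rule C_k_on_cong[OF open_\<Omega> _ sm_frechet[OF assms Basis3(3)]]) (auto simp: partial_frechet[OF assms])
qed

lemma sm_cong:
  assumes "sm k f" "\<And>R \<phi> Z. (R, Z) \<in> U \<Longrightarrow> f R \<phi> Z = g R \<phi> Z"
  shows "sm k g"
proof -
  have "C_k_on k \<Omega> (uncurry3 f)" using assms(1) by (simp add: smooth_field_def)
  from C_k_on_cong[OF open_\<Omega> _ this, of "uncurry3 g"] show ?thesis
    using assms(2) by (auto simp: smooth_field_def)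
qed

lemma slices_eventually:
  assumes "(R, Z) \<in> U"
  shows "\<forall>\<^sub>F r in nhds R. (r, Z) \<in> U" "\<forall>\<^sub>F z in nhds Z. (R, z) \<in> U"
proof -
  have "open ((\<lambda>r. (r, Z)) -` U)" by (intro open_vimage open_U continuous_intros)
  then show "\<forall>\<^sub>F r in nhds R. (r, Z) \<in> U" using assms eventually_nhds_in_open by fastforce
  have "open ((\<lambda>z. (R, z)) -` U)" by (intro open_vimage open_U continuous_intros)
  then show "\<forall>\<^sub>F z in nhds Z. (R, z) \<in> U" using assms eventually_nhds_in_open by fastforce
qed

text \<open>Partial derivatives are local, and openness of \<open>U\<close> keeps nearby points of
  each coordinate line in \<open>U\<close>. This allows differentiating identities that hold only on
  \<open>U\<close>.\<close>

lemma partial_cong: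
  assumes "\<And>R \<phi> Z. (R, Z) \<in> U \<Longrightarrow> f R \<phi> Z = g R \<phi> Z" "(R, Z) \<in> U"
  shows "\<partial>\<^sub>R f R \<phi> Z = \<partial>\<^sub>R g R \<phi> Z" "\<partial>\<^sub>\<phi> f R \<phi> Z = \<partial>\<^sub>\<phi> g R \<phi> Z" "\<partial>\<^sub>Z f R \<phi> Z = \<partial>\<^sub>Z g R \<phi> Z"
  unfolding partial_R_def partial_phi_def partial_Z_def
  using slices_eventually[OF assms(2)] assms
  by (auto intro!: deriv_cong_ev elim!: eventually_mono)

lemma sm_commute:
  assumes f: "sm 2 f" and x: "(R, Z) \<in> U"
  shows "\<partial>\<^sub>Z (\<partial>\<^sub>R f) R \<phi> Z = \<partial>\<^sub>R (\<partial>\<^sub>Z f) R \<phi> Z"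
    and "\<partial>\<^sub>\<phi> (\<partial>\<^sub>R f) R \<phi> Z = \<partial>\<^sub>R (\<partial>\<^sub>\<phi> f) R \<phi> Z"
    and "\<partial>\<^sub>\<phi> (\<partial>\<^sub>Z f) R \<phi> Z = \<partial>\<^sub>Z (\<partial>\<^sub>\<phi> f) R \<phi> Z"
proof -
  have f1: "sm (Suc (Suc 0)) f" using f by (simp add: numeral_2_eq_2)
  have C2: "C_k_on 2 \<Omega> (uncurry3 f)" using f by (simp add: smooth_field_def)
  have xO: "(R, \<phi>, Z) \<in> \<Omega>" using x by simp
  note mixed = mixed_derivatives_commute[OF open_\<Omega> C2 _ _ xO]
  let ?D = "\<lambda>b y. frechet_derivative (uncurry3 f) (at y) b"
  have D: "uncurry3 g differentiable at (R, \<phi>, Z)" if "sm (Suc 0) g" for g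
    using sm_has_derivative[OF that x] by (auto simp: differentiable_def)
  \<comment> \<open>The partial derivatives agree with components of the Frechet derivative only on
    \<open>\<Omega>\<close>; since it is open, the agreement survives one more
    differentiation.\<close>
  have eq: "frechet_derivative (uncurry3 (\<partial>\<^sub>R f)) (at (R, \<phi>, Z))
      = frechet_derivative (?D (1, 0, 0)) (at (R, \<phi>, Z))"
    "frechet_derivative (uncurry3 (\<partial>\<^sub>\<phi> f)) (at (R, \<phi>, Z)) = frechet_derivative (?D (0, 1, 0)) (at (R, \<phi>, Z))"
    "frechet_derivative (uncurry3 (\<partial>\<^sub>Z f)) (at (R, \<phi>, Z)) = frechet_derivative (?D (0, 0, 1)) (at (R, \<phi>, Z))"
    by (rule frechet_derivative_transform_within_open[OF D[OF sm_partial(1)[OF f1]] open_\<Omega> xO]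
             frechet_derivative_transform_within_open[OF D[OF sm_partial(2)[OF f1]] open_\<Omega> xO]
             frechet_derivative_transform_within_open[OF D[OF sm_partial(3)[OF f1]] open_\<Omega> xO],
        auto simp: partial_frechet[OF f1])+
  show "\<partial>\<^sub>Z (\<partial>\<^sub>R f) R \<phi> Z = \<partial>\<^sub>R (\<partial>\<^sub>Z f) R \<phi> Z" "\<partial>\<^sub>\<phi> (\<partial>\<^sub>R f) R \<phi> Z = \<partial>\<^sub>R (\<partial>\<^sub>\<phi> f) R \<phi> Z"
    "\<partial>\<^sub>\<phi> (\<partial>\<^sub>Z f) R \<phi> Z = \<partial>\<^sub>Z (\<partial>\<^sub>\<phi> f) R \<phi> Z"
    using mixed[OF Basis3(1) Basis3(3)] mixed[OF Basis3(1) Basis3(2)] mixed[OF Basis3(2) Basis3(3)]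
    by (simp_all add: partial_frechet[OF sm_partial(1)[OF f1] x] partial_frechet[OF sm_partial(2)[OF f1] x]
        partial_frechet[OF sm_partial(3)[OF f1] x] eq)
qed

lemma sm_const: "sm k (\<lambda>R \<phi> Z. c)"
  unfolding smooth_field_def using C_k_on_const[of k \<Omega> c] by (simp add: case_prod_unfold)

lemma sm_R: "sm k (\<lambda>R \<phi> Z. R)"
  unfolding smooth_field_def using C_k_on_linear[OF bounded_linear_fst open_\<Omega>, of k]
  by (simp add: case_prod_unfold)

lemma sm_add: "sm k f \<Longrightarrow> sm k g \<Longrightarrow> sm k (\<lambda>R \<phi> Z. f R \<phi> Z + g R \<phi> Z)"
  unfolding smooth_field_def case_prod_unfold using C_k_on_add[OF open_\<Omega>] by (simp add: case_prod_unfold)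

lemma sm_mult: "sm k f \<Longrightarrow> sm k g \<Longrightarrow> sm k (\<lambda>R \<phi> Z. f R \<phi> Z * g R \<phi> Z)"
  unfolding smooth_field_def case_prod_unfold using C_k_on_mult[OF open_\<Omega>] by (simp add: case_prod_unfold)

lemma sm_inverse_R: "sm k (\<lambda>R \<phi> Z. inverse R)"
proof -
  have "C_k_on k \<Omega> (\<lambda>x. inverse (fst x))"
    by (rule C_k_on_inverse[OF open_\<Omega>])
      (use R_pos in \<open>force intro: C_k_on_linear[OF bounded_linear_fst open_\<Omega>]\<close>)+
  then show ?thesis unfolding smooth_field_def by (simp add: case_prod_unfold)
qed

lemma sm_power: "sm k f \<Longrightarrow> sm k (\<lambda>R \<phi> Z. f R \<phi> Z ^ n)"
  by (induction n) (auto intro: sm_const sm_mult)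

lemma sm_divide_R: "sm k f \<Longrightarrow> sm k (\<lambda>R \<phi> Z. f R \<phi> Z / R)"
  using sm_mult[OF _ sm_inverse_R] by (simp add: divide_inverse)

lemma sm_divide_R_power: "sm k f \<Longrightarrow> sm k (\<lambda>R \<phi> Z. f R \<phi> Z / R ^ n)"
  using sm_mult[OF _ sm_power[OF sm_inverse_R]] by (simp add: divide_inverse power_inverse)

lemma sm_divide_const: "sm k f \<Longrightarrow> sm k (\<lambda>R \<phi> Z. f R \<phi> Z / c)"
  using sm_mult[OF _ sm_const, of k f "inverse c"] by (simp add: divide_inverse)

lemma sm_continuous: "sm k f \<Longrightarrow> continuous_on \<Omega> (uncurry3 f)"
  using sm_lower[of k f 0] by (simp add: smooth_field_def)

end

section \<open>Time-dependent fields\<close>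

locale evolution_region = poloidal_region +
  fixes J :: "real set"
  assumes open_J: "open J"
begin

abbreviation "ev \<equiv> smooth_evolution J U"
abbreviation "\<W> \<equiv> J \<times> \<Omega>"
abbreviation uncurry4 :: "evolution \<Rightarrow> real \<times> real \<times> real \<times> real \<Rightarrow> real"
  where "uncurry4 f \<equiv> (\<lambda>(t, R, \<phi>, Z). f t R \<phi> Z)"

lemma open_\<W>: "open \<W>"
  by (intro open_Times open_J open_\<Omega>)

lemma ev_lower: "ev n f \<Longrightarrow> m \<le> n \<Longrightarrow> ev m f"
  unfolding smooth_evolution_def by (rule C_k_on_mono)

lemma ev_slice:
  assumes "ev k f" "t \<in> J" shows "sm k (f t)"
proof -
  have "C_k_on k {x. (t, x) \<in> \<W>} (\<lambda>x. uncurry4 f (t, x))"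
    using assms(1) unfolding smooth_evolution_def by (rule C_k_on_slice[OF open_\<W>])
  moreover have "{x. (t, x) \<in> \<W>} = \<Omega>" using assms(2) by auto
  ultimately show ?thesis by (simp add: smooth_field_def)
qed

lemma ev_deriv_frechet:
  assumes "ev (Suc k) f" "t \<in> J" "(R, Z) \<in> U"
  shows "((\<lambda>s. f s R \<phi> Z) has_real_derivative frechet_derivative (uncurry4 f) (at (t, R, \<phi>, Z)) (1, 0, 0, 0)) (at t)"
    and "((\<lambda>r. f t r \<phi> Z) has_real_derivative frechet_derivative (uncurry4 f) (at (t, R, \<phi>, Z)) (0, 1, 0, 0)) (at R)"
    and "((\<lambda>s. f t R s Z) has_real_derivative frechet_derivative (uncurry4 f) (at (t, R, \<phi>, Z)) (0, 0, 1, 0)) (at \<phi>)"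
    and "((\<lambda>z. f t R \<phi> z) has_real_derivative frechet_derivative (uncurry4 f) (at (t, R, \<phi>, Z)) (0, 0, 0, 1)) (at Z)"
proof -
  have F: "(uncurry4 f has_derivative frechet_derivative (uncurry4 f) (at (t, R, \<phi>, Z))) (at (t, R, \<phi>, Z))"
    using assms unfolding smooth_evolution_def by (intro C_k_on_has_derivative) (auto simp: open_\<W>)
  have v: "((\<lambda>s. (s, R, \<phi>, Z)) has_vector_derivative (1, 0, 0, 0)) (at t)"
    "((\<lambda>r. (t, r, \<phi>, Z)) has_vector_derivative (0, 1, 0, 0)) (at R)"
    "((\<lambda>s. (t, R, s, Z)) has_vector_derivative (0, 0, 1, 0)) (at \<phi>)"
    "((\<lambda>z. (t, R, \<phi>, z)) has_vector_derivative (0, 0, 0, 1)) (at Z)"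
    unfolding has_vector_derivative_def by (auto intro!: derivative_eq_intros simp: zero_prod_def)
  show "((\<lambda>s. f s R \<phi> Z) has_real_derivative frechet_derivative (uncurry4 f) (at (t, R, \<phi>, Z)) (1, 0, 0, 0)) (at t)"
    using curve_derivative[OF F v(1)] by simp
  show "((\<lambda>r. f t r \<phi> Z) has_real_derivative frechet_derivative (uncurry4 f) (at (t, R, \<phi>, Z)) (0, 1, 0, 0)) (at R)"
    using curve_derivative[OF F v(2)] by simp
  show "((\<lambda>s. f t R s Z) has_real_derivative frechet_derivative (uncurry4 f) (at (t, R, \<phi>, Z)) (0, 0, 1, 0)) (at \<phi>)"
    using curve_derivative[OF F v(3)] by simp
  show "((\<lambda>z. f t R \<phi> z) has_real_derivative frechet_derivative (uncurry4 f) (at (t, R, \<phi>, Z)) (0, 0, 0, 1)) (at Z)"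
    using curve_derivative[OF F v(4)] by simp
qed

lemma ev_partial_frechet:
  assumes "ev (Suc k) f" "t \<in> J" "(R, Z) \<in> U"
  shows "\<partial>\<^sub>t f t R \<phi> Z = frechet_derivative (uncurry4 f) (at (t, R, \<phi>, Z)) (1, 0, 0, 0)"
    and "\<partial>\<^sub>R (f t) R \<phi> Z = frechet_derivative (uncurry4 f) (at (t, R, \<phi>, Z)) (0, 1, 0, 0)"
    and "\<partial>\<^sub>\<phi> (f t) R \<phi> Z = frechet_derivative (uncurry4 f) (at (t, R, \<phi>, Z)) (0, 0, 1, 0)"
    and "\<partial>\<^sub>Z (f t) R \<phi> Z = frechet_derivative (uncurry4 f) (at (t, R, \<phi>, Z)) (0, 0, 0, 1)"
  unfolding partial_R_def partial_phi_def partial_Z_def partial_t_def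
  using ev_deriv_frechet[OF assms]
  by (auto intro!: DERIV_imp_deriv vector_derivative_at simp flip: has_real_derivative_iff_has_vector_derivative)

lemma ev_deriv:
  assumes "ev (Suc k) f" "t \<in> J" "(R, Z) \<in> U"
  shows "((\<lambda>s. f s R \<phi> Z) has_real_derivative \<partial>\<^sub>t f t R \<phi> Z) (at t)"
  using ev_deriv_frechet(1)[OF assms] ev_partial_frechet(1)[OF assms] by simp

lemma Basis4: "(1, 0, 0, 0) \<in> (Basis :: (real \<times> real \<times> real \<times> real) set)"
  "(0, 1, 0, 0) \<in> (Basis :: (real \<times> real \<times> real \<times> real) set)"
  "(0, 0, 1, 0) \<in> (Basis :: (real \<times> real \<times> real \<times> real) set)"
  "(0, 0, 0, 1) \<in> (Basis :: (real \<times> real \<times> real \<times> real) set)"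
  by (auto simp: Basis_prod_def zero_prod_def)

lemma ev_partial:
  assumes "ev (Suc k) f"
  shows "ev k (\<partial>\<^sub>t f)" "ev k (\<lambda>t. \<partial>\<^sub>R (f t))" "ev k (\<lambda>t. \<partial>\<^sub>\<phi> (f t))" "ev k (\<lambda>t. \<partial>\<^sub>Z (f t))"
proof -
  have *: "C_k_on k \<W> (\<lambda>x. frechet_derivative (uncurry4 f) (at x) b)" if "b \<in> Basis" for b
    using assms that unfolding smooth_evolution_def by simp
  show "ev k (\<partial>\<^sub>t f)" "ev k (\<lambda>t. \<partial>\<^sub>R (f t))" "ev k (\<lambda>t. \<partial>\<^sub>\<phi> (f t))" "ev k (\<lambda>t. \<partial>\<^sub>Z (f t))"
    unfolding smooth_evolution_def
    by (rule C_k_on_cong[OF open_\<W> _ *[OF Basis4(1)]], force simp: ev_partial_frechet[OF assms])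
       (rule C_k_on_cong[OF open_\<W> _ *[OF Basis4(2)]], force simp: ev_partial_frechet[OF assms],
        rule C_k_on_cong[OF open_\<W> _ *[OF Basis4(3)]], force simp: ev_partial_frechet[OF assms],
        rule C_k_on_cong[OF open_\<W> _ *[OF Basis4(4)]], force simp: ev_partial_frechet[OF assms])
qed

text \<open>The rate of change of the energy produces time derivatives of gradients, whereas the
  equations contain gradients of time derivatives.\<close>

lemma ev_commute:
  assumes f: "ev 2 f" and x: "t \<in> J" "(R, Z) \<in> U"
  shows "\<partial>\<^sub>t (\<lambda>t. \<partial>\<^sub>R (f t)) t R \<phi> Z = \<partial>\<^sub>R (\<partial>\<^sub>t f t) R \<phi> Z"
    and "\<partial>\<^sub>t (\<lambda>t. \<partial>\<^sub>Z (f t)) t R \<phi> Z = \<partial>\<^sub>Z (\<partial>\<^sub>t f t) R \<phi> Z"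
proof -
  have f1: "ev (Suc (Suc 0)) f" using f by (simp add: numeral_2_eq_2)
  have C2: "C_k_on 2 \<W> (uncurry4 f)" using f by (simp add: smooth_evolution_def)
  have xW: "(t, R, \<phi>, Z) \<in> \<W>" using x by simp
  note mixed = mixed_derivatives_commute[OF open_\<W> C2 _ _ xW]
  let ?D = "\<lambda>b y. frechet_derivative (uncurry4 f) (at y) b"
  have D: "uncurry4 g differentiable at (t, R, \<phi>, Z)" if "ev (Suc 0) g" for g
    using that xW unfolding smooth_evolution_def by (intro C_k_on_differentiable_at[OF _ open_\<W>])
  have eq: "frechet_derivative (uncurry4 (\<partial>\<^sub>t f)) (at (t, R, \<phi>, Z))
      = frechet_derivative (?D (1, 0, 0, 0)) (at (t, R, \<phi>, Z))"
    "frechet_derivative (uncurry4 (\<lambda>t. \<partial>\<^sub>R (f t))) (at (t, R, \<phi>, Z))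
        = frechet_derivative (?D (0, 1, 0, 0)) (at (t, R, \<phi>, Z))"
    "frechet_derivative (uncurry4 (\<lambda>t. \<partial>\<^sub>Z (f t))) (at (t, R, \<phi>, Z))
        = frechet_derivative (?D (0, 0, 0, 1)) (at (t, R, \<phi>, Z))"
    by (rule frechet_derivative_transform_within_open[OF D[OF ev_partial(1)[OF f1]] open_\<W> xW]
             frechet_derivative_transform_within_open[OF D[OF ev_partial(2)[OF f1]] open_\<W> xW]
             frechet_derivative_transform_within_open[OF D[OF ev_partial(4)[OF f1]] open_\<W> xW],
        auto simp: ev_partial_frechet[OF f1])+
  show "\<partial>\<^sub>t (\<lambda>t. \<partial>\<^sub>R (f t)) t R \<phi> Z = \<partial>\<^sub>R (\<partial>\<^sub>t f t) R \<phi> Z"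
    "\<partial>\<^sub>t (\<lambda>t. \<partial>\<^sub>Z (f t)) t R \<phi> Z = \<partial>\<^sub>Z (\<partial>\<^sub>t f t) R \<phi> Z"
    using mixed[OF Basis4(1) Basis4(2)] mixed[OF Basis4(1) Basis4(4)]
    by (simp_all add: ev_partial_frechet(1)[OF ev_partial(2)[OF f1] x] ev_partial_frechet(1)[OF
        ev_partial(4)[OF f1] x]
       ev_partial_frechet(2,4)[OF ev_partial(1)[OF f1] x] eq)
qed

lemma ev_const: "ev k (\<lambda>t R \<phi> Z. c)"
  unfolding smooth_evolution_def using C_k_on_const[of k \<W> c] by (simp add: case_prod_unfold)

lemma ev_R: "ev k (\<lambda>t R \<phi> Z. R)"
  unfolding smooth_evolution_def
  using C_k_on_linear[OF bounded_linear_compose[OF bounded_linear_fst bounded_linear_snd] open_\<W>, of k]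
  by (simp add: case_prod_unfold)

lemma ev_add: "ev k f \<Longrightarrow> ev k g \<Longrightarrow> ev k (\<lambda>t R \<phi> Z. f t R \<phi> Z + g t R \<phi> Z)"
  unfolding smooth_evolution_def case_prod_unfold using C_k_on_add[OF open_\<W>] by (simp add: case_prod_unfold)

lemma ev_diff: "ev k f \<Longrightarrow> ev k g \<Longrightarrow> ev k (\<lambda>t R \<phi> Z. f t R \<phi> Z - g t R \<phi> Z)"
  unfolding smooth_evolution_def case_prod_unfold using C_k_on_diff[OF open_\<W>] by (simp add: case_prod_unfold)

lemma ev_mult: "ev k f \<Longrightarrow> ev k g \<Longrightarrow> ev k (\<lambda>t R \<phi> Z. f t R \<phi> Z * g t R \<phi> Z)"
  unfolding smooth_evolution_def case_prod_unfold using C_k_on_mult[OF open_\<W>] by (simp add: case_prod_unfold)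

lemma ev_inverse_R: "ev k (\<lambda>t R \<phi> Z. inverse R)"
proof -
  have "C_k_on k \<W> (\<lambda>x. inverse (fst (snd x)))"
    by (rule C_k_on_inverse[OF open_\<W>])
      (use R_pos in \<open>force intro:
          C_k_on_linear[OF bounded_linear_compose[OF bounded_linear_fst bounded_linear_snd] open_\<W>]\<close>)+
  then show ?thesis unfolding smooth_evolution_def by (simp add: case_prod_unfold)
qed

lemma ev_power: "ev k f \<Longrightarrow> ev k (\<lambda>t R \<phi> Z. f t R \<phi> Z ^ n)"
  by (induction n) (auto intro: ev_const ev_mult)

lemma ev_divide_const: "ev k f \<Longrightarrow> ev k (\<lambda>t R \<phi> Z. f t R \<phi> Z / c)"
  using ev_mult[OF _ ev_const, of k f "inverse c"] by (simp add: divide_inverse)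

lemma ev_continuous: "ev k f \<Longrightarrow> continuous_on \<W> (uncurry4 f)"
  using ev_lower[of k f 0] by (simp add: smooth_evolution_def)

end

section \<open>Integrals of partial derivatives and behaviour at the boundary\<close>

text \<open>By continuity the preimage of a closure contains the closure of the preimage, and this
  is applied to \<open>S\<close> and to its complement. With \<open>g\<close> a coordinate line it
  shows that the ends of a slice of the domain lie on its frontier.\<close>

lemma frontier_slice:
  assumes "continuous_on UNIV g" "x \<in> frontier {y. g y \<in> S}"
  shows "g x \<in> frontier S"
proof -
  have "x \<in> closure (g -` S)" "x \<in> closure (g -` (- S))"
    using assms(2) by (auto simp: frontier_closures vimage_def Compl_eq)
  moreover have "closure (g -` T) \<subseteq> g -` closure T" for T
    using assms(1) by (intro closure_minimal closed_vimage) (auto simp: closure_subset[THEN subsetD])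
  ultimately show ?thesis by (auto simp: frontier_closures)
qed

text \<open>The components of \<open>S\<close> are intervals whose end points lie in the frontier of \<open>S\<close>.\<close>

lemma integral_deriv_open_eq_0:
  fixes f f' :: "real \<Rightarrow> real"
  assumes S: "open S" "bounded S" and cont: "continuous_on (closure S) f"
    and der: "\<And>x. x \<in> S \<Longrightarrow> (f has_real_derivative f' x) (at x)"
    and zero: "\<And>x. x \<in> frontier S \<Longrightarrow> f x = 0" and int: "set_integrable lborel S f'"
  shows "(LINT x:S|lborel. f' x) = 0"
proof -
  have comp0: "(LINT x:C|lborel. f' x) = 0" if C: "C \<in> components S" for C
  proof -
    have CS: "C \<subseteq> S" "open C" "connected C" "C \<noteq> {}"
      using C S(1)
          by (simp_all add: in_components_subset open_components in_components_connected in_components_nonempty)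
    have "bounded C" using S(2) CS(1) by (rule bounded_subset)
    define a b where "a = Inf C" and "b = Sup C"
    have bdd: "bdd_below C" "bdd_above C"
      using \<open>bounded C\<close> by (auto simp: bounded_imp_bdd_below bounded_imp_bdd_above)
    have Csub: "C \<subseteq> {a..b}"
      using bdd by (auto simp: a_def b_def cInf_lower cSup_upper)
    have ab: "a \<in> closure C" "b \<in> closure C"
      using CS bdd by (auto simp: a_def b_def closure_contains_Inf closure_contains_Sup)
    have nab: "a \<notin> C" "b \<notin> C"
    proof -
      show "a \<notin> C"
      proof
        assume "a \<in> C"
        then obtain e where "e > 0" "ball a e \<subseteq> C" using CS(2) openE by blast
        then have "a - e / 2 \<in> C" by (auto simp: dist_real_def)
        then show False using Csub \<open>e > 0\<close> by fastforce
      qed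
      show "b \<notin> C"
      proof
        assume "b \<in> C"
        then obtain e where "e > 0" "ball b e \<subseteq> C" using CS(2) openE by blast
        then have "b + e / 2 \<in> C" by (auto simp: dist_real_def)
        then show False using Csub \<open>e > 0\<close> by fastforce
      qed
    qed
    have Ceq: "C = {a<..<b}"
    proof
      show "C \<subseteq> {a<..<b}" using Csub nab by (force simp: less_le)
      show "{a<..<b} \<subseteq> C"
      proof
        fix x assume x: "x \<in> {a<..<b}"
        obtain y where y: "y \<in> C" "y < x"
          using x cInf_lessD[OF CS(4), of x] by (auto simp: a_def)
        obtain z where z: "z \<in> C" "x < z"
          using x less_cSupD[OF CS(4), of x] by (auto simp: b_def)
        show "x \<in> C"
          using connected_contains_Icc[OF CS(3) y(1) z(1)] y z by auto
      qed
    qed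
    have lt: "a < b" using CS(4) Ceq by (auto simp: not_less)
    \<comment> \<open>The ends of a component belong to the frontier of the whole set, where
      \<open>f\<close> is zero, so both boundary terms of the fundamental theorem drop out.\<close>
    have "a \<in> frontier C" "b \<in> frontier C"
      using ab nab CS(2) by (auto simp: frontier_def interior_open)
    then have fab: "f a = 0" "f b = 0"
      using zero frontier_of_components_subset[OF C] by auto
    have "{a..b} \<subseteq> closure S"
      using closure_mono[OF CS(1)] Ceq lt by (simp add: closure_greaterThanLessThan)
    then have "(f' has_integral (f b - f a)) {a..b}"
      using lt cont CS(1) der
      by (intro fundamental_theorem_of_calculus_interior)
        (auto simp: Ceq simp flip: has_real_derivative_iff_has_vector_derivative
          intro: continuous_on_subset)
    then have "integral C f' = 0"
      by (auto simp: Ceq fab has_integral_Icc_iff_Ioo)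
    moreover have "set_integrable lborel C f'"
      using int by (rule set_integrable_subset) (use CS in auto)
    ultimately show ?thesis by (simp add: set_borel_integral_eq_integral(2))
  qed
  have cnt: "countable (components S)"
    using open_components[OF S(1)] by (intro countable_disjoint_open_subsets)
      (auto simp: pairwise_def disjnt_def components_nonoverlap)
  \<comment> \<open>There may be infinitely many components. \<open>A i\<close> is the component
    numbered \<open>i\<close>, or empty if there is none, so that countable additivity applies to a
    sequence.\<close>
  define A where "A i = \<Union>{C \<in> components S. to_nat_on (components S) C = i}" for i
  have A: "A i = {} \<or> A i \<in> components S" for i
  proof (cases "\<exists>C\<in>components S. to_nat_on (components S) C = i")
    case True
    then obtain C where C: "C \<in> components S" "to_nat_on (components S) C = i" by blast
    then have "{C \<in> components S. to_nat_on (components S) C = i} = {C}"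
      using inj_on_to_nat_on[OF cnt] by (auto dest: inj_onD)
    then show ?thesis using C by (simp add: A_def)
  next
    case False
    then show ?thesis by (auto simp: A_def)
  qed
  have "\<exists>C. C \<in> components S \<and> x \<in> C" if "x \<in> S" for x
    using that Union_components[of S] by blast
  then have UA: "(\<Union>i. A i) = S"
    using in_components_subset by (fastforce simp: A_def)
  have disj: "A i \<inter> A k = {}" if "i \<noteq> k" for i k
    unfolding A_def using that components_nonoverlap by blast
  have "(LINT x:(\<Union>i. A i)|lborel. f' x) = (\<Sum>i. (LINT x:(A i)|lborel. f' x))"
  proof (rule lebesgue_integral_countable_add)
    show "A i \<in> sets lborel" for i
      using A[of i] open_components[OF S(1)] by auto
    show "set_integrable lborel (\<Union>i. A i) f'" using int UA by simp
  qed (use disj in auto)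
  moreover have "(LINT x:(A i)|lborel. f' x) = 0" for i
    using A[of i] comp0 by (auto simp: set_lebesgue_integral_def)
  ultimately show ?thesis using UA by simp
qed

text \<open>Fubini with the vanishing coordinate innermost. For the second and third coordinate the
  pair integral has to be split again, and its integrand is integrable only for almost every
  \<open>x\<close>; hence the detour through \<open>ae\<close>.\<close>

lemma triple_integral_eq_0:
  fixes h :: "real \<times> real \<times> real \<Rightarrow> real"
  assumes h: "integrable lborel h"
  shows "(\<And>y z. (LINT x|lborel. h (x, y, z)) = 0) \<Longrightarrow> (LINT x|lborel. h x) = 0"
    and "(\<And>x z. (LINT y|lborel. h (x, y, z)) = 0) \<Longrightarrow> (LINT x|lborel. h x) = 0"
    and "(\<And>x y. (LINT z|lborel. h (x, y, z)) = 0) \<Longrightarrow> (LINT x|lborel. h x) = 0"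
proof -
  have hp: "integrable (lborel \<Otimes>\<^sub>M lborel) (\<lambda>(x, yz). h (x, yz))"
    using h by (simp add: lborel_prod)
  have ae: "AE x in lborel. integrable (lborel \<Otimes>\<^sub>M lborel) (\<lambda>(y, z). h (x, y, z))"
    using lborel_pair.AE_integrable_fst'[OF hp] by (simp add: lborel_prod case_prod_unfold)
  {
    assume P1: "\<And>y z. (LINT x|lborel. h (x, y, z)) = 0"
    then have "(LINT x|lborel. h (x, yz)) = 0" for yz by (cases yz) auto
    then show "(LINT x|lborel. h x) = 0"
      using lborel_pair.integral_snd[OF hp] by (simp add: lborel_prod)
  }
  have inner: "(LINT x|lborel. h x) = 0" if "AE x in lborel. (LINT yz|lborel. h (x, yz)) = 0"
  proof -
    have "(LINT x|lborel. (LINT yz|lborel. h (x, yz))) = (LINT x|lborel. h x)"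
      using lborel_pair.integral_fst'[OF hp] by (simp add: lborel_prod)
    moreover have "(LINT x|lborel. (LINT yz|lborel. h (x, yz))) = 0"
      using that by (rule integral_eq_zero_AE)
    ultimately show ?thesis by simp
  qed
  {
    assume P2: "\<And>x z. (LINT y|lborel. h (x, y, z)) = 0"
    show "(LINT x|lborel. h x) = 0"
    proof (rule inner, use ae in eventually_elim)
      fix x assume "integrable (lborel \<Otimes>\<^sub>M lborel) (\<lambda>(y, z). h (x, y, z))"
      from lborel_pair.integral_snd[OF this] P2
      show "(LINT yz|lborel. h (x, yz)) = 0" by (simp add: lborel_prod case_prod_unfold)
    qed
  }
  {
    assume P3: "\<And>x y. (LINT z|lborel. h (x, y, z)) = 0"
    show "(LINT x|lborel. h x) = 0"
    proof (rule inner, use ae in eventually_elim)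
      fix x assume "integrable (lborel \<Otimes>\<^sub>M lborel) (\<lambda>(y, z). h (x, y, z))"
      from lborel_pair.integral_fst[OF this] P3
      show "(LINT yz|lborel. h (x, yz)) = 0" by (simp add: lborel_prod case_prod_unfold)
    qed
  }
qed

section \<open>Integration over the domain, and differentiation under the integral\<close>

locale poloidal_domain = evolution_region +
  fixes D :: "(real \<times> real) set"
  assumes open_D: "open D" and bounded_D: "bounded D" and closure_D: "closure D \<subseteq> U"
begin

text \<open>A compact set between \<open>cyl D\<close> and \<open>\<Omega>\<close>, including the
  angle \<open>2 * pi\<close>. Continuous fields are bounded on it, which yields integrability and
  dominating constants.\<close>

definition closed_cyl :: "(real \<times> real \<times> real) set"
  where "closed_cyl = {(R, \<phi>, Z). (R, Z) \<in> closure D \<and> 0 \<le> \<phi> \<and> \<phi> \<le> 2 * pi}"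

lemma D_U: "(R, Z) \<in> D \<Longrightarrow> (R, Z) \<in> U"
  using closure_D closure_subset by blast

lemma compact_closed_cyl: "compact closed_cyl"
proof -
  have "closed_cyl = (\<lambda>(x, \<phi>). (fst x, \<phi>, snd x)) ` (closure D \<times> {0..2 * pi})"
    by (force simp: closed_cyl_def)
  moreover have "compact (closure D \<times> {0..2 * pi})"
    using bounded_D by (intro compact_Times) (auto simp: compact_closure)
  ultimately show ?thesis
    by (auto intro!: compact_continuous_image continuous_intros simp: case_prod_unfold)
qed

lemma cyl_closed_cyl: "cyl D \<subseteq> closed_cyl" and closed_cyl_\<Omega>: "closed_cyl \<subseteq> \<Omega>" and cyl_\<Omega>: "cyl D \<subseteq> \<Omega>"
  using closure_subset[of D] closure_D by (auto simp: cyl_def closed_cyl_def)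

lemma borel_cyl: "cyl D \<in> sets borel"
proof -
  have "cyl D = (\<lambda>x. (fst x, snd (snd x))) -` D \<inter> (\<lambda>x. fst (snd x)) -` {0..<2 * pi}"
    by (auto simp: cyl_def)
  moreover have "(\<lambda>x::real \<times> real \<times> real. (fst x, snd (snd x))) -` D \<in> sets borel"
    by (intro borel_open open_vimage open_D continuous_intros)
  moreover have "(\<lambda>x::real \<times> real \<times> real. fst (snd x)) -` {0..<2 * pi} \<in> sets borel"
  proof -
    have "(\<lambda>x::real \<times> real \<times> real. fst (snd x)) \<in> borel_measurable borel"
      by (intro borel_measurable_continuous_onI continuous_intros)
    from measurable_sets_borel[OF this, of "{0..<2 * pi}"] show ?thesis by auto
  qed
  ultimately show ?thesis by simp
qed

lemma set_integrable_cyl: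
  fixes F :: "real \<times> real \<times> real \<Rightarrow> real"
  assumes "continuous_on \<Omega> F" shows "set_integrable lborel (cyl D) F"
proof -
  have "set_integrable lborel closed_cyl F"
    unfolding set_integrable_def
    by (rule borel_integrable_compact[OF compact_closed_cyl continuous_on_subset[OF assms closed_cyl_\<Omega>]])
  then show ?thesis
    by (rule set_integrable_subset) (use borel_cyl cyl_closed_cyl in auto)
qed

lemma sm_integrable: "sm k f \<Longrightarrow> set_integrable lborel (cyl D) (uncurry3 f)"
  by (intro set_integrable_cyl sm_continuous)

text \<open>For fixed angle and height the slice of \<open>D\<close> is a bounded open subset of the
  line, not necessarily an interval, and its frontier lies over \<open>frontier D\<close>, where
  \<open>f\<close> vanishes. Angles outside the period contribute nothing because of the
  indicator.\<close>

lemma integral_partial_R_eq_0: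
  assumes f: "sm 1 f" and zero: "\<And>R \<phi> Z. (R, Z) \<in> frontier D \<Longrightarrow> 0 \<le> \<phi> \<Longrightarrow> \<phi> < 2 * pi \<Longrightarrow> f R \<phi> Z = 0"
  shows "(LINT x:cyl D|lborel. uncurry3 (\<partial>\<^sub>R f) x) = 0"
  unfolding set_lebesgue_integral_def
proof (rule triple_integral_eq_0(1))
  have f1: "sm (Suc 0) f" using f by simp
  note int = sm_integrable[OF sm_partial(1)[OF f1]]
  show "integrable lborel (\<lambda>x. indicat_real (cyl D) x *\<^sub>R uncurry3 (\<partial>\<^sub>R f) x)"
    using int by (simp add: set_integrable_def)
  fix \<phi> Z
  show "(LINT R|lborel. indicat_real (cyl D) (R, \<phi>, Z) *\<^sub>R uncurry3 (\<partial>\<^sub>R f) (R, \<phi>, Z)) = 0"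
  proof (cases "0 \<le> \<phi> \<and> \<phi> < 2 * pi")
    case True
    let ?S = "{R. (R, Z) \<in> D}"
    have cont: "continuous_on UNIV (\<lambda>R. (R, Z))" by (intro continuous_intros)
    have op: "open ?S"
      using open_vimage[OF open_D, of "\<lambda>R. (R, Z)"] by (simp add: vimage_def continuous_intros)
    have "?S \<subseteq> fst ` D" by force
    then have bd: "bounded ?S"
      using bounded_D bounded_fst bounded_subset by blast
    have clo: "closure ?S \<subseteq> {R. (R, Z) \<in> closure D}"
    proof (rule closure_minimal)
      show "closed {R. (R, Z) \<in> closure D}"
        using closed_vimage[OF closed_closure, of "\<lambda>R. (R, Z)" D] by (simp add: vimage_def continuous_intros)
    qed (use closure_subset in auto)
    have "(LINT R:?S|lborel. \<partial>\<^sub>R f R \<phi> Z) = 0"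
    proof (rule integral_deriv_open_eq_0[OF op bd, where f="\<lambda>R. f R \<phi> Z"])
      have "\<And>R. R \<in> closure ?S \<Longrightarrow> isCont (\<lambda>R. f R \<phi> Z) R"
        using clo closure_D sm_deriv(1)[OF f1] by (blast intro: DERIV_isCont)
      then show "continuous_on (closure ?S) (\<lambda>R. f R \<phi> Z)"
        by (intro continuous_at_imp_continuous_on) auto
      show "((\<lambda>R. f R \<phi> Z) has_real_derivative \<partial>\<^sub>R f R \<phi> Z) (at R)" if "R \<in> ?S" for R
        using that D_U by (intro sm_deriv[OF f1]) auto
      show "f R \<phi> Z = 0" if "R \<in> frontier ?S" for R
        using frontier_slice[OF cont, of R D] that True by (intro zero) auto
      have "continuous_on {R. (R, Z) \<in> closure D} (\<lambda>R. uncurry3 (\<partial>\<^sub>R f) (R, \<phi>, Z))"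
        by (rule continuous_on_compose2[OF sm_continuous[OF sm_partial(1)[OF f1]]])
          (use closure_D in \<open>auto intro!: continuous_intros\<close>)
      then have "continuous_on (closure ?S) (\<lambda>R. \<partial>\<^sub>R f R \<phi> Z)"
        using clo by (auto intro: continuous_on_subset)
      then have "set_integrable lborel (closure ?S) (\<lambda>R. \<partial>\<^sub>R f R \<phi> Z)"
        unfolding set_integrable_def using bd by (intro borel_integrable_compact) (auto simp: compact_closure)
      then show "set_integrable lborel ?S (\<lambda>R. \<partial>\<^sub>R f R \<phi> Z)"
        by (rule set_integrable_subset) (use op closure_subset[of ?S] in auto)
    qed
    moreover have "indicat_real (cyl D) (R, \<phi>, Z) = indicat_real ?S R" for R
      using True by (auto simp: cyl_def indicator_def)
    ultimately show ?thesis by (simp add: set_lebesgue_integral_def)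
  next
    case False
    then have "indicat_real (cyl D) (R, \<phi>, Z) = 0" for R by (auto simp: cyl_def indicator_def)
    then show ?thesis by simp
  qed
qed

lemma integral_partial_Z_eq_0:
  assumes f: "sm 1 f" and zero: "\<And>R \<phi> Z. (R, Z) \<in> frontier D \<Longrightarrow> 0 \<le> \<phi> \<Longrightarrow> \<phi> < 2 * pi \<Longrightarrow> f R \<phi> Z = 0"
  shows "(LINT x:cyl D|lborel. uncurry3 (\<partial>\<^sub>Z f) x) = 0"
  unfolding set_lebesgue_integral_def
proof (rule triple_integral_eq_0(3))
  have f1: "sm (Suc 0) f" using f by simp
  note int = sm_integrable[OF sm_partial(3)[OF f1]]
  show "integrable lborel (\<lambda>x. indicat_real (cyl D) x *\<^sub>R uncurry3 (\<partial>\<^sub>Z f) x)"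
    using int by (simp add: set_integrable_def)
  fix R \<phi>
  show "(LINT Z|lborel. indicat_real (cyl D) (R, \<phi>, Z) *\<^sub>R uncurry3 (\<partial>\<^sub>Z f) (R, \<phi>, Z)) = 0"
  proof (cases "0 \<le> \<phi> \<and> \<phi> < 2 * pi")
    case True
    let ?S = "{Z. (R, Z) \<in> D}"
    have cont: "continuous_on UNIV (\<lambda>Z. (R, Z))" by (intro continuous_intros)
    have op: "open ?S"
      using open_vimage[OF open_D, of "\<lambda>Z. (R, Z)"] by (simp add: vimage_def continuous_intros)
    have "?S \<subseteq> snd ` D" by force
    then have bd: "bounded ?S"
      using bounded_D bounded_snd bounded_subset by blast
    have clo: "closure ?S \<subseteq> {Z. (R, Z) \<in> closure D}"
    proof (rule closure_minimal)
      show "closed {Z. (R, Z) \<in> closure D}"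
        using closed_vimage[OF closed_closure, of "\<lambda>Z. (R, Z)" D] by (simp add: vimage_def continuous_intros)
    qed (use closure_subset in auto)
    have "(LINT Z:?S|lborel. \<partial>\<^sub>Z f R \<phi> Z) = 0"
    proof (rule integral_deriv_open_eq_0[OF op bd, where f="\<lambda>Z. f R \<phi> Z"])
      have "\<And>Z. Z \<in> closure ?S \<Longrightarrow> isCont (\<lambda>Z. f R \<phi> Z) Z"
        using clo closure_D sm_deriv(3)[OF f1] by (blast intro: DERIV_isCont)
      then show "continuous_on (closure ?S) (\<lambda>Z. f R \<phi> Z)"
        by (intro continuous_at_imp_continuous_on) auto
      show "((\<lambda>Z. f R \<phi> Z) has_real_derivative \<partial>\<^sub>Z f R \<phi> Z) (at Z)" if "Z \<in> ?S" for Z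
        using that D_U by (intro sm_deriv[OF f1]) auto
      show "f R \<phi> Z = 0" if "Z \<in> frontier ?S" for Z
        using frontier_slice[OF cont, of Z D] that True by (intro zero) auto
      have "continuous_on {Z. (R, Z) \<in> closure D} (\<lambda>Z. uncurry3 (\<partial>\<^sub>Z f) (R, \<phi>, Z))"
        by (rule continuous_on_compose2[OF sm_continuous[OF sm_partial(3)[OF f1]]])
          (use closure_D in \<open>auto intro!: continuous_intros\<close>)
      then have "continuous_on (closure ?S) (\<lambda>Z. \<partial>\<^sub>Z f R \<phi> Z)"
        using clo by (auto intro: continuous_on_subset)
      then have "set_integrable lborel (closure ?S) (\<lambda>Z. \<partial>\<^sub>Z f R \<phi> Z)"
        unfolding set_integrable_def using bd by (intro borel_integrable_compact) (auto simp: compact_closure)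
      then show "set_integrable lborel ?S (\<lambda>Z. \<partial>\<^sub>Z f R \<phi> Z)"
        by (rule set_integrable_subset) (use op closure_subset[of ?S] in auto)
    qed
    moreover have "indicat_real (cyl D) (R, \<phi>, Z) = indicat_real ?S Z" for Z
      using True by (auto simp: cyl_def indicator_def)
    ultimately show ?thesis by (simp add: set_lebesgue_integral_def)
  next
    case False
    then have "indicat_real (cyl D) (R, \<phi>, Z) = 0" for Z by (auto simp: cyl_def indicator_def)
    then show ?thesis by simp
  qed
qed

lemma integral_partial_phi_eq_0:
  assumes f: "sm 1 f" and per: "\<And>R Z. (R, Z) \<in> D \<Longrightarrow> f R (2 * pi) Z = f R 0 Z"
  shows "(LINT x:cyl D|lborel. uncurry3 (\<partial>\<^sub>\<phi> f) x) = 0"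
  unfolding set_lebesgue_integral_def
proof (rule triple_integral_eq_0(2))
  have f1: "sm (Suc 0) f" using f by simp
  note int = sm_integrable[OF sm_partial(2)[OF f1]]
  show "integrable lborel (\<lambda>x. indicat_real (cyl D) x *\<^sub>R uncurry3 (\<partial>\<^sub>\<phi> f) x)"
    using int by (simp add: set_integrable_def)
  fix R Z
  show "(LINT \<phi>|lborel. indicat_real (cyl D) (R, \<phi>, Z) *\<^sub>R uncurry3 (\<partial>\<^sub>\<phi> f) (R, \<phi>, Z)) = 0"
  proof (cases "(R, Z) \<in> D")
    case True
    have cont: "continuous_on {0..2 * pi} (\<lambda>\<phi>. uncurry3 (\<partial>\<^sub>\<phi> f) (R, \<phi>, Z))"
      by (rule continuous_on_compose2[OF sm_continuous[OF sm_partial(2)[OF f1]]])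
        (use D_U[OF True] in \<open>auto intro!: continuous_intros\<close>)
    have int: "set_integrable lborel {0..2 * pi} (\<lambda>\<phi>. \<partial>\<^sub>\<phi> f R \<phi> Z)"
      unfolding set_integrable_def using cont by (intro borel_integrable_compact) auto
    have int': "set_integrable lborel {0..<2 * pi} (\<lambda>\<phi>. \<partial>\<^sub>\<phi> f R \<phi> Z)"
      by (rule set_integrable_subset[OF int]) auto
    have "((\<lambda>\<phi>. \<partial>\<^sub>\<phi> f R \<phi> Z) has_integral (f R (2 * pi) Z - f R 0 Z)) {0..2 * pi}"
      by (rule fundamental_theorem_of_calculus)
        (use sm_deriv(2)[OF f1 D_U[OF True]] in \<open>auto intro: has_field_derivative_at_within
          simp flip: has_real_derivative_iff_has_vector_derivative\<close>)
    \<comment> \<open>The half-open period in \<open>cyl\<close> and the closed interval of the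
      fundamental theorem differ by the single point \<open>2 * pi\<close>.\<close>
    moreover have "negligible {\<phi> \<in> {0..2 * pi} - {0..<2 * pi}. \<partial>\<^sub>\<phi> f R \<phi> Z \<noteq> 0}"
      "negligible {\<phi> \<in> {0..<2 * pi} - {0..2 * pi}. \<partial>\<^sub>\<phi> f R \<phi> Z \<noteq> 0}"
      by (rule negligible_subset[OF negligible_sing[of "2 * pi"]], force)+
    ultimately have "((\<lambda>\<phi>. \<partial>\<^sub>\<phi> f R \<phi> Z) has_integral 0) {0..<2 * pi}"
      using has_integral_spike_set_eq[of "{0..2 * pi}" "{0..<2 * pi}" "\<lambda>\<phi>. \<partial>\<^sub>\<phi> f R \<phi> Z" 0]
      by (simp add: per[OF True])
    then have "(LINT \<phi>:{0..<2 * pi}|lborel. \<partial>\<^sub>\<phi> f R \<phi> Z) = 0"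
      using set_borel_integral_eq_integral(2)[OF int'] by (simp add: integral_unique)
    moreover have "indicat_real (cyl D) (R, \<phi>, Z) = indicat_real {0..<2 * pi} \<phi>" for \<phi>
      using True by (auto simp: cyl_def indicator_def)
    ultimately show ?thesis by (simp add: set_lebesgue_integral_def)
  next
    case False
    then have "indicat_real (cyl D) (R, \<phi>, Z) = 0" for \<phi> by (auto simp: cyl_def indicator_def)
    then show ?thesis by simp
  qed
qed

text \<open>Dominated convergence of difference quotients: the time derivative is bounded by some
  \<open>M\<close> on a compact set of times and points, so by the mean value inequality all
  quotients are bounded by \<open>M\<close>, which is integrable over the bounded
  \<open>cyl D\<close>.\<close>

lemma integral_time_derivative:
  assumes f: "ev 1 f" and t: "t \<in> J"
  shows "((\<lambda>s. LINT x:cyl D|lborel. uncurry3 (f s) x) has_real_derivative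
    (LINT x:cyl D|lborel. uncurry3 (\<partial>\<^sub>t f t) x)) (at t)"
proof -
  have f1: "ev (Suc 0) f" using f by simp
  \<comment> \<open>A closed ball of times, because compactness is needed for the bound
    \<open>M\<close>.\<close>
  obtain \<delta> where \<delta>: "\<delta> > 0" "cball t \<delta> \<subseteq> J"
    using open_J t open_contains_cball by blast
  have "continuous_on (cball t \<delta> \<times> closed_cyl) (uncurry4 (\<partial>\<^sub>t f))"
    by (rule continuous_on_subset[OF ev_continuous[OF ev_partial(1)[OF f1]]]) (use \<delta> closed_cyl_\<Omega> in auto)
  then have "compact (uncurry4 (\<partial>\<^sub>t f) ` (cball t \<delta> \<times> closed_cyl))"
    by (intro compact_continuous_image compact_Times compact_closed_cyl compact_cball)
  from compact_imp_bounded[OF this]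
  obtain M where M: "\<And>y. y \<in> uncurry4 (\<partial>\<^sub>t f) ` (cball t \<delta> \<times> closed_cyl) \<Longrightarrow> norm y \<le> M"
    unfolding bounded_iff by blast
  have dt: "\<bar>\<partial>\<^sub>t f s R \<phi> Z\<bar> \<le> M" if "s \<in> cball t \<delta>" "(R, \<phi>, Z) \<in> cyl D" for s R \<phi> Z
  proof -
    have "(s, R, \<phi>, Z) \<in> cball t \<delta> \<times> closed_cyl" using that cyl_closed_cyl by blast
    from M[OF imageI[OF this]] show ?thesis by simp
  qed
  have lip: "\<bar>f s R \<phi> Z - f t R \<phi> Z\<bar> \<le> M * \<bar>s - t\<bar>" if "s \<in> cball t \<delta>" "(R, \<phi>, Z) \<in> cyl D" for s R \<phi> Z
  proof -
    have RZ: "(R, Z) \<in> U" using that(2) cyl_\<Omega> by auto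
    have der: "((\<lambda>s. f s R \<phi> Z) has_real_derivative \<partial>\<^sub>t f r R \<phi> Z) (at r within cball t \<delta>)"
      if r: "r \<in> cball t \<delta>" for r
      using ev_deriv[OF f1 _ RZ] r \<delta>(2) by (blast intro: has_field_derivative_at_within)
    have "t \<in> cball t \<delta>" using \<delta>(1) by simp
    have "norm (f s R \<phi> Z - f t R \<phi> Z) \<le> M * norm (s - t)"
      by (rule field_differentiable_bound[OF convex_cball der _ that(1) \<open>t \<in> cball t \<delta>\<close>])
        (use dt that in auto)
    then show ?thesis by simp
  qed
  have int: "set_integrable lborel (cyl D) (uncurry3 (f s))" if "s \<in> J" for s
    using sm_integrable[OF ev_slice[OF f that]] .
  have intt: "set_integrable lborel (cyl D) (uncurry3 (\<partial>\<^sub>t f t))"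
    using sm_integrable[OF ev_slice[OF ev_partial(1)[OF f1] t]] .
  have intM: "set_integrable lborel (cyl D) (\<lambda>x. M)"
    by (rule set_integrable_cyl) simp
  have lim: "(\<lambda>n. ((LINT x:cyl D|lborel. uncurry3 (f (X n)) x)
      - (LINT x:cyl D|lborel. uncurry3 (f t) x)) / (X n - t))
      \<longlonglongrightarrow> (LINT x:cyl D|lborel. uncurry3 (\<partial>\<^sub>t f t) x)"
    if X: "\<And>n. X n \<in> cball t \<delta> - {t}" and Xt: "X \<longlonglongrightarrow> t" for X
  proof -
    define q where "q n = (\<lambda>(R, \<phi>, Z). (f (X n) R \<phi> Z - f t R \<phi> Z) / (X n - t))" for n
    have XJ: "X n \<in> J" for n using X \<delta> by auto
    have q: "set_integrable lborel (cyl D) (q n)" "(LINT x:cyl D|lborel. q n x) =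
      ((LINT x:cyl D|lborel. uncurry3 (f (X n)) x) - (LINT x:cyl D|lborel. uncurry3 (f t) x)) / (X n - t)"
          for n
      using set_integral_diff[OF int[OF XJ[of n]] int[OF t]]
      by (auto simp: q_def case_prod_unfold)
    have "(\<lambda>n. (LINT x:cyl D|lborel. q n x)) \<longlonglongrightarrow> (LINT x:cyl D|lborel. uncurry3 (\<partial>\<^sub>t f t) x)"
      unfolding set_lebesgue_integral_def
    proof (rule integral_dominated_convergence)
      show "(\<lambda>x. indicat_real (cyl D) x *\<^sub>R uncurry3 (\<partial>\<^sub>t f t) x) \<in> borel_measurable lborel"
        using intt by (simp add: set_integrable_def borel_measurable_integrable)
      show "(\<lambda>x. indicat_real (cyl D) x *\<^sub>R q n x) \<in> borel_measurable lborel" for n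
        using q(1)[of n] borel_measurable_integrable by (auto simp: set_integrable_def)
      show "integrable lborel (\<lambda>x. indicat_real (cyl D) x *\<^sub>R M)"
        using intM by (simp add: set_integrable_def)
      show "AE x in lborel. (\<lambda>n. indicat_real (cyl D) x *\<^sub>R q n x)
          \<longlonglongrightarrow> indicat_real (cyl D) x *\<^sub>R uncurry3 (\<partial>\<^sub>t f t) x"
      proof (rule AE_I2)
        fix x :: "real \<times> real \<times> real"
        obtain R \<phi> Z where x: "x = (R, \<phi>, Z)" by (cases x)
        show "(\<lambda>n. indicat_real (cyl D) x *\<^sub>R q n x) \<longlonglongrightarrow> indicat_real (cyl D) x *\<^sub>R uncurry3 (\<partial>\<^sub>t f t) x"
        proof (cases "x \<in> cyl D")
          case True
          then have "((\<lambda>s. f s R \<phi> Z) has_real_derivative \<partial>\<^sub>t f t R \<phi> Z) (at t)"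
            using cyl_\<Omega> x by (intro ev_deriv[OF f1 t]) auto
          then have "((\<lambda>s. (f s R \<phi> Z - f t R \<phi> Z) / (s - t)) \<longlongrightarrow> \<partial>\<^sub>t f t R \<phi> Z) (at t)"
            by (simp add: has_field_derivative_iff)
          then have "(\<lambda>n. q n x) \<longlonglongrightarrow> \<partial>\<^sub>t f t R \<phi> Z"
            using X Xt unfolding tendsto_at_iff_sequentially q_def x comp_def by auto
          then show ?thesis using True x by simp
        qed simp
      qed
      show "AE x in lborel. norm (indicat_real (cyl D) x *\<^sub>R q n x) \<le> indicat_real (cyl D) x *\<^sub>R M" for n
      proof (rule AE_I2)
        fix x :: "real \<times> real \<times> real"
        obtain R \<phi> Z where x: "x = (R, \<phi>, Z)" by (cases x)
        have "\<bar>q n x\<bar> \<le> M" if "x \<in> cyl D"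
          using lip[of "X n" R \<phi> Z] X[of n] that by (auto simp: q_def x field_simps)
        then show "norm (indicat_real (cyl D) x *\<^sub>R q n x) \<le> indicat_real (cyl D) x *\<^sub>R M"
          by (simp add: indicator_def)
      qed
    qed
    then show ?thesis using q(2) by simp
  qed
  show ?thesis
    unfolding has_field_derivative_iff tendsto_at_iff_sequentially comp_def
  proof (intro allI impI)
    fix X :: "nat \<Rightarrow> real" assume X: "\<forall>i. X i \<in> UNIV - {t}" "X \<longlonglongrightarrow> t"
    \<comment> \<open>\<open>lim\<close> covers sequences that stay in the ball; an arbitrary
      sequence tending to \<open>t\<close> does so from some index \<open>N\<close> on, and a shift
      does not change the limit.\<close>
    have "\<forall>\<^sub>F n in sequentially. X n \<in> cball t \<delta>"
      using X(2) \<delta>(1) by (rule_tac topological_tendstoD[of _ _ _ "ball t \<delta>", THEN eventually_mono]) auto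
    then obtain N where N: "\<And>n. n \<ge> N \<Longrightarrow> X n \<in> cball t \<delta>" by (auto simp: eventually_sequentially)
    have "(\<lambda>n. X (n + N)) \<longlonglongrightarrow> t" using X(2) by (rule LIMSEQ_ignore_initial_segment)
    from LIMSEQ_offset[OF lim[OF _ this]]
    show "(\<lambda>n. ((LINT x:cyl D|lborel. uncurry3 (f (X n)) x)
        - (LINT x:cyl D|lborel. uncurry3 (f t) x)) / (X n - t))
      \<longlonglongrightarrow> (LINT x:cyl D|lborel. uncurry3 (\<partial>\<^sub>t f t) x)"
      using N X(1) by auto
  qed
qed

end

text \<open>Moving from \<open>x\<close> by \<open>s (\<tau> + n)\<close> leaves \<open>D\<close> and moving by \<open>s (\<tau> - n)\<close> enters it, so the frontier
  is met at some \<open>x + s (\<tau> + c n)\<close> with \<open>\<bar>c\<bar> \<le> 1\<close>. There \<open>f\<close> vanishes, and \<open>f' n = 0\<close> forces \<open>f' \<tau> = 0\<close>.\<close>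

lemma derivative_eq_0_at_normal:
  fixes f :: "real \<times> real \<Rightarrow> real"
  assumes D: "open D" and n: "outward_normal D x n" and f: "(f has_derivative f') (at x)"
    and zero: "\<And>y. y \<in> frontier D \<Longrightarrow> f y = 0" and f'n: "f' n = 0"
  shows "f' h = 0"
proof -
  from n obtain V g G where x: "x \<in> frontier D" and V: "open V" "x \<in> V"
    and DV: "D \<inter> V = {y \<in> V. g y < 0}" and g: "(g has_derivative (\<lambda>h. h \<bullet> G)) (at x)"
    and G: "G \<noteq> 0" and nG: "n = sgn G"
    by (auto simp: outward_normal_def gderiv_def inner_commute)
  have Gn: "n \<bullet> G = norm G"
    using G by (simp add: nG sgn_div_norm dot_square_norm power2_eq_square)
  have nn: "norm n = 1" using G by (simp add: nG norm_sgn)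
  have lin: "linear f'" using f by (rule has_derivative_linear)
  have "x \<notin> D" using x D by (simp add: frontier_def interior_open)
  have DV': "y \<in> D \<longleftrightarrow> g y < 0" if "y \<in> V" for y using DV that by blast
  have "g x \<ge> 0" using DV'[OF V(2)] \<open>x \<notin> D\<close> by simp
  \<comment> \<open>If \<open>g\<close> were positive at \<open>x\<close>, it would be so on a
    neighbourhood, which would then miss \<open>D\<close>, although \<open>x\<close> lies in the
    closure of \<open>D\<close>.\<close>
  moreover have "g x \<le> 0"
  proof (rule ccontr)
    assume "\<not> g x \<le> 0"
    moreover have "isCont g x" using g has_derivative_continuous by blast
    ultimately have "\<forall>\<^sub>F y in at x. g y > 0" "g x > 0"
      by (auto simp: isCont_def intro: order_tendstoD(1))
    then have "\<forall>\<^sub>F y in nhds x. g y > 0"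
      by (simp add: eventually_nhds_conv_at)
    then have "\<forall>\<^sub>F y in nhds x. y \<in> V \<and> g y > 0"
      using eventually_nhds_in_open[OF V] by (rule eventually_conj[rotated])
    then obtain W where W: "open W" "x \<in> W" "\<And>y. y \<in> W \<Longrightarrow> y \<in> V \<and> g y > 0"
      by (auto simp: eventually_nhds)
    have "x \<in> closure D" using x by (simp add: frontier_def)
    then obtain y where "y \<in> W" "y \<in> D" using open_Int_closure_eq_empty[OF W(1), of D] W(2) by blast
    then show False using W(3)[of y] DV'[of y] by simp
  qed
  ultimately have gx: "g x = 0" by simp
  have tangent: "f' \<tau> = 0" if \<tau>: "\<tau> \<bullet> G = 0" for \<tau>
  proof -
    have bound: "\<bar>f' \<tau>\<bar> \<le> e * (norm \<tau> + 1)" if e: "e > 0" for e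
    proof -
      \<comment> \<open>This accuracy makes the linearisation error of \<open>g\<close> at most half
        of \<open>s * norm G\<close> at the points \<open>p c\<close> below, so the signs of
        \<open>g\<close> at \<open>p 1\<close> and \<open>p (-1)\<close> are those of the linear
        part.\<close>
      have "norm G / (2 * (norm \<tau> + 1)) > 0" using G by (simp add: add_nonneg_pos)
      then obtain d1 where d1: "d1 > 0"
        "\<And>y. norm (y - x) < d1 \<Longrightarrow> \<bar>g y - g x - (y - x) \<bullet> G\<bar> \<le> norm G / (2 * (norm \<tau> + 1)) * norm (y - x)"
        using g unfolding has_derivative_at_alt real_norm_def by blast
      obtain d2 where d2: "d2 > 0" "\<And>y. norm (y - x) < d2 \<Longrightarrow> \<bar>f y - f x - f' (y - x)\<bar> \<le> e * norm (y - x)"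
        using f e unfolding has_derivative_at_alt real_norm_def by blast
      obtain d3 where d3: "d3 > 0" "ball x d3 \<subseteq> V" using V openE by blast
      \<comment> \<open>All points \<open>p c\<close> with \<bar>c\<bar> \<le> 1 lie within
        \<open>s * (norm \<tau> + 1)\<close> of \<open>x\<close>, which is half of the smallest of
        the three radii.\<close>
      define s where "s = min d1 (min d2 d3) / (2 * (norm \<tau> + 1))"
      have np: "norm \<tau> + 1 > 0" by (simp add: add_nonneg_pos)
      have s: "s > 0" "s * (norm \<tau> + 1) < d1" "s * (norm \<tau> + 1) < d2" "s * (norm \<tau> + 1) < d3"
      proof -
        have "m / (2 * k) * k = m / 2" if "k > 0" for m k :: real using that by simp
        from this[OF np] have "s * (norm \<tau> + 1) = min d1 (min d2 d3) / 2" by (simp only: s_def)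
        then show "s * (norm \<tau> + 1) < d1" "s * (norm \<tau> + 1) < d2" "s * (norm \<tau> + 1) < d3"
          using d1(1) d2(1) d3(1) by auto
        show "s > 0" using d1(1) d2(1) d3(1) np by (simp add: s_def)
      qed
      define p where "p c = x + s *\<^sub>R (\<tau> + c *\<^sub>R n)" for c
      have np': "norm (p c - x) \<le> s * (norm \<tau> + 1)" if "\<bar>c\<bar> \<le> 1" for c
      proof -
        have "norm (\<tau> + c *\<^sub>R n) \<le> norm \<tau> + \<bar>c\<bar>"
          using norm_triangle_ineq[of \<tau> "c *\<^sub>R n"] nn by simp
        then show ?thesis using s(1) that by (simp add: p_def)
      qed
      have pV: "p c \<in> V" if "\<bar>c\<bar> \<le> 1" for c
        using np'[OF that] s(4) d3(2) by (auto simp: dist_norm norm_minus_commute subset_eq)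
      have gp: "\<bar>g (p c) - s * c * norm G\<bar> \<le> s * norm G / 2" if "\<bar>c\<bar> \<le> 1" for c
      proof -
        have "\<bar>g (p c) - g x - (p c - x) \<bullet> G\<bar> \<le> norm G / (2 * (norm \<tau> + 1)) * norm (p c - x)"
          using np'[OF that] s(2) by (intro d1(2)) linarith
        also have "\<dots> \<le> norm G / (2 * (norm \<tau> + 1)) * (s * (norm \<tau> + 1))"
          using np'[OF that] np by (intro mult_left_mono) auto
        also have "\<dots> = s * norm G / 2" using np by (simp add: field_simps)
        finally show ?thesis
          using gx by (simp add: p_def inner_add_left \<tau> Gn mult.assoc)
      qed
      have sG: "s * norm G > 0" using s(1) G by simp
      have "g (p 1) > 0" using gp[of 1] sG by (simp add: abs_if split: if_splits)
      moreover have "g (p (-1)) < 0" using gp[of "-1"] sG by (simp add: abs_if split: if_splits)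
      ultimately have "p 1 \<notin> D" "p (-1) \<in> D" using DV'[OF pV] by simp_all
      moreover have "connected (p ` {-1..1})"
        unfolding p_def by (intro connected_continuous_image continuous_intros) auto
      moreover have "p 1 \<in> p ` {-1..1}" "p (-1) \<in> p ` {-1..1}" by auto
      ultimately have "p ` {-1..1} \<inter> frontier D \<noteq> {}"
        by (intro connected_Int_frontier) blast+
      then obtain c where c': "c \<in> {-1..1}" "p c \<in> frontier D" by blast
      then have c: "\<bar>c\<bar> \<le> 1" "p c \<in> frontier D" by auto
      have "\<bar>f (p c) - f x - f' (p c - x)\<bar> \<le> e * norm (p c - x)"
        using np'[OF c(1)] s(3) by (intro d2(2)) linarith
      also have "\<dots> \<le> e * (s * (norm \<tau> + 1))"
        using np'[OF c(1)] e by (intro mult_left_mono) auto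
      finally have "\<bar>f' (p c - x)\<bar> \<le> e * (s * (norm \<tau> + 1))"
        using zero[OF c(2)] zero[OF x] by simp
      \<comment> \<open>The unknown normal displacement \<open>c\<close> disappears because
        \<open>f'\<close> vanishes on \<open>n\<close>.\<close>
      moreover have "f' (p c - x) = s * f' \<tau>"
        using linear_add[OF lin] linear_cmul[OF lin] f'n by (simp add: p_def)
      ultimately have "s * \<bar>f' \<tau>\<bar> \<le> s * (e * (norm \<tau> + 1))"
        using s(1) by (simp add: abs_mult algebra_simps)
      then show ?thesis using s(1) by simp
    qed
    show ?thesis
    proof (rule ccontr)
      assume ne: "f' \<tau> \<noteq> 0"
      have np: "norm \<tau> + 1 > 0" by (simp add: add_nonneg_pos)
      have "m / (2 * k) * k = m / 2" if "k > 0" for m k :: real using that by simp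
      \<comment> \<open>The bound holds for every \<open>e\<close>; this choice of \<open>e\<close>
        makes \<bar>f' \<tau>\<bar> at most half of itself.\<close>
      from this[OF np] have "\<bar>f' \<tau>\<bar> \<le> \<bar>f' \<tau>\<bar> / 2"
        using bound[of "\<bar>f' \<tau>\<bar> / (2 * (norm \<tau> + 1))"] ne np
            by (metis divide_pos_pos mult_pos_pos zero_less_abs_iff zero_less_numeral)
      then show False using ne by simp
    qed
  qed
  \<comment> \<open>Subtracting the normal component of \<open>h\<close> leaves a tangential vector,
    and \<open>f'\<close> vanishes on both parts.\<close>
  define c where "c = (h \<bullet> G) / norm G"
  have "(h - c *\<^sub>R n) \<bullet> G = 0" using G by (simp add: c_def inner_diff_left Gn)
  then have "f' (h - c *\<^sub>R n) = 0" by (rule tangent)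
  then show ?thesis using linear_diff[OF lin] linear_cmul[OF lin] f'n by simp
qed

context poloidal_domain
begin

lemma frontier_U: "frontier D \<subseteq> U"
  using closure_D by (auto simp: frontier_def)

text \<open>Where a normal exists, the condition on the normal derivative and the constant boundary
  value kill the whole poloidal gradient. Such points are dense in the frontier, and their closure
  stays in \<open>U\<close>, where the partial derivatives are continuous, so the gradient vanishes
  on all of the frontier.\<close>

lemma gradient_eq_0_on_frontier:
  assumes f: "sm 1 f" and zero: "\<And>R Z. (R, Z) \<in> frontier D \<Longrightarrow> f R \<phi> Z = 0"
    and normal: "\<And>R Z n. outward_normal D (R, Z) n \<Longrightarrow> normal_derivative f n R \<phi> Z = 0"
    and dense: "frontier D \<subseteq> closure {x. \<exists>n. outward_normal D x n}"
    and x: "(R, Z) \<in> frontier D"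
  shows "\<partial>\<^sub>R f R \<phi> Z = 0" "\<partial>\<^sub>Z f R \<phi> Z = 0"
proof -
  let ?N = "{x. \<exists>n. outward_normal D x n}"
  have f1: "sm (Suc 0) f" using f by simp
  have NF: "?N \<subseteq> frontier D" by (auto simp: outward_normal_def)
  then have clN: "closure ?N \<subseteq> frontier D" by (intro closure_minimal) auto
  have atN: "\<partial>\<^sub>R f r \<phi> z = 0 \<and> \<partial>\<^sub>Z f r \<phi> z = 0" if n: "outward_normal D (r, z) n" for r z n
  proof -
    have rz: "(r, z) \<in> U" using n frontier_U NF by blast
    let ?f' = "\<lambda>h. frechet_derivative (uncurry3 f) (at (r, \<phi>, z)) (fst h, 0, snd h)"
    have F: "(uncurry3 f has_derivative frechet_derivative (uncurry3 f) (at (r, \<phi>, z))) (at (r, \<phi>, z))"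
      by (rule sm_has_derivative[OF f1 rz])
    have "((\<lambda>p. (fst p, \<phi>, snd p)) has_derivative (\<lambda>h. (fst h, 0, snd h))) (at (r, z))"
      by (auto intro!: derivative_eq_intros)
    from has_derivative_compose[OF this, of "uncurry3 f"] F
    have der: "((\<lambda>p. f (fst p) \<phi> (snd p)) has_derivative ?f') (at (r, z))" by simp
    define L where "L = ?f'"
    have der: "((\<lambda>p. f (fst p) \<phi> (snd p)) has_derivative L) (at (r, z))" using der by (simp add: L_def)
    have lin: "linear L" using der by (rule has_derivative_linear)
    have p: "L (1, 0) = \<partial>\<^sub>R f r \<phi> z" "L (0, 1) = \<partial>\<^sub>Z f r \<phi> z"
      by (simp_all add: L_def partial_frechet[OF f1 rz])
    have "L n = L (fst n *\<^sub>R (1, 0) + snd n *\<^sub>R (0, 1))" by (rule arg_cong[where f=L]) (simp add: prod_eq_iff)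
    also have "\<dots> = fst n * \<partial>\<^sub>R f r \<phi> z + snd n * \<partial>\<^sub>Z f r \<phi> z"
      by (simp only: linear_add[OF lin] linear_cmul[OF lin] p real_scaleR_def)
    also have "\<dots> = normal_derivative f n r \<phi> z"
      by (simp add: normal_derivative_def grad_def inner_vec_def sum_3)
    finally have "L n = 0" using normal[OF n] by simp
    from derivative_eq_0_at_normal[OF open_D n der _ this] zero
    have "L h = 0" for h by (auto simp: case_prod_unfold)
    then show ?thesis using p by simp
  qed
  have cont: "continuous_on (closure ?N) (\<lambda>x. uncurry3 g (fst x, \<phi>, snd x))" if "sm 0 g" for g
    by (rule continuous_on_compose2[OF sm_continuous[OF that]])
      (use clN frontier_U in \<open>auto intro!: continuous_intros\<close>)
  have xN: "(R, Z) \<in> closure ?N" using x dense by blast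
  show "\<partial>\<^sub>R f R \<phi> Z = 0"
    using continuous_constant_on_closure[OF cont[OF sm_partial(1)[OF f1]] _ xN, of 0] atN by force
  show "\<partial>\<^sub>Z f R \<phi> Z = 0"
    using continuous_constant_on_closure[OF cont[OF sm_partial(3)[OF f1]] _ xN, of 0] atN by force
qed

end

section \<open>Calculus in poloidal coordinates\<close>

text \<open>The inner product of poloidal gradients as a scalar field, so that it can be
  differentiated without passing through vectors.\<close>

definition dot_pol :: "scalar_field \<Rightarrow> scalar_field \<Rightarrow> scalar_field"
  where "dot_pol f g R \<phi> Z = \<partial>\<^sub>R f R \<phi> Z * \<partial>\<^sub>R g R \<phi> Z + \<partial>\<^sub>Z f R \<phi> Z * \<partial>\<^sub>Z g R \<phi> Z"

lemma inner_grad_pol: "grad_pol f R \<phi> Z \<bullet> grad_pol g R \<phi> Z = dot_pol f g R \<phi> Z"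
  by (simp add: grad_pol_def dot_pol_def inner_vec_def sum_3)

lemma norm_grad_pol: "(norm (grad_pol f R \<phi> Z))\<^sup>2 = dot_pol f f R \<phi> Z"
  by (simp add: power2_norm_eq_inner inner_grad_pol)

lemma norm_B_pol: "(norm (B_pol \<psi> R \<phi> Z))\<^sup>2 = dot_pol \<psi> \<psi> R \<phi> Z / R\<^sup>2"
  unfolding power2_norm_eq_inner
      by (simp add: B_pol_components inner_vec_def sum_3 dot_pol_def add_divide_distrib power2_eq_square)

lemma norm_B_field: "(norm (B_field F0 \<psi> R \<phi> Z))\<^sup>2 = (F0\<^sup>2 + dot_pol \<psi> \<psi> R \<phi> Z) / R\<^sup>2"
  unfolding power2_norm_eq_inner
      by (simp add: B_field_def B_pol_components e_phi_def inner_vec_def sum_3 dot_pol_def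
      add_divide_distrib power2_eq_square)

text \<open>The poloidal drift is \<open>R\<close> times the gradient of \<open>u\<close> rotated by
  a right angle, and \<open>B_pol\<close> is 1 / R times the gradient of \<psi> rotated the opposite
  way. In the cross term the weights cancel and a minus sign remains; the toroidal component of the
  drift is zero.\<close>

lemma norm_velocity:
  assumes "R \<noteq> 0"
  shows "(norm (velocity F0 \<psi> u v R \<phi> Z))\<^sup>2 = R\<^sup>2 * dot_pol u u R \<phi> Z
    - 2 * v R \<phi> Z * dot_pol \<psi> u R \<phi> Z + (v R \<phi> Z)\<^sup>2 * ((F0\<^sup>2 + dot_pol \<psi> \<psi> R \<phi> Z) / R\<^sup>2)"
  unfolding power2_norm_eq_inner using assms
  by (simp add: velocity_components B_field_def B_pol_components e_phi_def inner_vec_def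
      sum_3 dot_pol_def add_divide_distrib power2_eq_square) (simp add: field_simps)

lemma divg_grad_pol:
  "divg (\<lambda>R \<phi> Z. s R \<phi> Z *\<^sub>R grad_pol f R \<phi> Z) R \<phi> Z =
    (1 / R) * \<partial>\<^sub>R (\<lambda>R \<phi> Z. R * (s R \<phi> Z * \<partial>\<^sub>R f R \<phi> Z)) R \<phi> Z
    + \<partial>\<^sub>Z (\<lambda>R \<phi> Z. s R \<phi> Z * \<partial>\<^sub>Z f R \<phi> Z) R \<phi> Z"
  by (simp add: divg_def grad_pol_def partial_phi_def)

lemma rho_hat_eq: "rho_hat \<rho> = (\<lambda>R \<phi> Z. R\<^sup>2 * \<rho> R \<phi> Z)"
  by (simp add: fun_eq_iff rho_hat_def)

lemma pbracket_antisym: "pbracket a b R \<phi> Z = - pbracket b a R \<phi> Z"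
  by (simp add: pbracket_def)

lemma pbracket_self: "pbracket a a R \<phi> Z = 0"
  by (simp add: pbracket_def)

context poloidal_region
begin

lemma partial_const: "\<partial>\<^sub>R (\<lambda>R \<phi> Z. c) R \<phi> Z = 0" "\<partial>\<^sub>\<phi> (\<lambda>R \<phi> Z. c) R \<phi> Z = 0" "\<partial>\<^sub>Z (\<lambda>R \<phi> Z. c) R \<phi> Z = 0"
  by (simp_all add: partial_R_def partial_phi_def partial_Z_def)

lemma partial_coord_power: "\<partial>\<^sub>R (\<lambda>R \<phi> Z. R ^ n) R \<phi> Z = real n * R ^ (n - 1)"
  "\<partial>\<^sub>\<phi> (\<lambda>R \<phi> Z. R ^ n) R \<phi> Z = 0" "\<partial>\<^sub>Z (\<lambda>R \<phi> Z. R ^ n) R \<phi> Z = 0"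
  by (auto simp: partial_R_def partial_phi_def partial_Z_def intro!: DERIV_imp_deriv derivative_eq_intros)

lemma partial_add:
  assumes "sm (Suc 0) f" "sm (Suc 0) g" "(R, Z) \<in> U"
  shows "\<partial>\<^sub>R (\<lambda>R \<phi> Z. f R \<phi> Z + g R \<phi> Z) R \<phi> Z = \<partial>\<^sub>R f R \<phi> Z + \<partial>\<^sub>R g R \<phi> Z"
    and "\<partial>\<^sub>\<phi> (\<lambda>R \<phi> Z. f R \<phi> Z + g R \<phi> Z) R \<phi> Z = \<partial>\<^sub>\<phi> f R \<phi> Z + \<partial>\<^sub>\<phi> g R \<phi> Z"
    and "\<partial>\<^sub>Z (\<lambda>R \<phi> Z. f R \<phi> Z + g R \<phi> Z) R \<phi> Z = \<partial>\<^sub>Z f R \<phi> Z + \<partial>\<^sub>Z g R \<phi> Z"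
  using sm_deriv[of 0 f, OF _ assms(3)] sm_deriv[of 0 g, OF _ assms(3)] assms
  unfolding partial_R_def[of "\<lambda>R \<phi> Z. f R \<phi> Z + g R \<phi> Z"] partial_phi_def[of "\<lambda>R \<phi> Z. f R \<phi> Z + g R \<phi> Z"]
    partial_Z_def[of "\<lambda>R \<phi> Z. f R \<phi> Z + g R \<phi> Z"]
  by (auto intro!: DERIV_imp_deriv DERIV_add)

lemma partial_mult:
  assumes "sm (Suc 0) f" "sm (Suc 0) g" "(R, Z) \<in> U"
  shows "\<partial>\<^sub>R (\<lambda>R \<phi> Z. f R \<phi> Z * g R \<phi> Z) R \<phi> Z = f R \<phi> Z * \<partial>\<^sub>R g R \<phi> Z + g R \<phi> Z * \<partial>\<^sub>R f R \<phi> Z"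
    and "\<partial>\<^sub>\<phi> (\<lambda>R \<phi> Z. f R \<phi> Z * g R \<phi> Z) R \<phi> Z = f R \<phi> Z * \<partial>\<^sub>\<phi> g R \<phi> Z + g R \<phi> Z * \<partial>\<^sub>\<phi> f R \<phi> Z"
    and "\<partial>\<^sub>Z (\<lambda>R \<phi> Z. f R \<phi> Z * g R \<phi> Z) R \<phi> Z = f R \<phi> Z * \<partial>\<^sub>Z g R \<phi> Z + g R \<phi> Z * \<partial>\<^sub>Z f R \<phi> Z"
  unfolding partial_R_def[of "\<lambda>R \<phi> Z. f R \<phi> Z * g R \<phi> Z"] partial_phi_def[of "\<lambda>R \<phi> Z. f R \<phi> Z * g R \<phi> Z"]
    partial_Z_def[of "\<lambda>R \<phi> Z. f R \<phi> Z * g R \<phi> Z"]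
  using assms sm_deriv[of 0 f, OF _ assms(3)] sm_deriv[of 0 g, OF _ assms(3)]
  by (auto intro!: DERIV_imp_deriv derivative_eq_intros)

lemma partial_divide_R_power:
  assumes "sm (Suc 0) f" "(R, Z) \<in> U"
  shows "\<partial>\<^sub>R (\<lambda>R \<phi> Z. f R \<phi> Z / R ^ n) R \<phi> Z = \<partial>\<^sub>R f R \<phi> Z / R ^ n - real n * f R \<phi> Z / R ^ Suc n"
    and "\<partial>\<^sub>\<phi> (\<lambda>R \<phi> Z. f R \<phi> Z / R ^ n) R \<phi> Z = \<partial>\<^sub>\<phi> f R \<phi> Z / R ^ n"
    and "\<partial>\<^sub>Z (\<lambda>R \<phi> Z. f R \<phi> Z / R ^ n) R \<phi> Z = \<partial>\<^sub>Z f R \<phi> Z / R ^ n"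
proof -
  note d = sm_deriv[of 0 f, OF _ assms(2)]
  have R: "R \<noteq> 0" using R_pos[OF assms(2)] by simp
  have "((\<lambda>r. inverse r ^ n) has_real_derivative - real n * inverse R ^ Suc n) (at R)"
  proof (cases n)
    case (Suc m)
    show ?thesis
      using DERIV_power_Suc[OF DERIV_inverse[OF R], of m] by (simp add: Suc algebra_simps)
  qed simp
  then have "((\<lambda>r. f r \<phi> Z * inverse r ^ n) has_real_derivative
      \<partial>\<^sub>R f R \<phi> Z * inverse R ^ n + (- real n * inverse R ^ Suc n) * f R \<phi> Z) (at R)"
    using d(1)[of \<phi>] assms(1) by (intro DERIV_mult) auto
  then have "((\<lambda>r. f r \<phi> Z / r ^ n) has_real_derivative \<partial>\<^sub>R f R \<phi> Z / R ^ n - real n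
      * f R \<phi> Z / R ^ Suc n) (at R)"
    by (simp add: divide_inverse power_inverse algebra_simps)
  then show "\<partial>\<^sub>R (\<lambda>R \<phi> Z. f R \<phi> Z / R ^ n) R \<phi> Z = \<partial>\<^sub>R f R \<phi> Z / R ^ n - real n * f R \<phi> Z / R ^ Suc n"
    by (auto simp: partial_R_def[of "\<lambda>R \<phi> Z. f R \<phi> Z / R ^ n"] intro: DERIV_imp_deriv)
  show "\<partial>\<^sub>\<phi> (\<lambda>R \<phi> Z. f R \<phi> Z / R ^ n) R \<phi> Z = \<partial>\<^sub>\<phi> f R \<phi> Z / R ^ n"
    unfolding partial_phi_def[of "\<lambda>R \<phi> Z. f R \<phi> Z / R ^ n"]
    using assms d(2)[of \<phi>] by (intro DERIV_imp_deriv DERIV_cdivide) auto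
  show "\<partial>\<^sub>Z (\<lambda>R \<phi> Z. f R \<phi> Z / R ^ n) R \<phi> Z = \<partial>\<^sub>Z f R \<phi> Z / R ^ n"
    unfolding partial_Z_def[of "\<lambda>R \<phi> Z. f R \<phi> Z / R ^ n"]
    using assms d(3)[of \<phi>] by (intro DERIV_imp_deriv DERIV_cdivide) auto
qed

lemmas partial_divide_R = partial_divide_R_power[where n="Suc 0", simplified]

lemma partial_power2:
  assumes "sm (Suc 0) f" "(R, Z) \<in> U"
  shows "\<partial>\<^sub>R (\<lambda>R \<phi> Z. (f R \<phi> Z)\<^sup>2) R \<phi> Z = 2 * f R \<phi> Z * \<partial>\<^sub>R f R \<phi> Z"
    and "\<partial>\<^sub>\<phi> (\<lambda>R \<phi> Z. (f R \<phi> Z)\<^sup>2) R \<phi> Z = 2 * f R \<phi> Z * \<partial>\<^sub>\<phi> f R \<phi> Z"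
    and "\<partial>\<^sub>Z (\<lambda>R \<phi> Z. (f R \<phi> Z)\<^sup>2) R \<phi> Z = 2 * f R \<phi> Z * \<partial>\<^sub>Z f R \<phi> Z"
  using partial_mult[OF assms(1,1,2)] by (simp_all add: power2_eq_square)

lemma sm_partial_12: "sm 2 f \<Longrightarrow> sm (Suc 0) (\<partial>\<^sub>R f)" "sm 2 f \<Longrightarrow> sm (Suc 0) (\<partial>\<^sub>\<phi> f)" "sm 2 f \<Longrightarrow> sm (Suc 0) (\<partial>\<^sub>Z f)"
  and sm_partial_23: "sm 3 f \<Longrightarrow> sm 2 (\<partial>\<^sub>R f)" "sm 3 f \<Longrightarrow> sm 2 (\<partial>\<^sub>\<phi> f)" "sm 3 f \<Longrightarrow> sm 2 (\<partial>\<^sub>Z f)"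
  using sm_partial[of "Suc 0" f] sm_partial[of 2 f] by (auto simp: numeral_3_eq_3 numeral_2_eq_2)

lemma sm_dot_pol: "sm (Suc k) f \<Longrightarrow> sm (Suc k) g \<Longrightarrow> sm k (dot_pol f g)"
  using sm_add[OF sm_mult[OF sm_partial(1) sm_partial(1)] sm_mult[OF sm_partial(3) sm_partial(3)], of k f g f g]
  by (simp add: dot_pol_def[abs_def])

lemma sm_dot_pol_12: "sm 2 f \<Longrightarrow> sm 2 g \<Longrightarrow> sm (Suc 0) (dot_pol f g)"
  using sm_dot_pol[where k="Suc 0"] by (simp add: numeral_2_eq_2)

lemmas sm_intros = sm_const sm_R sm_add sm_mult sm_power sm_divide_R sm_divide_R_power
  sm_divide_const sm_partial_12 sm_partial_23 sm_dot_pol_12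

lemma partial_dot_pol_phi:
  assumes "sm 2 f" "sm 2 g" "(R, Z) \<in> U"
  shows "\<partial>\<^sub>\<phi> (dot_pol f g) R \<phi> Z = dot_pol (\<partial>\<^sub>\<phi> f) g R \<phi> Z + dot_pol f (\<partial>\<^sub>\<phi> g) R \<phi> Z"
proof -
  have "dot_pol f g = (\<lambda>R \<phi> Z. \<partial>\<^sub>R f R \<phi> Z * \<partial>\<^sub>R g R \<phi> Z + \<partial>\<^sub>Z f R \<phi> Z * \<partial>\<^sub>Z g R \<phi> Z)"
    by (simp add: fun_eq_iff dot_pol_def)
  then show ?thesis
    using assms by (simp add: partial_add partial_mult sm_intros sm_commute)
      (simp add: dot_pol_def algebra_simps)
qed

lemma parts_bracket:
  assumes "sm (Suc 0) a" "sm (Suc 0) h" "(R, Z) \<in> U"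
  shows "a R \<phi> Z * pbracket h b R \<phi> Z
    = pbracket (\<lambda>R \<phi> Z. a R \<phi> Z * h R \<phi> Z) b R \<phi> Z - h R \<phi> Z * pbracket a b R \<phi> Z"
  using assms by (simp add: pbracket_def partial_mult algebra_simps)

lemma parts_partial:
  assumes "sm (Suc 0) a" "sm (Suc 0) m" "(R, Z) \<in> U"
  shows "a R \<phi> Z * \<partial>\<^sub>R m R \<phi> Z = \<partial>\<^sub>R (\<lambda>R \<phi> Z. a R \<phi> Z * m R \<phi> Z) R \<phi> Z - \<partial>\<^sub>R a R \<phi> Z * m R \<phi> Z"
    and "a R \<phi> Z * \<partial>\<^sub>Z m R \<phi> Z = \<partial>\<^sub>Z (\<lambda>R \<phi> Z. a R \<phi> Z * m R \<phi> Z) R \<phi> Z - \<partial>\<^sub>Z a R \<phi> Z * m R \<phi> Z"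
  using assms by (simp_all add: partial_mult algebra_simps)

text \<open>The mixed derivatives of \<open>b\<close> cancel, whence the asymmetric regularity:
  \<open>b\<close> is differentiated twice, \<open>a\<close> once. The divergence is the one for the
  measure dR dZ, without the weight R.\<close>

lemma bracket_divergence:
  assumes "sm (Suc 0) a" "sm 2 b" "(R, Z) \<in> U"
  shows "pbracket a b R \<phi> Z
    = \<partial>\<^sub>R (\<lambda>R \<phi> Z. a R \<phi> Z * \<partial>\<^sub>Z b R \<phi> Z) R \<phi> Z - \<partial>\<^sub>Z (\<lambda>R \<phi> Z. a R \<phi> Z * \<partial>\<^sub>R b R \<phi> Z) R \<phi> Z"
  using assms by (simp add: pbracket_def partial_mult sm_intros sm_commute algebra_simps)

end

section \<open>Fields whose integral vanishes\<close>

context poloidal_domain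
begin

text \<open>Integrability is part of the notion: a non-integrable field has integral 0 by default,
  and sums of such fields would not behave.\<close>

definition null :: "scalar_field \<Rightarrow> bool"
  where "null f \<longleftrightarrow> set_integrable lborel (cyl D) (uncurry3 f) \<and> (LINT x:cyl D|lborel. uncurry3 f x) = 0"

definition vanish :: "scalar_field \<Rightarrow> bool"
  where "vanish f \<longleftrightarrow> (\<forall>(R, \<phi>, Z)\<in>cyl (frontier D). f R \<phi> Z = 0)"

lemma vanish_mult: "vanish f \<Longrightarrow> vanish (\<lambda>R \<phi> Z. f R \<phi> Z * g R \<phi> Z)" "vanish g \<Longrightarrow> vanish (\<lambda>R \<phi> Z. f R \<phi> Z
    * g R \<phi> Z)"
  by (auto simp: vanish_def)

lemma null_add: "null f \<Longrightarrow> null g \<Longrightarrow> null (\<lambda>R \<phi> Z. f R \<phi> Z + g R \<phi> Z)"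
  unfolding null_def case_prod_unfold by (auto simp: set_integral_add)

lemma null_diff: "null f \<Longrightarrow> null g \<Longrightarrow> null (\<lambda>R \<phi> Z. f R \<phi> Z - g R \<phi> Z)"
  unfolding null_def case_prod_unfold by (auto simp: set_integral_diff)

lemma null_cmult: "null f \<Longrightarrow> null (\<lambda>R \<phi> Z. c * f R \<phi> Z)"
  unfolding null_def case_prod_unfold by (auto simp: set_integral_mult_right)

lemma null_cong:
  assumes "null f" and eq: "\<And>R \<phi> Z. (R, \<phi>, Z) \<in> cyl D \<Longrightarrow> f R \<phi> Z = g R \<phi> Z"
  shows "null g"
proof -
  have "(\<lambda>x. indicat_real (cyl D) x *\<^sub>R uncurry3 f x) = (\<lambda>x. indicat_real (cyl D) x *\<^sub>R uncurry3 g x)"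
    using eq by (auto simp: fun_eq_iff indicator_def)
  then show ?thesis
    using assms(1) by (simp only: null_def set_integrable_def set_lebesgue_integral_def)
qed

lemma null_partial_R:
  assumes "sm (Suc 0) f" "vanish f" shows "null (\<partial>\<^sub>R f)"
proof -
  have "(LINT x:cyl D|lborel. uncurry3 (\<partial>\<^sub>R f) x) = 0"
    by (rule integral_partial_R_eq_0) (use assms in \<open>auto simp: vanish_def cyl_def\<close>)
  then show ?thesis using sm_integrable[OF sm_partial(1)[OF assms(1)]] by (simp add: null_def)
qed

lemma null_partial_Z:
  assumes "sm (Suc 0) f" "vanish f" shows "null (\<partial>\<^sub>Z f)"
proof -
  have "(LINT x:cyl D|lborel. uncurry3 (\<partial>\<^sub>Z f) x) = 0"
    by (rule integral_partial_Z_eq_0) (use assms in \<open>auto simp: vanish_def cyl_def\<close>)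
  then show ?thesis using sm_integrable[OF sm_partial(3)[OF assms(1)]] by (simp add: null_def)
qed

lemma null_partial_phi:
  assumes "sm (Suc 0) f" "\<And>R Z. (R, Z) \<in> D \<Longrightarrow> f R (2 * pi) Z = f R 0 Z" shows "null (\<partial>\<^sub>\<phi> f)"
proof -
  have "(LINT x:cyl D|lborel. uncurry3 (\<partial>\<^sub>\<phi> f) x) = 0"
    by (rule integral_partial_phi_eq_0) (use assms in auto)
  then show ?thesis using sm_integrable[OF sm_partial(2)[OF assms(1)]] by (simp add: null_def)
qed

lemma null_bracket:
  assumes "sm (Suc 0) a" "sm 2 b" "vanish a" shows "null (pbracket a b)"
proof (rule null_cong)
  show "null (\<lambda>R \<phi> Z. \<partial>\<^sub>R (\<lambda>R \<phi> Z. a R \<phi> Z * \<partial>\<^sub>Z b R \<phi> Z) R \<phi> Z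
      - \<partial>\<^sub>Z (\<lambda>R \<phi> Z. a R \<phi> Z * \<partial>\<^sub>R b R \<phi> Z) R \<phi> Z)"
    by (intro null_diff null_partial_R null_partial_Z sm_mult vanish_mult(1) sm_partial_12 assms)
  show "\<partial>\<^sub>R (\<lambda>R \<phi> Z. a R \<phi> Z * \<partial>\<^sub>Z b R \<phi> Z) R \<phi> Z - \<partial>\<^sub>Z (\<lambda>R \<phi> Z. a R \<phi> Z * \<partial>\<^sub>R b R \<phi> Z) R \<phi> Z
      = pbracket a b R \<phi> Z" if "(R, \<phi>, Z) \<in> cyl D" for R \<phi> Z
    using bracket_divergence[OF assms(1,2)] that cyl_\<Omega> by auto
qed

end

section \<open>Integration by parts modulo fields with vanishing integral\<close>

context poloidal_domain
begin

text \<open>Invariance is asked at every angle, not only between the two ends of the period, so that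
  it passes to derivatives.\<close>

definition per :: "scalar_field \<Rightarrow> bool"
  where "per f \<longleftrightarrow> (\<forall>R \<phi> Z. (R, Z) \<in> D \<longrightarrow> f R (\<phi> + 2 * pi) Z = f R \<phi> Z)"

lemma per_2pi: "per f \<Longrightarrow> (R, Z) \<in> D \<Longrightarrow> f R (2 * pi) Z = f R 0 Z"
  unfolding per_def by (metis add_0)

lemma per_mult: "per f \<Longrightarrow> per g \<Longrightarrow> per (\<lambda>R \<phi> Z. f R \<phi> Z * g R \<phi> Z)"
  and per_add: "per f \<Longrightarrow> per g \<Longrightarrow> per (\<lambda>R \<phi> Z. f R \<phi> Z + g R \<phi> Z)"
  and per_R_fun: "per (\<lambda>R \<phi> Z. c R)"
  and per_divide: "per f \<Longrightarrow> per (\<lambda>R \<phi> Z. f R \<phi> Z / c R)"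
  and per_power: "per f \<Longrightarrow> per (\<lambda>R \<phi> Z. f R \<phi> Z ^ n)"
  unfolding per_def by auto

lemma per_partial:
  assumes "per f" shows "per (\<partial>\<^sub>R f)" "per (\<partial>\<^sub>\<phi> f)" "per (\<partial>\<^sub>Z f)"
proof -
  have f: "f R (\<phi> + 2 * pi) Z = f R \<phi> Z" if "(R, Z) \<in> D" for R \<phi> Z
    using assms that by (auto simp: per_def)
  have "\<partial>\<^sub>R f R (\<phi> + 2 * pi) Z = \<partial>\<^sub>R f R \<phi> Z \<and> \<partial>\<^sub>\<phi> f R (\<phi> + 2 * pi) Z = \<partial>\<^sub>\<phi> f R \<phi> Z
      \<and> \<partial>\<^sub>Z f R (\<phi> + 2 * pi) Z = \<partial>\<^sub>Z f R \<phi> Z" if D: "(R, Z) \<in> D" for R \<phi> Z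
  proof (intro conjI)
    have "open {r. (r, Z) \<in> D}" "open {z. (R, z) \<in> D}"
      using open_vimage[OF open_D, of "\<lambda>r. (r, Z)"] open_vimage[OF open_D, of "\<lambda>z. (R, z)"]
      by (simp_all add: vimage_def continuous_intros)
    then have "\<forall>\<^sub>F r in nhds R. (r, Z) \<in> D" "\<forall>\<^sub>F z in nhds Z. (R, z) \<in> D"
      using D eventually_nhds_in_open by fastforce+
    then show "\<partial>\<^sub>R f R (\<phi> + 2 * pi) Z = \<partial>\<^sub>R f R \<phi> Z" "\<partial>\<^sub>Z f R (\<phi> + 2 * pi) Z = \<partial>\<^sub>Z f R \<phi> Z"
      unfolding partial_R_def partial_Z_def by (auto intro!: deriv_cong_ev elim!: eventually_mono simp: f)
    have "(\<lambda>s. f R (s + 2 * pi) Z) = (\<lambda>s. f R s Z)" using f[OF D] by auto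
    moreover have "deriv (\<lambda>s. f R s Z) (\<phi> + 2 * pi) = deriv (\<lambda>s. f R (s + 2 * pi) Z) \<phi>"
      unfolding deriv_def by (simp add: DERIV_shift)
    ultimately show "\<partial>\<^sub>\<phi> f R (\<phi> + 2 * pi) Z = \<partial>\<^sub>\<phi> f R \<phi> Z"
      by (simp add: partial_phi_def)
  qed
  then show "per (\<partial>\<^sub>R f)" "per (\<partial>\<^sub>\<phi> f)" "per (\<partial>\<^sub>Z f)"
    unfolding per_def by auto
qed

lemma per_dot_pol: "per f \<Longrightarrow> per g \<Longrightarrow> per (dot_pol f g)"
  using per_add[OF per_mult[OF per_partial(1) per_partial(1)] per_mult[OF per_partial(3)
      per_partial(3)], of f g f g]
  by (simp add: dot_pol_def[abs_def])

lemma cyl_U: "(R, \<phi>, Z) \<in> cyl D \<Longrightarrow> (R, Z) \<in> U"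
  using cyl_\<Omega> by auto

lemma null_parts_bracket:
  assumes "sm (Suc 0) a" "sm (Suc 0) h" "sm 2 b" "vanish a"
  shows "null (\<lambda>R \<phi> Z. a R \<phi> Z * pbracket h b R \<phi> Z + h R \<phi> Z * pbracket a b R \<phi> Z)"
proof (rule null_cong)
  show "null (pbracket (\<lambda>R \<phi> Z. a R \<phi> Z * h R \<phi> Z) b)"
    by (intro null_bracket sm_mult vanish_mult(1) assms)
qed (simp add: parts_bracket[OF assms(1,2) cyl_U])

lemma null_parts_R:
  assumes "sm (Suc 0) a" "sm (Suc 0) m" "vanish a"
  shows "null (\<lambda>R \<phi> Z. a R \<phi> Z * \<partial>\<^sub>R m R \<phi> Z + \<partial>\<^sub>R a R \<phi> Z * m R \<phi> Z)"
proof (rule null_cong)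
  show "null (\<partial>\<^sub>R (\<lambda>R \<phi> Z. a R \<phi> Z * m R \<phi> Z))"
    by (intro null_partial_R sm_mult vanish_mult(1) assms)
qed (simp add: parts_partial(1)[OF assms(1,2) cyl_U])

text \<open>A power of R is constant along Z and may be pulled through the derivative.
  \<open>n = 1\<close> serves divergences multiplied by R, \<open>n = 0\<close> the terms whose
  coefficient 1 / R has been cancelled by that factor.\<close>

lemma null_parts_Z:
  assumes "sm (Suc 0) a" "sm (Suc 0) m" "vanish a"
  shows "null (\<lambda>R \<phi> Z. R ^ n * (a R \<phi> Z * \<partial>\<^sub>Z m R \<phi> Z + \<partial>\<^sub>Z a R \<phi> Z * m R \<phi> Z))"
proof (rule null_cong)
  show "null (\<partial>\<^sub>Z (\<lambda>R \<phi> Z. (R ^ n * a R \<phi> Z) * m R \<phi> Z))"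
    by (intro null_partial_Z sm_mult sm_power sm_R vanish_mult assms)
  show "\<partial>\<^sub>Z (\<lambda>R \<phi> Z. R ^ n * a R \<phi> Z * m R \<phi> Z) R \<phi> Z
      = R ^ n * (a R \<phi> Z * \<partial>\<^sub>Z m R \<phi> Z + \<partial>\<^sub>Z a R \<phi> Z * m R \<phi> Z)" if "(R, \<phi>, Z) \<in> cyl D" for R \<phi> Z
    using cyl_U[OF that] assms
    by (simp add: partial_mult partial_coord_power sm_intros algebra_simps)
qed

lemma null_parts_phi:
  assumes "sm (Suc 0) a" "sm (Suc 0) m" "per a" "per m"
  shows "null (\<lambda>R \<phi> Z. (a R \<phi> Z * \<partial>\<^sub>\<phi> m R \<phi> Z + \<partial>\<^sub>\<phi> a R \<phi> Z * m R \<phi> Z) / R)"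
proof (rule null_cong)
  have "per (\<lambda>R \<phi> Z. (a R \<phi> Z * m R \<phi> Z) / R)"
    by (intro per_divide per_mult assms)
  then have "((a R (2 * pi) Z * m R (2 * pi) Z) / R) = ((a R 0 Z * m R 0 Z) / R)" if "(R, Z) \<in> D" for R Z
    using per_2pi that by blast
  then show "null (\<partial>\<^sub>\<phi> (\<lambda>R \<phi> Z. (a R \<phi> Z * m R \<phi> Z) / R))"
    by (intro null_partial_phi sm_divide_R sm_mult assms)
  show "\<partial>\<^sub>\<phi> (\<lambda>R \<phi> Z. (a R \<phi> Z * m R \<phi> Z) / R) R \<phi> Z
      = (a R \<phi> Z * \<partial>\<^sub>\<phi> m R \<phi> Z + \<partial>\<^sub>\<phi> a R \<phi> Z * m R \<phi> Z) / R" if "(R, \<phi>, Z) \<in> cyl D" for R \<phi> Z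
    using cyl_U[OF that] assms
    by (simp add: partial_divide_R partial_mult sm_intros algebra_simps)
qed

text \<open>Divided by R, \<open>lap_star\<close> is the plain dR dZ divergence of the gradient of
  \<psi> over R. Applied twice: with \<open>a\<close> the time derivative of \<psi> for the magnetic
  energy, and with a second \<phi>-derivative over \<open>R\<^sup>2\<close> for the resistive
  term.\<close>

lemma null_magnetic:
  assumes "sm 2 \<psi>" "sm (Suc 0) a" "vanish a"
    and j: "\<And>R \<phi> Z. (R, \<phi>, Z) \<in> cyl D \<Longrightarrow> j R \<phi> Z = lap_star \<psi> R \<phi> Z"
  shows "null (\<lambda>R \<phi> Z. dot_pol \<psi> a R \<phi> Z / R + a R \<phi> Z * j R \<phi> Z / R)"
proof (rule null_cong)
  show "null (\<lambda>R \<phi> Z. (a R \<phi> Z * \<partial>\<^sub>R (\<lambda>R \<phi> Z. (1 / R) * \<partial>\<^sub>R \<psi> R \<phi> Z) R \<phi> Z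
      + \<partial>\<^sub>R a R \<phi> Z * ((1 / R) * \<partial>\<^sub>R \<psi> R \<phi> Z))
      + R ^ 0 * (a R \<phi> Z * \<partial>\<^sub>Z (\<lambda>R \<phi> Z. (1 / R) * \<partial>\<^sub>Z \<psi> R \<phi> Z) R \<phi> Z
      + \<partial>\<^sub>Z a R \<phi> Z * ((1 / R) * \<partial>\<^sub>Z \<psi> R \<phi> Z)))"
    by (intro null_add null_parts_R null_parts_Z sm_intros assms)
  fix R \<phi> Z assume x: "(R, \<phi>, Z) \<in> cyl D"
  have U: "(R, Z) \<in> U" by (rule cyl_U[OF x])
  have R: "R \<noteq> 0" using R_pos[OF U] by simp
  have Z: "\<partial>\<^sub>Z (\<lambda>R \<phi> Z. (1 / R) * \<partial>\<^sub>Z \<psi> R \<phi> Z) R \<phi> Z = (1 / R) * \<partial>\<^sub>Z (\<partial>\<^sub>Z \<psi>) R \<phi> Z"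
    using U assms by (simp add: partial_divide_R sm_intros)
  show "(a R \<phi> Z * \<partial>\<^sub>R (\<lambda>R \<phi> Z. (1 / R) * \<partial>\<^sub>R \<psi> R \<phi> Z) R \<phi> Z
      + \<partial>\<^sub>R a R \<phi> Z * ((1 / R) * \<partial>\<^sub>R \<psi> R \<phi> Z))
      + R ^ 0 * (a R \<phi> Z * \<partial>\<^sub>Z (\<lambda>R \<phi> Z. (1 / R) * \<partial>\<^sub>Z \<psi> R \<phi> Z) R \<phi> Z
      + \<partial>\<^sub>Z a R \<phi> Z * ((1 / R) * \<partial>\<^sub>Z \<psi> R \<phi> Z)) = dot_pol \<psi> a R \<phi> Z / R + a R \<phi> Z * j R \<phi> Z / R"
    unfolding Z j[OF x] lap_star_def dot_pol_def using R by (simp add: field_simps)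
qed

text \<open>Green's second identity for \<open>R * lap_pol\<close>, which is a dR dZ divergence. The
  first flux contains \<open>u\<close>, the second its gradient, and both vanish on the
  frontier.\<close>

lemma null_viscous:
  assumes "sm 2 u" "sm 2 w" "vanish u" "vanish (\<partial>\<^sub>R u)" "vanish (\<partial>\<^sub>Z u)"
    and w: "\<And>R \<phi> Z. (R, \<phi>, Z) \<in> cyl D \<Longrightarrow> w R \<phi> Z = lap_pol u R \<phi> Z"
  shows "null (\<lambda>R \<phi> Z. R * (u R \<phi> Z * lap_pol w R \<phi> Z) - R * (w R \<phi> Z)\<^sup>2)"
proof (rule null_cong)
  have 1: "sm (Suc 0) u" "sm (Suc 0) w" using assms by (auto intro: sm_lower)
  show "null (\<lambda>R \<phi> Z. ((u R \<phi> Z * \<partial>\<^sub>R (\<lambda>R \<phi> Z. R * \<partial>\<^sub>R w R \<phi> Z) R \<phi> Z + \<partial>\<^sub>R u R \<phi> Z * (R * \<partial>\<^sub>R w R \<phi> Z))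
      + R ^ 1 * (u R \<phi> Z * \<partial>\<^sub>Z (\<partial>\<^sub>Z w) R \<phi> Z + \<partial>\<^sub>Z u R \<phi> Z * \<partial>\<^sub>Z w R \<phi> Z))
      - (\<partial>\<^sub>R (\<lambda>R \<phi> Z. (R * \<partial>\<^sub>R u R \<phi> Z) * w R \<phi> Z) R \<phi> Z
      + R ^ 1 * (\<partial>\<^sub>Z u R \<phi> Z * \<partial>\<^sub>Z w R \<phi> Z + \<partial>\<^sub>Z (\<partial>\<^sub>Z u) R \<phi> Z * w R \<phi> Z)))"
    by (intro null_add null_diff null_parts_R null_parts_Z null_partial_R vanish_mult(1) vanish_mult(2) sm_intros assms 1)
  fix R \<phi> Z assume x: "(R, \<phi>, Z) \<in> cyl D"
  have U: "(R, Z) \<in> U" by (rule cyl_U[OF x])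
  have R: "R \<noteq> 0" using R_pos[OF U] by simp
  have prod: "\<partial>\<^sub>R (\<lambda>R \<phi> Z. (R * \<partial>\<^sub>R u R \<phi> Z) * w R \<phi> Z) R \<phi> Z
      = (R * \<partial>\<^sub>R u R \<phi> Z) * \<partial>\<^sub>R w R \<phi> Z + w R \<phi> Z * \<partial>\<^sub>R (\<lambda>R \<phi> Z. R * \<partial>\<^sub>R u R \<phi> Z) R \<phi> Z"
    by (rule partial_mult(1)) (use U assms 1 in \<open>auto intro: sm_mult sm_R sm_partial_12\<close>)
  have Rw: "\<partial>\<^sub>R (\<lambda>R \<phi> Z. R * \<partial>\<^sub>R u R \<phi> Z) R \<phi> Z = R * w R \<phi> Z - R * \<partial>\<^sub>Z (\<partial>\<^sub>Z u) R \<phi> Z"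
    using w[OF x] R by (simp add: lap_pol_def field_simps)
  show "((u R \<phi> Z * \<partial>\<^sub>R (\<lambda>R \<phi> Z. R * \<partial>\<^sub>R w R \<phi> Z) R \<phi> Z + \<partial>\<^sub>R u R \<phi> Z * (R * \<partial>\<^sub>R w R \<phi> Z))
      + R ^ 1 * (u R \<phi> Z * \<partial>\<^sub>Z (\<partial>\<^sub>Z w) R \<phi> Z + \<partial>\<^sub>Z u R \<phi> Z * \<partial>\<^sub>Z w R \<phi> Z))
      - (\<partial>\<^sub>R (\<lambda>R \<phi> Z. (R * \<partial>\<^sub>R u R \<phi> Z) * w R \<phi> Z) R \<phi> Z
      + R ^ 1 * (\<partial>\<^sub>Z u R \<phi> Z * \<partial>\<^sub>Z w R \<phi> Z + \<partial>\<^sub>Z (\<partial>\<^sub>Z u) R \<phi> Z * w R \<phi> Z))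
      = R * (u R \<phi> Z * lap_pol w R \<phi> Z) - R * (w R \<phi> Z)\<^sup>2"
    unfolding prod Rw lap_pol_def[of w] using R by (simp add: field_simps power2_eq_square)
qed

text \<open>With g = \<open>\<partial>\<^sub>\<phi> \<psi> / R\<^sup>2\<close> and k its
  \<phi>-derivative, j k / R is traded for - \<nabla>\<psi> \<bullet> \<nabla>k / R by
  \<open>null_magnetic\<close>; the \<phi>-derivative is then moved from \<nabla>g to \<nabla>\<psi>
  by periodicity, and \<open>\<partial>\<^sub>\<phi> \<psi>\<close> is R^2 g. The leftover
  R-derivative of g^2 integrates to zero since g vanishes on the frontier.\<close>

lemma null_resistive:
  assumes \<psi>: "sm 3 \<psi>" and per: "per \<psi>" and v: "vanish (\<partial>\<^sub>\<phi> \<psi>)" "vanish (\<partial>\<^sub>\<phi> (\<partial>\<^sub>\<phi> \<psi>))"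
    and j: "\<And>R \<phi> Z. (R, \<phi>, Z) \<in> cyl D \<Longrightarrow> j R \<phi> Z = lap_star \<psi> R \<phi> Z"
  shows "null (\<lambda>R \<phi> Z. j R \<phi> Z * \<partial>\<^sub>\<phi> (\<partial>\<^sub>\<phi> \<psi>) R \<phi> Z / R ^ 3
    - R * (norm (grad_pol (\<lambda>R \<phi> Z. \<partial>\<^sub>\<phi> \<psi> R \<phi> Z / R\<^sup>2) R \<phi> Z))\<^sup>2)"
proof (rule null_cong)
  define g where "g = (\<lambda>R \<phi> Z. \<partial>\<^sub>\<phi> \<psi> R \<phi> Z / R\<^sup>2)"
  define k where "k = (\<lambda>R \<phi> Z. \<partial>\<^sub>\<phi> (\<partial>\<^sub>\<phi> \<psi>) R \<phi> Z / R\<^sup>2)"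
  have 2: "sm 2 \<psi>" using \<psi> by (auto intro: sm_lower)
  have g: "sm 2 g" unfolding g_def by (intro sm_intros \<psi>)
  have g1: "sm (Suc 0) g" using g by (auto intro: sm_lower)
  have k: "sm (Suc 0) k" unfolding k_def by (intro sm_intros \<psi>)
  have vg: "vanish g" "vanish k" using v by (auto simp: vanish_def g_def k_def)
  have pg: "per g" unfolding g_def by (intro per_divide per_partial per)
  let ?N = "\<lambda>R \<phi> Z. ((dot_pol \<psi> k R \<phi> Z / R + k R \<phi> Z * j R \<phi> Z / R)
      - ((\<partial>\<^sub>R \<psi> R \<phi> Z * \<partial>\<^sub>\<phi> (\<partial>\<^sub>R g) R \<phi> Z + \<partial>\<^sub>\<phi> (\<partial>\<^sub>R \<psi>) R \<phi> Z * \<partial>\<^sub>R g R \<phi> Z) / R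
       + (\<partial>\<^sub>Z \<psi> R \<phi> Z * \<partial>\<^sub>\<phi> (\<partial>\<^sub>Z g) R \<phi> Z + \<partial>\<^sub>\<phi> (\<partial>\<^sub>Z \<psi>) R \<phi> Z * \<partial>\<^sub>Z g R \<phi> Z) / R))
      + (g R \<phi> Z * \<partial>\<^sub>R g R \<phi> Z + \<partial>\<^sub>R g R \<phi> Z * g R \<phi> Z)"
  show "null ?N"
    by (intro null_add null_diff null_magnetic null_parts_R null_parts_phi sm_intros
        per_partial 2 g g1 k vg j per pg)
  fix R \<phi> Z assume x: "(R, \<phi>, Z) \<in> cyl D"
  have U: "(R, Z) \<in> U" by (rule cyl_U[OF x])
  have R: "R \<noteq> 0" using R_pos[OF U] by simp
  \<comment> \<open>This identity and \<open>gk\<close> are needed on all of \<open>U\<close> and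
    not only at the point at hand, because they are differentiated next.\<close>
  have \<psi>\<phi>: "\<partial>\<^sub>\<phi> \<psi> R \<phi> Z = R\<^sup>2 * g R \<phi> Z" if "(R, Z) \<in> U" for R \<phi> Z
    using R_pos[OF that] by (simp add: g_def)
  have gk: "\<partial>\<^sub>\<phi> g R \<phi> Z = k R \<phi> Z" if "(R, Z) \<in> U" for R \<phi> Z
    using that \<psi> 2 by (simp add: g_def k_def partial_divide_R_power sm_intros)
  have c: "\<partial>\<^sub>\<phi> (\<partial>\<^sub>R g) R \<phi> Z = \<partial>\<^sub>R k R \<phi> Z" "\<partial>\<^sub>\<phi> (\<partial>\<^sub>Z g) R \<phi> Z = \<partial>\<^sub>Z k R \<phi> Z"
    using sm_commute(2,3)[OF g U] partial_cong(1,3)[of "\<partial>\<^sub>\<phi> g" k, OF gk U] by simp_all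
  have d: "\<partial>\<^sub>\<phi> (\<partial>\<^sub>R \<psi>) R \<phi> Z = R\<^sup>2 * \<partial>\<^sub>R g R \<phi> Z + g R \<phi> Z * (2 * R)" "\<partial>\<^sub>\<phi> (\<partial>\<^sub>Z \<psi>) R \<phi> Z = R\<^sup>2 * \<partial>\<^sub>Z g R \<phi> Z"
    using sm_commute(2,3)[OF 2 U] partial_cong(1,3)[of "\<partial>\<^sub>\<phi> \<psi>" "\<lambda>R \<phi> Z. R\<^sup>2 * g R \<phi> Z", OF \<psi>\<phi> U]
      U g1 by (simp_all add: partial_mult partial_coord_power sm_intros)
  have kk: "\<partial>\<^sub>\<phi> (\<partial>\<^sub>\<phi> \<psi>) R \<phi> Z = R\<^sup>2 * k R \<phi> Z" using R by (simp add: k_def)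
  show "?N R \<phi> Z = j R \<phi> Z * \<partial>\<^sub>\<phi> (\<partial>\<^sub>\<phi> \<psi>) R \<phi> Z / R ^ 3
    - R * (norm (grad_pol (\<lambda>R \<phi> Z. \<partial>\<^sub>\<phi> \<psi> R \<phi> Z / R\<^sup>2) R \<phi> Z))\<^sup>2"
    unfolding g_def[symmetric] c d kk norm_grad_pol dot_pol_def using R
    by (simp add: field_simps power2_eq_square power3_eq_cube)
qed

end

section \<open>Local energy balance\<close>

text \<open>
  The variables are values at a point; \<open>b\<close> followed by letters is a bracket, with \<open>p\<close> for \<open>\<psi>\<close>, \<open>r\<close>
      for \<open>\<rho>\<close>, \<open>h\<close>
  for \<open>R\<^sup>2 \<rho>\<close>, \<open>k\<close> for \<open>\<nabla>\<psi> \<bullet> \<nabla>u\<close>, and with \<open>B\<close> for the poloidal part of \<open>|\<^bold>B|\<^sup>2 / 2\<close>. In the pressure terms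
  \<open>bpu\<close> and \<open>bpp\<close> are \<open>[p, u]\<close> and \<open>[p, \<psi>]\<close>.
\<close>

lemma magnetic_terms:
  fixes R :: real
  assumes "R \<noteq> 0" "bpj = - bjp" "bpu = - bup"
    and "1 / R\<^sup>2 * \<psi>t = 1 / R * bpu + \<eta> / R\<^sup>2 * (j + \<psi>pp / R\<^sup>2) - F0 / R\<^sup>2 * uphi"
  shows "- (\<psi>t * j / R) - u * bpj + F0 / R * (u * jphi)
    = (u * bjp + j * bup) + F0 * ((u * jphi + uphi * j) / R) - \<eta> * (R * (j\<^sup>2 / R\<^sup>2)) - \<eta> * (j * \<psi>pp / R ^ 3)"
proof -
  have \<psi>t: "\<psi>t = R\<^sup>2 * (1 / R * bpu + \<eta> / R\<^sup>2 * (j + \<psi>pp / R\<^sup>2) - F0 / R\<^sup>2 * uphi)"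
    unfolding assms(4)[symmetric] using assms(1) by simp
  show ?thesis unfolding \<psi>t assms(2,3) using assms(1)
      by (simp add: field_simps power2_eq_square power3_eq_cube)
qed

text \<open>The constants come from \<gamma> = 5/3: 3/2 is 1 / (\<gamma> - 1) and 5/2 is \<gamma> /
  (\<gamma> - 1) = 1 + 1 / (\<gamma> - 1). The pressure work along the field from the momentum
  equation thus completes the advection of \<open>p\<close> to the coefficient of the compression
  term. Likewise 5 R p \<open>uZ\<close> splits into 3 R p \<open>uZ\<close> for the bracket of R^2
  p and 2 R p \<open>uZ\<close> to pair with \<open>pZ\<close>.\<close>

lemma pressure_terms:
  fixes R :: real
  assumes "R \<noteq> 0"
    and "pt = R * bpu + 2 * gam * p * uZ - v * F0 / R\<^sup>2 * pphi - v / R * bpp - gam * p / R * bvp - gam * p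
        * F0 / R\<^sup>2 * vphi"
  shows "u * (2 * R * pZ) - v * bpp - F0 / R * v * pphi + R * (1 / (gam - 1) * pt)
    = - 5 / 2 * (p * bvp + v * bpp) - 5 / 2 * F0 * ((p * vphi + pphi * v) / R)
      + 3 / 2 * (2 * R * p * uZ + R\<^sup>2 * bpu) + 2 * (R ^ 1 * (p * uZ + pZ * u))"
  unfolding assms(2) gam_def using assms(1) by (simp add: field_simps power2_eq_square)

text \<open>
  Here \<open>c1\<close>, \<open>c2\<close> and \<open>d4\<close>, \<open>d3\<close> are the \<open>R\<close>- and \<open>Z\<close>-derivatives of \<open>\<partial>\<^sub>\<phi> u\<close> and of \<open>\<partial>\<^sub>\<phi> \<psi>\<close>. The brackets such
  as \<open>bh1r\<close> stay opaque: the fields \<open>h\<^sub>i\<close> in them are those of the local energy balance below.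
\<close>

lemma density_terms:
  fixes R :: real
  assumes "R \<noteq> 0"
    and \<rho>t: "\<rho>t = R * bru + 2 * \<rho> * uZ - v * F0 / R\<^sup>2 * rphi - v / R * brp - \<rho> / R * bvp - \<rho> * F0 / R\<^sup>2
        * vphi"
    and rh: "rh = R\<^sup>2 * \<rho>" and bhu: "bhu = R\<^sup>2 * bru + 2 * R * \<rho> * uZ"
    and U: "U2 = uR\<^sup>2 + uZ\<^sup>2" and P: "P2 = \<psi>R\<^sup>2 + \<psi>Z\<^sup>2" and k: "k = \<psi>R * uR + \<psi>Z * uZ" and S: "S = vR * \<psi>R
        + vZ * \<psi>Z"
    and bup: "bup = uR * \<psi>Z - uZ * \<psi>R" and bvp: "bvp = vR * \<psi>Z - vZ * \<psi>R" and buv: "buv = uR * vZ - uZ * vR"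
    and jets: "h1phi = R\<^sup>2 * (2 * (uR * c1 + uZ * c2))" "kphi = A1 + A2" "A1 = uR * d4 + uZ * d3" "c3 = v
        * d3 + \<psi>Z * vphi" "c4 = v * d4 + \<psi>R * vphi"
  shows "R * (\<rho>t * ((R\<^sup>2 * U2 - 2 * v * k + v\<^sup>2 * ((F0\<^sup>2 + P2) / R\<^sup>2)) / 2))
     - (1 / 2 * u * bh1r + u * bh2u + u * bh7p + u * bh8p - (u * D5 + R * u * D6) + u * - bh10r - 1 / 2 * u
         * - bh11r
        - u * bh12p + u * - bh13u + u * - bh14u + u * m15 + u * m16 - u * m17)
     + v * R * (\<rho> / R * - bh3p - F0 / R * \<rho> * (1 / R * h3phi) - 1 / (2 * R) * \<rho> * bh1p
        - rh / R * w * - bup - R * \<rho> * ((F0\<^sup>2 + P2) / R\<^sup>2) * buv - R * \<rho> * v * (buB + F0\<^sup>2 / R ^ 3 * uZ)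
        + R * \<rho> * v * buB - \<rho> * v * (j / R) * bup - \<rho> * v / R * - bkp + \<rho> * v * F0 / R\<^sup>2 * A2
        + \<rho> * v * (F0\<^sup>2 / R\<^sup>2) * uZ)
   = - 1 / 2 * (u * bh1r + R\<^sup>2 * U2 * - bhu) - (u * bh2u + rh * R\<^sup>2 * w * 0) - (u * bh7p + \<rho> * v\<^sup>2 * j * bup)
     - (u * bh8p + \<rho> * v * S * bup) + (u * D5 + uR * (R * (rh * (F0 / R\<^sup>2) * v * c1))) + R ^ 1 * (u * D6
         + uZ * (rh * (F0 / R\<^sup>2) * v * c2))
     + (u * bh10r + v * k * - bhu) - 1 / 2 * (u * bh11r + v\<^sup>2 * (P2 / R\<^sup>2) * - bhu) + (u * bh12p + rh * v
         * w * bup)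
     + (u * bh13u + rh * v * j * 0) + (u * bh14u + rh * S * 0) - R ^ 0 * (u * m15 + uZ * (rh * (F0 / R ^ 3)
         * v * c3))
     - (u * m16 + uR * (rh * (F0 / R ^ 3) * v * c4)) + R ^ 0 * (u * m17 + uZ * (rh * (F0\<^sup>2 / R ^ 3) * v\<^sup>2))
     - (1 / 2 * (\<rho> * v * bh1p + R\<^sup>2 * U2 * (v * brp + \<rho> * bvp)) - (\<rho> * v * (v * bkp + k * bvp) + v * k * (v
         * brp + \<rho> * bvp))
        + (\<rho> * v * bh3p + v\<^sup>2 * ((F0\<^sup>2 + P2) / R\<^sup>2) / 2 * (v * brp + \<rho> * bvp)))
     - F0 * (1 / 2 * ((\<rho> * v * h1phi + (\<rho> * vphi + v * rphi) * (R\<^sup>2 * U2)) / R)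
        - (\<rho> * v * (v * kphi + k * vphi) + (\<rho> * vphi + v * rphi) * (v * k)) / R
        + (\<rho> * v * h3phi + (\<rho> * vphi + v * rphi) * (v\<^sup>2 * ((F0\<^sup>2 + P2) / R\<^sup>2) / 2)) / R)
     + 1 / 2 * (rh * (F0\<^sup>2 / R\<^sup>2 * (2 * v * - buv) - v\<^sup>2 * (2 * F0\<^sup>2 / R ^ 3) * uZ) + v\<^sup>2 * (F0\<^sup>2 / R\<^sup>2)
         * bhu)"
  \<comment> \<open>What remains is a rational identity. The vorticity and momentum equations
    contain only parts of the \<phi>-derivatives of |\<nabla>u|^2 and \<nabla>\<psi> \<bullet>
    \<nabla>u, so \<open>jets\<close> supplies these expanded by the product rule. The zero factors
    stand for the bracket [u, u].\<close>
  unfolding jets \<rho>t rh bhu U P k S bup bvp buv using assms(1)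
  by (simp add: field_simps power2_eq_square power3_eq_cube)

lemma dot_pol_commute: "dot_pol f g R \<phi> Z = dot_pol g f R \<phi> Z"
  by (simp add: dot_pol_def)

section \<open>The time derivative of the energy density\<close>

context evolution_region
begin

lemma ev_partial_12: "ev 2 f \<Longrightarrow> ev (Suc 0) (\<partial>\<^sub>t f)" "ev 2 f \<Longrightarrow> ev (Suc 0) (\<lambda>t. \<partial>\<^sub>R (f t))"
    "ev 2 f \<Longrightarrow> ev (Suc 0) (\<lambda>t. \<partial>\<^sub>Z (f t))"
  and ev_partial_23: "ev 3 f \<Longrightarrow> ev 2 (\<partial>\<^sub>t f)" "ev 3 f \<Longrightarrow> ev 2 (\<lambda>t. \<partial>\<^sub>R (f t))"
    "ev 3 f \<Longrightarrow> ev 2 (\<lambda>t. \<partial>\<^sub>Z (f t))"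
  using ev_partial[of "Suc 0" f] ev_partial[of 2 f] by (auto simp: numeral_3_eq_3 numeral_2_eq_2)

lemma partial_t_eqI:
  "((\<lambda>s. f s R \<phi> Z) has_real_derivative d) (at t) \<Longrightarrow> \<partial>\<^sub>t f t R \<phi> Z = d"
  by (simp add: partial_t_def has_real_derivative_iff_has_vector_derivative vector_derivative_at)

lemma partial_t_mult:
  assumes "ev (Suc 0) f" "ev (Suc 0) g" "t \<in> J" "(R, Z) \<in> U"
  shows "\<partial>\<^sub>t (\<lambda>t R \<phi> Z. f t R \<phi> Z * g t R \<phi> Z) t R \<phi> Z
    = f t R \<phi> Z * \<partial>\<^sub>t g t R \<phi> Z + g t R \<phi> Z * \<partial>\<^sub>t f t R \<phi> Z"
proof (rule partial_t_eqI)
  show "((\<lambda>s. f s R \<phi> Z * g s R \<phi> Z) has_real_derivative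
      f t R \<phi> Z * \<partial>\<^sub>t g t R \<phi> Z + g t R \<phi> Z * \<partial>\<^sub>t f t R \<phi> Z) (at t)"
    using DERIV_mult[OF ev_deriv[OF assms(1,3,4)] ev_deriv[OF assms(2,3,4)], of \<phi> \<phi>]
    by (simp add: algebra_simps)
qed

text \<open>The equation differentiates a vector field in time. Writing it as a combination of two
  constant vectors with scalar coefficients reduces this to the scalar time derivatives.\<close>

lemma partial_t_grad_pol:
  assumes v: "ev 1 v" and f: "ev 2 f" and x: "t \<in> J" "(R, Z) \<in> U"
  shows "\<partial>\<^sub>t (\<lambda>t R \<phi> Z. v t R \<phi> Z *\<^sub>R grad_pol (f t) R \<phi> Z) t R \<phi> Z
    = vector [\<partial>\<^sub>t (\<lambda>t R \<phi> Z. v t R \<phi> Z * \<partial>\<^sub>R (f t) R \<phi> Z) t R \<phi> Z, 0,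
        \<partial>\<^sub>t (\<lambda>t R \<phi> Z. v t R \<phi> Z * \<partial>\<^sub>Z (f t) R \<phi> Z) t R \<phi> Z]"
proof -
  let ?a = "\<lambda>t R \<phi> Z. v t R \<phi> Z * \<partial>\<^sub>R (f t) R \<phi> Z" and ?b = "\<lambda>t R \<phi> Z. v t R \<phi> Z * \<partial>\<^sub>Z (f t) R \<phi> Z"
  let ?e = "vector [1, 0, 0] :: real ^ 3" and ?e' = "vector [0, 0, 1] :: real ^ 3"
  have v1: "ev (Suc 0) v" using v by simp
  have d: "((\<lambda>s. ?a s R \<phi> Z) has_real_derivative \<partial>\<^sub>t ?a t R \<phi> Z) (at t)"
    "((\<lambda>s. ?b s R \<phi> Z) has_real_derivative \<partial>\<^sub>t ?b t R \<phi> Z) (at t)"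
    by (rule ev_deriv[of 0, OF ev_mult[OF v1 ev_partial_12(2)[OF f]] x] ev_deriv[of 0, OF ev_mult[OF v1
        ev_partial_12(3)[OF f]] x])+
  have "((\<lambda>s. ?a s R \<phi> Z *\<^sub>R ?e + ?b s R \<phi> Z *\<^sub>R ?e') has_vector_derivative
      \<partial>\<^sub>t ?a t R \<phi> Z *\<^sub>R ?e + \<partial>\<^sub>t ?b t R \<phi> Z *\<^sub>R ?e') (at t)"
    using d unfolding has_real_derivative_iff_has_vector_derivative
    by (intro has_vector_derivative_add bounded_linear.has_vector_derivative[OF bounded_linear_scaleR_left])
  moreover have "(\<lambda>s. v s R \<phi> Z *\<^sub>R grad_pol (f s) R \<phi> Z) = (\<lambda>s. ?a s R \<phi> Z *\<^sub>R ?e + ?b s R \<phi> Z *\<^sub>R ?e')"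
    by (simp add: fun_eq_iff grad_pol_def vec_eq_iff forall_3)
  ultimately have "\<partial>\<^sub>t (\<lambda>t R \<phi> Z. v t R \<phi> Z *\<^sub>R grad_pol (f t) R \<phi> Z) t R \<phi> Z
      = \<partial>\<^sub>t ?a t R \<phi> Z *\<^sub>R ?e + \<partial>\<^sub>t ?b t R \<phi> Z *\<^sub>R ?e'"
    by (simp add: partial_t_def[where 'a="real^3"] vector_derivative_at)
  then show ?thesis by (simp add: vec_eq_iff forall_3)
qed

lemma divg_partial_t_grad_pol:
  assumes v: "ev 1 v" and f: "ev 2 f" and x: "t \<in> J" "(R, Z) \<in> U"
  shows "divg (\<lambda>R \<phi> Z. \<rho> R \<phi> Z *\<^sub>R \<partial>\<^sub>t (\<lambda>t R \<phi> Z. v t R \<phi> Z *\<^sub>R grad_pol (f t) R \<phi> Z) t R \<phi> Z) R \<phi> Z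
    = (1 / R) * \<partial>\<^sub>R (\<lambda>R \<phi> Z. R * (\<rho> R \<phi> Z * \<partial>\<^sub>t (\<lambda>t R \<phi> Z. v t R \<phi> Z * \<partial>\<^sub>R (f t) R \<phi> Z) t R \<phi> Z)) R \<phi> Z
    + \<partial>\<^sub>Z (\<lambda>R \<phi> Z. \<rho> R \<phi> Z * \<partial>\<^sub>t (\<lambda>t R \<phi> Z. v t R \<phi> Z * \<partial>\<^sub>Z (f t) R \<phi> Z) t R \<phi> Z) R \<phi> Z"
    (is "divg ?F R \<phi> Z = (1 / R) * \<partial>\<^sub>R ?A R \<phi> Z + \<partial>\<^sub>Z ?B R \<phi> Z")
proof -
  have "\<partial>\<^sub>R (\<lambda>R \<phi> Z. R * ?F R \<phi> Z $ 1) R \<phi> Z = \<partial>\<^sub>R ?A R \<phi> Z"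
    by (rule partial_cong(1)) (use partial_t_grad_pol[OF v f x(1)] x in auto)
  moreover have "\<partial>\<^sub>\<phi> (\<lambda>R \<phi> Z. ?F R \<phi> Z $ 2) R \<phi> Z = \<partial>\<^sub>\<phi> (\<lambda>R \<phi> Z. 0) R \<phi> Z"
    by (rule partial_cong(2)) (use partial_t_grad_pol[OF v f x(1)] x in auto)
  moreover have "\<partial>\<^sub>Z (\<lambda>R \<phi> Z. ?F R \<phi> Z $ 3) R \<phi> Z = \<partial>\<^sub>Z ?B R \<phi> Z"
    by (rule partial_cong(3)) (use partial_t_grad_pol[OF v f x(1)] x in auto)
  ultimately show ?thesis by (simp add: divg_def partial_const)
qed

lemma energy_density_eq:
  assumes "R > 0"
  shows "R * energy_density F0 \<psi> u \<rho> p v R \<phi> Z = R * ((F0\<^sup>2 + dot_pol \<psi> \<psi> R \<phi> Z) / R\<^sup>2 / 2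
    + \<rho> R \<phi> Z * ((R\<^sup>2 * dot_pol u u R \<phi> Z - 2 * v R \<phi> Z * dot_pol \<psi> u R \<phi> Z
      + (v R \<phi> Z)\<^sup>2 * ((F0\<^sup>2 + dot_pol \<psi> \<psi> R \<phi> Z) / R\<^sup>2)) / 2)
    + 1 / (gam - 1) * p R \<phi> Z)"
  using assms by (simp add: energy_density_def norm_B_field norm_velocity)

lemma ev_cong:
  assumes "ev k f" "\<And>t R \<phi> Z. t \<in> J \<Longrightarrow> (R, Z) \<in> U \<Longrightarrow> f t R \<phi> Z = g t R \<phi> Z"
  shows "ev k g"
proof -
  have "C_k_on k \<W> (uncurry4 f)" using assms(1) by (simp add: smooth_evolution_def)
  from C_k_on_cong[OF open_\<W> _ this, of "uncurry4 g"] show ?thesis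
    using assms(2) by (auto simp: smooth_evolution_def)
qed

lemma ev_energy:
  assumes "ev 3 \<psi>" "ev 3 u" "ev 3 \<rho>" "ev 3 p" "ev 3 v"
  shows "ev 1 (\<lambda>t R \<phi> Z. R * energy_density F0 (\<psi> t) (u t) (\<rho> t) (p t) (v t) R \<phi> Z)"
proof (rule ev_cong)
  have 2: "ev 2 \<psi>" "ev 2 u" and 1: "ev (Suc 0) \<rho>" "ev (Suc 0) p" "ev (Suc 0) v"
    using assms by (auto intro: ev_lower)
  have dp: "ev (Suc 0) (\<lambda>t. dot_pol (f t) (g t))" if "ev 2 f" "ev 2 g" for f g
    unfolding dot_pol_def[abs_def] by (intro ev_add ev_mult ev_partial_12 that)
  have "ev (Suc 0) (\<lambda>t R \<phi> Z. R * ((F0\<^sup>2 + dot_pol (\<psi> t) (\<psi> t) R \<phi> Z) * inverse R ^ 2 / 2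
    + \<rho> t R \<phi> Z * ((R\<^sup>2 * dot_pol (u t) (u t) R \<phi> Z - 2 * v t R \<phi> Z * dot_pol (\<psi> t) (u t) R \<phi> Z
      + (v t R \<phi> Z)\<^sup>2 * ((F0\<^sup>2 + dot_pol (\<psi> t) (\<psi> t) R \<phi> Z) * inverse R ^ 2)) / 2)
    + 1 / (gam - 1) * p t R \<phi> Z))"
    by (intro ev_mult ev_add ev_diff ev_divide_const ev_power ev_inverse_R ev_R ev_const dp 1 2)
  then show "ev 1 (\<lambda>t R \<phi> Z. R * ((F0\<^sup>2 + dot_pol (\<psi> t) (\<psi> t) R \<phi> Z) * inverse R ^ 2 / 2
    + \<rho> t R \<phi> Z * ((R\<^sup>2 * dot_pol (u t) (u t) R \<phi> Z - 2 * v t R \<phi> Z * dot_pol (\<psi> t) (u t) R \<phi> Z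
      + (v t R \<phi> Z)\<^sup>2 * ((F0\<^sup>2 + dot_pol (\<psi> t) (\<psi> t) R \<phi> Z) * inverse R ^ 2)) / 2)
    + 1 / (gam - 1) * p t R \<phi> Z))" by simp
next
  fix t R \<phi> Z assume "(R, Z) \<in> U"
  from energy_density_eq[OF R_pos[OF this]]
  show "R * ((F0\<^sup>2 + dot_pol (\<psi> t) (\<psi> t) R \<phi> Z) * inverse R ^ 2 / 2
    + \<rho> t R \<phi> Z * ((R\<^sup>2 * dot_pol (u t) (u t) R \<phi> Z - 2 * v t R \<phi> Z * dot_pol (\<psi> t) (u t) R \<phi> Z
      + (v t R \<phi> Z)\<^sup>2 * ((F0\<^sup>2 + dot_pol (\<psi> t) (\<psi> t) R \<phi> Z) * inverse R ^ 2)) / 2)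
    + 1 / (gam - 1) * p t R \<phi> Z) = R * energy_density F0 (\<psi> t) (u t) (\<rho> t) (p t) (v t) R \<phi> Z"
    by (simp only: divide_inverse power_inverse)
qed

text \<open>The summands are grouped to fit the left-hand sides. The third is what the two
  divergences of the vorticity equation leave after testing with - R u and integrating by parts, the
  fourth is \<open>v R\<close> times the left side of the parallel momentum equation; the others
  await the flux, density and pressure equations.\<close>

lemma partial_t_energy:
  assumes "ev 3 \<psi>" "ev 3 u" "ev 3 \<rho>" "ev 3 p" "ev 3 v" and x: "t \<in> J" "(R, Z) \<in> U"
  shows "\<partial>\<^sub>t (\<lambda>t R \<phi> Z. R * energy_density F0 (\<psi> t) (u t) (\<rho> t) (p t) (v t) R \<phi> Z) t R \<phi> Z
    = dot_pol (\<psi> t) (\<partial>\<^sub>t \<psi> t) R \<phi> Z / R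
      + R * (\<partial>\<^sub>t \<rho> t R \<phi> Z * ((R\<^sup>2 * dot_pol (u t) (u t) R \<phi> Z - 2 * v t R \<phi> Z * dot_pol (\<psi> t) (u t) R \<phi> Z
        + (v t R \<phi> Z)\<^sup>2 * ((F0\<^sup>2 + dot_pol (\<psi> t) (\<psi> t) R \<phi> Z) / R\<^sup>2)) / 2))
      + R * \<rho> t R \<phi> Z * (R\<^sup>2 * dot_pol (u t) (\<partial>\<^sub>t u t) R \<phi> Z
          - (\<partial>\<^sub>t (\<lambda>t R \<phi> Z. v t R \<phi> Z * \<partial>\<^sub>R (\<psi> t) R \<phi> Z) t R \<phi> Z * \<partial>\<^sub>R (u t) R \<phi> Z
           + \<partial>\<^sub>t (\<lambda>t R \<phi> Z. v t R \<phi> Z * \<partial>\<^sub>Z (\<psi> t) R \<phi> Z) t R \<phi> Z * \<partial>\<^sub>Z (u t) R \<phi> Z))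
      + v t R \<phi> Z * R * (\<rho> t R \<phi> Z * ((F0\<^sup>2 + dot_pol (\<psi> t) (\<psi> t) R \<phi> Z) / R\<^sup>2) * \<partial>\<^sub>t v t R \<phi> Z
          + \<rho> t R \<phi> Z * v t R \<phi> Z * (1 / R\<^sup>2) * dot_pol (\<psi> t) (\<partial>\<^sub>t \<psi> t) R \<phi> Z
          - \<rho> t R \<phi> Z * dot_pol (\<psi> t) (\<partial>\<^sub>t u t) R \<phi> Z)
      + R * (1 / (gam - 1) * \<partial>\<^sub>t p t R \<phi> Z)"
proof (rule partial_t_eqI)
  have R: "R > 0" by (rule R_pos[OF x(2)])
  have 2: "ev 2 \<psi>" "ev 2 u" and 1: "ev (Suc 0) \<rho>" "ev (Suc 0) p" "ev (Suc 0) v"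
    using assms by (auto intro: ev_lower)
  note d = ev_deriv[OF 1(1) x, of \<phi>] ev_deriv[OF 1(2) x, of \<phi>] ev_deriv[OF 1(3) x, of \<phi>]
  have dot: "((\<lambda>s. dot_pol (f s) (g s) R \<phi> Z) has_real_derivative
      dot_pol (\<partial>\<^sub>t f t) (g t) R \<phi> Z + dot_pol (f t) (\<partial>\<^sub>t g t) R \<phi> Z) (at t)" if "ev 2 f" "ev 2 g" for f g
  proof -
    note e = ev_deriv[OF ev_partial_12(2)[OF that(1)] x, of \<phi>] ev_deriv[OF
        ev_partial_12(3)[OF that(1)] x, of \<phi>]
      ev_deriv[OF ev_partial_12(2)[OF that(2)] x, of \<phi>] ev_deriv[OF ev_partial_12(3)[OF that(2)] x, of \<phi>]
    from DERIV_add[OF DERIV_mult[OF e(1,3)] DERIV_mult[OF e(2,4)]] show ?thesis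
      by (simp add: dot_pol_def ev_commute[OF that(1) x] ev_commute[OF that(2) x] algebra_simps)
  qed
  define c where "c = 1 / (gam - 1)"
  note pm = partial_t_mult[OF 1(3) ev_partial_12(2)[OF 2(1)] x, unfolded ev_commute[OF 2(1) x]]
     partial_t_mult[OF 1(3) ev_partial_12(3)[OF 2(1)] x, unfolded ev_commute[OF 2(1) x]]
  have rate: "\<partial>\<^sub>t (\<lambda>t R \<phi> Z. v t R \<phi> Z * \<partial>\<^sub>R (\<psi> t) R \<phi> Z) t R \<phi> Z * \<partial>\<^sub>R (u t) R \<phi> Z
      + \<partial>\<^sub>t (\<lambda>t R \<phi> Z. v t R \<phi> Z * \<partial>\<^sub>Z (\<psi> t) R \<phi> Z) t R \<phi> Z * \<partial>\<^sub>Z (u t) R \<phi> Z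
    = v t R \<phi> Z * dot_pol (\<partial>\<^sub>t \<psi> t) (u t) R \<phi> Z + \<partial>\<^sub>t v t R \<phi> Z * dot_pol (\<psi> t) (u t) R \<phi> Z"
    unfolding pm dot_pol_def by (simp add: algebra_simps)
  show "((\<lambda>s. R * energy_density F0 (\<psi> s) (u s) (\<rho> s) (p s) (v s) R \<phi> Z) has_real_derivative
      dot_pol (\<psi> t) (\<partial>\<^sub>t \<psi> t) R \<phi> Z / R
      + R * (\<partial>\<^sub>t \<rho> t R \<phi> Z * ((R\<^sup>2 * dot_pol (u t) (u t) R \<phi> Z - 2 * v t R \<phi> Z * dot_pol (\<psi> t) (u t) R \<phi> Z
        + (v t R \<phi> Z)\<^sup>2 * ((F0\<^sup>2 + dot_pol (\<psi> t) (\<psi> t) R \<phi> Z) / R\<^sup>2)) / 2))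
      + R * \<rho> t R \<phi> Z * (R\<^sup>2 * dot_pol (u t) (\<partial>\<^sub>t u t) R \<phi> Z
          - (\<partial>\<^sub>t (\<lambda>t R \<phi> Z. v t R \<phi> Z * \<partial>\<^sub>R (\<psi> t) R \<phi> Z) t R \<phi> Z * \<partial>\<^sub>R (u t) R \<phi> Z
           + \<partial>\<^sub>t (\<lambda>t R \<phi> Z. v t R \<phi> Z * \<partial>\<^sub>Z (\<psi> t) R \<phi> Z) t R \<phi> Z * \<partial>\<^sub>Z (u t) R \<phi> Z))
      + v t R \<phi> Z * R * (\<rho> t R \<phi> Z * ((F0\<^sup>2 + dot_pol (\<psi> t) (\<psi> t) R \<phi> Z) / R\<^sup>2) * \<partial>\<^sub>t v t R \<phi> Z
          + \<rho> t R \<phi> Z * v t R \<phi> Z * (1 / R\<^sup>2) * dot_pol (\<psi> t) (\<partial>\<^sub>t \<psi> t) R \<phi> Z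
          - \<rho> t R \<phi> Z * dot_pol (\<psi> t) (\<partial>\<^sub>t u t) R \<phi> Z)
      + R * (1 / (gam - 1) * \<partial>\<^sub>t p t R \<phi> Z)) (at t)"
    unfolding energy_density_eq[OF R] rate c_def[symmetric]
    using R by (auto intro!: d dot[OF 2(1) 2(1)] dot[OF 2(1) 2(2)] dot[OF 2(2) 2(2)] derivative_eq_intros)
      (simp add: field_simps power2_eq_square power4_eq_xxxx dot_pol_commute[of "\<partial>\<^sub>t \<psi> t"
          "\<psi> t"] dot_pol_commute[of "\<partial>\<^sub>t u t" "u t"])
qed

end

text \<open>Multiplication by R u removes the weights 1 / R. Brackets whose factor to be relieved of
  derivatives stands second are entered with reversed arguments, which explains the signs at
  \<open>b10\<close>, \<open>b11\<close>, \<open>b13\<close> and \<open>b14\<close>.\<close>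

lemma vorticity_terms:
  fixes R :: real
  assumes "R \<noteq> 0"
    and "(1 / R * d1 + d2) - (1 / R * d3 + d4)
      = 1 / (2 * R) * b1 + 1 / R * b2 - 1 / R * b3 + 1 / R * b4 - F0 / R\<^sup>2 * jphi + \<nu> * lw + 1 / R * b7
          + 1 / R * b8
        - (1 / R * d5 + d6) + 1 / R * - b10 - 1 / (2 * R) * - b11 - 1 / R * b12 + 1 / R * - b13 + 1 / R *
            - b14
        + 1 / R * m15 + 1 / R * m16 - 1 / R * m17"
  shows "u * d1 + R * u * d2 - (u * d3 + R * u * d4)
    = (1 / 2 * u * b1 + u * b2 + u * b7 + u * b8 - (u * d5 + R * u * d6) + u * - b10 - 1 / 2 * u * - b11 - u
        * b12
        + u * - b13 + u * - b14 + u * m15 + u * m16 - u * m17)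
      + \<nu> * (R * (u * lw)) - u * b3 + u * b4 - F0 / R * (u * jphi)"
proof -
  have "u * d1 + R * u * d2 - (u * d3 + R * u * d4) = R * u * ((1 / R * d1 + d2) - (1 / R * d3 + d4))"
    using assms(1) by (simp add: field_simps)
  also note assms(2)
  finally show ?thesis using assms(1)
    by (simp add: distrib_left right_diff_distrib power2_eq_square)
qed

context poloidal_domain
begin

text \<open>Rate and dissipation are put into one field, so that the claim reduces through
  \<open>null_cong\<close> to a pointwise identity on \<open>cyl D\<close>, exactly where the
  equations are available. The boundary conditions enter only as \<open>vanish\<close>.\<close>

lemma null_energy_balance:
  assumes t: "t \<in> J"
    and ev: "ev 3 \<psi>" "ev 3 u" "ev 3 w" "ev 3 j" "ev 3 \<rho>" "ev 3 p" "ev 3 v"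
    and per: "per (\<psi> t)" "per (u t)" "per (w t)" "per (j t)" "per (\<rho> t)" "per (p t)" "per (v t)"
    and van: "vanish (u t)" "vanish (\<partial>\<^sub>R (u t))" "vanish (\<partial>\<^sub>Z (u t))" "vanish (\<rho> t)" "vanish (p t)"
      "vanish (\<partial>\<^sub>t \<psi> t)" "vanish (\<partial>\<^sub>\<phi> (\<psi> t))" "vanish (\<partial>\<^sub>\<phi> (\<partial>\<^sub>\<phi> (\<psi> t)))"
    and mhd: "\<And>R \<phi> Z. (R, \<phi>, Z) \<in> cyl D \<Longrightarrow> reduced_mhd \<eta> \<nu> F0 \<psi> u w j \<rho> p v t R \<phi> Z"
  shows "null (\<lambda>R \<phi> Z. \<partial>\<^sub>t (\<lambda>t R \<phi> Z. R * energy_density F0 (\<psi> t) (u t) (\<rho> t) (p t) (v t) R \<phi> Z) t R \<phi> Z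
      + (\<nu> * (R * (w t R \<phi> Z)\<^sup>2) + \<eta> * (R * ((j t R \<phi> Z)\<^sup>2 / R\<^sup>2)) + \<eta> * (R
      * (norm (grad_pol (\<lambda>R \<phi> Z. \<partial>\<^sub>\<phi> (\<psi> t) R \<phi> Z / R\<^sup>2) R \<phi> Z))\<^sup>2)))"
proof -
  have s3: "sm 3 (\<psi> t)" "sm 3 (u t)" "sm 3 (w t)" "sm 3 (j t)" "sm 3 (\<rho> t)" "sm 3 (p t)" "sm 3 (v t)"
    by (intro ev_slice[OF _ t] ev)+
  then have s2: "sm 2 (\<psi> t)" "sm 2 (u t)" "sm 2 (w t)" "sm 2 (j t)" "sm 2 (\<rho> t)" "sm 2 (p t)" "sm 2 (v t)"
    and s1: "sm (Suc 0) (\<psi> t)" "sm (Suc 0) (u t)" "sm (Suc 0) (w t)" "sm (Suc 0) (j t)" "sm (Suc 0) (\<rho> t)"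
      "sm (Suc 0) (p t)" "sm (Suc 0) (v t)"
    by (auto intro: sm_lower)
  have ev1: "ev 1 v" and ev2: "ev 2 \<psi>" using ev by (auto intro: ev_lower)
  have st2: "sm 2 (\<partial>\<^sub>t \<psi> t)" "sm 2 (\<partial>\<^sub>t u t)"
    by (intro ev_slice[OF _ t] ev_partial_23 ev)+
  have st: "sm (Suc 0) (\<partial>\<^sub>t \<psi> t)" "sm (Suc 0) (\<partial>\<^sub>R (\<partial>\<^sub>t u t))" "sm (Suc 0) (\<partial>\<^sub>Z (\<partial>\<^sub>t u t))"
    using st2 by (auto intro: sm_lower sm_partial_12)
  have ev': "ev 2 v" using ev by (auto intro: ev_lower)
  have sa: "sm (Suc 0) (\<partial>\<^sub>t (\<lambda>t R \<phi> Z. v t R \<phi> Z * \<partial>\<^sub>R (\<psi> t) R \<phi> Z) t)"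
      "sm (Suc 0) (\<partial>\<^sub>t (\<lambda>t R \<phi> Z. v t R \<phi> Z * \<partial>\<^sub>Z (\<psi> t) R \<phi> Z) t)"
    by (intro ev_slice[OF _ t] ev_partial_12 ev_mult ev_partial_23 ev ev')+
  have srh: "sm 2 (rho_hat (\<rho> t))" "sm (Suc 0) (rho_hat (\<rho> t))"
    unfolding rho_hat_eq by (intro sm_intros s2 s1)+
  have vrh: "vanish (rho_hat (\<rho> t))" using van(4) by (auto simp: vanish_def rho_hat_def)
  note sm = s1 s2 s3 st sa srh
  \<comment> \<open>\<open>h1\<close> to \<open>h14\<close> are the differentiated factors of the vorticity equation, numbered by its terms, except
    that \<open>h3\<close> is \<open>v\<^sup>2 |\<^bold>B|\<^sup>2 / 2\<close>. They stay opaque, because integration by parts does not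
    differentiate them.\<close>
  define h1 where "h1 = (\<lambda>R \<phi> Z. R\<^sup>2 * dot_pol (u t) (u t) R \<phi> Z)"
  define h2 where "h2 = (\<lambda>R \<phi> Z. rho_hat (\<rho> t) R \<phi> Z * R\<^sup>2 * w t R \<phi> Z)"
  define h7 where "h7 = (\<lambda>R \<phi> Z. \<rho> t R \<phi> Z * (v t R \<phi> Z)\<^sup>2 * j t R \<phi> Z)"
  define h8 where "h8 = (\<lambda>R \<phi> Z. \<rho> t R \<phi> Z * v t R \<phi> Z * dot_pol (v t) (\<psi> t) R \<phi> Z)"
  define h10 where "h10 = (\<lambda>R \<phi> Z. v t R \<phi> Z * dot_pol (\<psi> t) (u t) R \<phi> Z)"
  define h11 where "h11 = (\<lambda>R \<phi> Z. (v t R \<phi> Z)\<^sup>2 * (dot_pol (\<psi> t) (\<psi> t) R \<phi> Z / R\<^sup>2))"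
  define h12 where "h12 = (\<lambda>R \<phi> Z. rho_hat (\<rho> t) R \<phi> Z * v t R \<phi> Z * w t R \<phi> Z)"
  define h13 where "h13 = (\<lambda>R \<phi> Z. rho_hat (\<rho> t) R \<phi> Z * v t R \<phi> Z * j t R \<phi> Z)"
  define h14 where "h14 = (\<lambda>R \<phi> Z. rho_hat (\<rho> t) R \<phi> Z * dot_pol (\<psi> t) (v t) R \<phi> Z)"
  \<comment> \<open>The toroidal part of v^2 |B|^2. Paired with \<open>rho_hat\<close> in a bracket
    with \<open>u\<close>, it absorbs the poloidal-drift terms that are quadratic in
    \<open>F0\<close>.\<close>
  define h20 where "h20 = (\<lambda>R \<phi> Z. (v t R \<phi> Z)\<^sup>2 * (F0\<^sup>2 / R\<^sup>2))"
  define h3 where "h3 = (\<lambda>R \<phi> Z. (v t R \<phi> Z)\<^sup>2 * ((F0\<^sup>2 + dot_pol (\<psi> t) (\<psi> t) R \<phi> Z) / R\<^sup>2) / 2)"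
  define n1 where "n1 = (\<lambda>R \<phi> Z. R * (rho_hat (\<rho> t) R \<phi> Z * (F0 / R\<^sup>2) * v t R \<phi> Z * \<partial>\<^sub>R (\<partial>\<^sub>\<phi> (u t)) R \<phi> Z))"
  define n2 where "n2 = (\<lambda>R \<phi> Z. rho_hat (\<rho> t) R \<phi> Z * (F0 / R\<^sup>2) * v t R \<phi> Z * \<partial>\<^sub>Z (\<partial>\<^sub>\<phi> (u t)) R \<phi> Z)"
  define m15 where "m15 = (\<lambda>R \<phi> Z. rho_hat (\<rho> t) R \<phi> Z * (F0 / R ^ 3) * v t R \<phi> Z * \<partial>\<^sub>\<phi> (\<lambda>R \<phi> Z. v t R \<phi> Z
      * \<partial>\<^sub>Z (\<psi> t) R \<phi> Z) R \<phi> Z)"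
  define m16 where "m16 = (\<lambda>R \<phi> Z. rho_hat (\<rho> t) R \<phi> Z * (F0 / R ^ 3) * v t R \<phi> Z * \<partial>\<^sub>\<phi> (\<lambda>R \<phi> Z. v t R \<phi> Z
      * \<partial>\<^sub>R (\<psi> t) R \<phi> Z) R \<phi> Z)"
  define m17 where "m17 = (\<lambda>R \<phi> Z. rho_hat (\<rho> t) R \<phi> Z * (F0\<^sup>2 / R ^ 3) * (v t R \<phi> Z)\<^sup>2)"
  define e1 where "e1 = (\<lambda>R \<phi> Z. R * (rho_hat (\<rho> t) R \<phi> Z * \<partial>\<^sub>R (\<partial>\<^sub>t u t) R \<phi> Z))"
  define e2 where "e2 = (\<lambda>R \<phi> Z. rho_hat (\<rho> t) R \<phi> Z * \<partial>\<^sub>Z (\<partial>\<^sub>t u t) R \<phi> Z)"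
  define e3 where "e3 = (\<lambda>R \<phi> Z. R * (\<rho> t R \<phi> Z * \<partial>\<^sub>t (\<lambda>t R \<phi> Z. v t R \<phi> Z * \<partial>\<^sub>R (\<psi> t) R \<phi> Z) t R \<phi> Z))"
  define e4 where "e4 = (\<lambda>R \<phi> Z. \<rho> t R \<phi> Z * \<partial>\<^sub>t (\<lambda>t R \<phi> Z. v t R \<phi> Z * \<partial>\<^sub>Z (\<psi> t) R \<phi> Z) t R \<phi> Z)"
  define bt where "bt = (\<lambda>R \<phi> Z. (F0\<^sup>2 + dot_pol (\<psi> t) (\<psi> t) R \<phi> Z) / R\<^sup>2 / 2)"
  define bp where "bp = (\<lambda>R \<phi> Z. dot_pol (\<psi> t) (\<psi> t) R \<phi> Z / R\<^sup>2 / 2)"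
  define rv where "rv = (\<lambda>R \<phi> Z. \<rho> t R \<phi> Z * v t R \<phi> Z)"
  note fd = h1_def h2_def h7_def h8_def h10_def h11_def h12_def h13_def h14_def h20_def h3_def n1_def n2_def
      m15_def m16_def m17_def e1_def e2_def e3_def e4_def bt_def bp_def rv_def
  have sf: "sm (Suc 0) h1" "sm (Suc 0) h2" "sm (Suc 0) h7" "sm (Suc 0) h8" "sm (Suc 0) h10" "sm (Suc 0) h11"
      "sm (Suc 0) h12" "sm (Suc 0) h13" "sm (Suc 0) h14" "sm (Suc 0) h20" "sm (Suc 0) h3" "sm (Suc 0) n1"
      "sm (Suc 0) n2" "sm (Suc 0) m15" "sm (Suc 0) m16" "sm (Suc 0) m17" "sm (Suc 0) e1" "sm (Suc 0) e2"
      "sm (Suc 0) e3" "sm (Suc 0) e4" "sm (Suc 0) bt" "sm (Suc 0) bp" "sm (Suc 0) rv"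
    unfolding fd by (intro sm_intros sm)+
  have vrv: "vanish rv" unfolding rv_def by (intro vanish_mult(1) van)
  have pf: "per h1" "per h10" "per h3" "per rv"
    unfolding fd by (intro per_divide per_mult per_add per_power per_R_fun per_dot_pol per)+
  \<comment> \<open>On solutions, the energy rate plus the dissipation is a combination of these fields.\<close>
  define N1 where "N1 = (\<lambda>R \<phi> Z. dot_pol (\<psi> t) (\<partial>\<^sub>t \<psi> t) R \<phi> Z / R + (\<partial>\<^sub>t \<psi> t) R \<phi> Z * j t R \<phi> Z / R)"
  define N2 where "N2 = (\<lambda>R \<phi> Z. (u t R \<phi> Z * pbracket (j t) (\<psi> t) R \<phi> Z + j t R \<phi> Z *
      pbracket (u t) (\<psi> t) R \<phi> Z) + F0 * ((u t R \<phi> Z * \<partial>\<^sub>\<phi> (j t) R \<phi> Z + \<partial>\<^sub>\<phi> (u t) R \<phi> Z * j t R \<phi> Z) / R))"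
  define N3 where "N3 = (\<lambda>R \<phi> Z. j t R \<phi> Z * \<partial>\<^sub>\<phi> (\<partial>\<^sub>\<phi> (\<psi> t)) R \<phi> Z / R ^ 3 - R
      * (norm (grad_pol (\<lambda>R \<phi> Z. \<partial>\<^sub>\<phi> (\<psi> t) R \<phi> Z / R\<^sup>2) R \<phi> Z))\<^sup>2)"
  define N4 where "N4 = (\<lambda>R \<phi> Z. - 5 / 2 * (p t R \<phi> Z * pbracket (v t) (\<psi> t) R \<phi> Z + v t R \<phi> Z *
      pbracket (p t) (\<psi> t) R \<phi> Z) + - 5 / 2 * F0 * ((p t R \<phi> Z * \<partial>\<^sub>\<phi> (v t) R \<phi> Z + \<partial>\<^sub>\<phi> (p t) R \<phi> Z
      * v t R \<phi> Z) / R) + 3 / 2 * pbracket (\<lambda>R \<phi> Z. R\<^sup>2 * p t R \<phi> Z) (u t) R \<phi> Z + 2 * (R ^ 1 * (p t R \<phi> Z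
      * \<partial>\<^sub>Z (u t) R \<phi> Z + \<partial>\<^sub>Z (p t) R \<phi> Z * u t R \<phi> Z)))"
  define N5 where "N5 = (\<lambda>R \<phi> Z. R * (u t R \<phi> Z * lap_pol (w t) R \<phi> Z) - R * (w t R \<phi> Z)\<^sup>2)"
  define N6 where "N6 = (\<lambda>R \<phi> Z. (u t R \<phi> Z * \<partial>\<^sub>R e1 R \<phi> Z + \<partial>\<^sub>R (u t) R \<phi> Z * e1 R \<phi> Z) + R ^ 1
      * (u t R \<phi> Z * \<partial>\<^sub>Z e2 R \<phi> Z + \<partial>\<^sub>Z (u t) R \<phi> Z * e2 R \<phi> Z) - (u t R \<phi> Z * \<partial>\<^sub>R e3 R \<phi> Z
      + \<partial>\<^sub>R (u t) R \<phi> Z * e3 R \<phi> Z) - R ^ 1 * (u t R \<phi> Z * \<partial>\<^sub>Z e4 R \<phi> Z + \<partial>\<^sub>Z (u t) R \<phi> Z * e4 R \<phi> Z))"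
  define N7 where "N7 = (\<lambda>R \<phi> Z. - 1 / 2 * (u t R \<phi> Z * pbracket h1 (rho_hat (\<rho> t)) R \<phi> Z + h1 R \<phi> Z *
      pbracket (u t) (rho_hat (\<rho> t)) R \<phi> Z) - (u t R \<phi> Z * pbracket h2 (u t) R \<phi> Z + h2 R \<phi> Z *
      pbracket (u t) (u t) R \<phi> Z) - (u t R \<phi> Z * pbracket h7 (\<psi> t) R \<phi> Z + h7 R \<phi> Z *
      pbracket (u t) (\<psi> t) R \<phi> Z) - (u t R \<phi> Z * pbracket h8 (\<psi> t) R \<phi> Z + h8 R \<phi> Z *
      pbracket (u t) (\<psi> t) R \<phi> Z) + (u t R \<phi> Z * \<partial>\<^sub>R n1 R \<phi> Z + \<partial>\<^sub>R (u t) R \<phi> Z * n1 R \<phi> Z) + R ^ 1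
      * (u t R \<phi> Z * \<partial>\<^sub>Z n2 R \<phi> Z + \<partial>\<^sub>Z (u t) R \<phi> Z * n2 R \<phi> Z) + (u t R \<phi> Z *
      pbracket h10 (rho_hat (\<rho> t)) R \<phi> Z + h10 R \<phi> Z * pbracket (u t) (rho_hat (\<rho> t)) R \<phi> Z) - 1 / 2
      * (u t R \<phi> Z * pbracket h11 (rho_hat (\<rho> t)) R \<phi> Z + h11 R \<phi> Z * pbracket (u t) (rho_hat (\<rho> t)) R \<phi> Z)
      + (u t R \<phi> Z * pbracket h12 (\<psi> t) R \<phi> Z + h12 R \<phi> Z * pbracket (u t) (\<psi> t) R \<phi> Z) + (u t R \<phi> Z *
      pbracket h13 (u t) R \<phi> Z + h13 R \<phi> Z * pbracket (u t) (u t) R \<phi> Z) + (u t R \<phi> Z *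
      pbracket h14 (u t) R \<phi> Z + h14 R \<phi> Z * pbracket (u t) (u t) R \<phi> Z) - R ^ 0 * (u t R \<phi> Z
      * \<partial>\<^sub>Z m15 R \<phi> Z + \<partial>\<^sub>Z (u t) R \<phi> Z * m15 R \<phi> Z) - (u t R \<phi> Z * \<partial>\<^sub>R m16 R \<phi> Z + \<partial>\<^sub>R (u t) R \<phi> Z
      * m16 R \<phi> Z) + R ^ 0 * (u t R \<phi> Z * \<partial>\<^sub>Z m17 R \<phi> Z + \<partial>\<^sub>Z (u t) R \<phi> Z * m17 R \<phi> Z) - (1 / 2 * (rv R \<phi> Z
      * pbracket h1 (\<psi> t) R \<phi> Z + h1 R \<phi> Z * pbracket rv (\<psi> t) R \<phi> Z) - (rv R \<phi> Z * pbracket h10 (\<psi> t) R \<phi> Z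
      + h10 R \<phi> Z * pbracket rv (\<psi> t) R \<phi> Z) + (rv R \<phi> Z * pbracket h3 (\<psi> t) R \<phi> Z + h3 R \<phi> Z *
      pbracket rv (\<psi> t) R \<phi> Z)) - F0 * (1 / 2 * ((rv R \<phi> Z * \<partial>\<^sub>\<phi> h1 R \<phi> Z + \<partial>\<^sub>\<phi> rv R \<phi> Z * h1 R \<phi> Z) / R)
      - ((rv R \<phi> Z * \<partial>\<^sub>\<phi> h10 R \<phi> Z + \<partial>\<^sub>\<phi> rv R \<phi> Z * h10 R \<phi> Z) / R) + ((rv R \<phi> Z * \<partial>\<^sub>\<phi> h3 R \<phi> Z
      + \<partial>\<^sub>\<phi> rv R \<phi> Z * h3 R \<phi> Z) / R)) + 1 / 2 * (rho_hat (\<rho> t) R \<phi> Z * pbracket h20 (u t) R \<phi> Z + h20 R \<phi> Z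
      * pbracket (rho_hat (\<rho> t)) (u t) R \<phi> Z))"
  have w: "w t R \<phi> Z = lap_pol (u t) R \<phi> Z" and j: "j t R \<phi> Z = lap_star (\<psi> t) R \<phi> Z" if "(R, \<phi>, Z) \<in> cyl D"
      for R \<phi> Z
    using mhd[OF that] by (auto simp: reduced_mhd_def)
  note null_intros
      = null_add null_diff null_cmult null_parts_bracket null_parts_R null_parts_Z null_parts_phi null_bracket
  \<comment> \<open>Each integration by parts has its own vanishing factor: the time derivative of
    \<psi> in \<open>N1\<close>, \<open>u\<close> in \<open>N2\<close> and \<open>N6\<close>,
    \<open>p\<close> in \<open>N4\<close>, and \<open>u\<close>, \<open>rv\<close> or
    \<open>rho_hat\<close> in \<open>N7\<close>. The \<phi>-terms use periodicity instead.\<close>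
  have N: "null N1" "null N2" "null N3" "null N4" "null N5" "null N6" "null N7"
  proof -
    show "null N1" unfolding N1_def by (rule null_magnetic[OF s2(1) st(1) van(6) j])
    show "null N2" unfolding N2_def by (intro null_intros sm van per)
    show "null N3" unfolding N3_def by (rule null_resistive[OF s3(1) per(1) van(7,8) j])
    show "null N4" unfolding N4_def by (intro null_intros sm_mult sm_power sm_R vanish_mult(2) sm van per)
    show "null N5" unfolding N5_def by (rule null_viscous[OF s2(2,3) van(1-3) w])
    show "null N6" unfolding N6_def by (intro null_intros sm sf van)
    show "null N7" unfolding N7_def by (intro null_intros sm sf van vrv vrh pf)
  qed
  show ?thesis
  proof (rule null_cong)
    show "null (\<lambda>R \<phi> Z. N1 R \<phi> Z + N2 R \<phi> Z - \<eta> * N3 R \<phi> Z + N4 R \<phi> Z - \<nu> * N5 R \<phi> Z + N6 R \<phi> Z + N7 R \<phi> Z)"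
      by (intro null_add null_diff null_cmult N)
  next
    fix R \<phi> Z assume x: "(R, \<phi>, Z) \<in> cyl D"
    have U: "(R, Z) \<in> U" by (rule cyl_U[OF x])
    have R: "R \<noteq> 0" using R_pos[OF U] by simp
    note eqs = mhd[OF x, unfolded reduced_mhd_def]
    have c: "\<partial>\<^sub>\<phi> (\<partial>\<^sub>R (\<psi> t)) R \<phi> Z = \<partial>\<^sub>R (\<partial>\<^sub>\<phi> (\<psi> t)) R \<phi> Z" "\<partial>\<^sub>\<phi> (\<partial>\<^sub>Z (\<psi> t)) R \<phi> Z = \<partial>\<^sub>Z (\<partial>\<^sub>\<phi> (\<psi> t)) R \<phi> Z"
      using sm_commute[OF s2(1) U] by auto
    have F1: "pbracket rv (\<psi> t) R \<phi> Z = v t R \<phi> Z * pbracket (\<rho> t) (\<psi> t) R \<phi> Z + \<rho> t R \<phi> Z *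
        pbracket (v t) (\<psi> t) R \<phi> Z"
      "\<partial>\<^sub>\<phi> rv R \<phi> Z = \<rho> t R \<phi> Z * \<partial>\<^sub>\<phi> (v t) R \<phi> Z + v t R \<phi> Z * \<partial>\<^sub>\<phi> (\<rho> t) R \<phi> Z"
      unfolding rv_def pbracket_def using U sm by (simp_all add: partial_mult algebra_simps)
    have F2: "pbracket h10 (\<psi> t) R \<phi> Z = v t R \<phi> Z * pbracket (dot_pol (\<psi> t) (u t)) (\<psi> t) R \<phi> Z
        + dot_pol (\<psi> t) (u t) R \<phi> Z * pbracket (v t) (\<psi> t) R \<phi> Z"
      "\<partial>\<^sub>\<phi> h10 R \<phi> Z = v t R \<phi> Z * \<partial>\<^sub>\<phi> (dot_pol (\<psi> t) (u t)) R \<phi> Z + dot_pol (\<psi> t) (u t) R \<phi> Z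
          * \<partial>\<^sub>\<phi> (v t) R \<phi> Z"
      unfolding h10_def pbracket_def using U sm by (simp_all add: partial_mult sm_intros algebra_simps)
    have F4: "\<partial>\<^sub>\<phi> (\<lambda>R \<phi> Z. (v t R \<phi> Z)\<^sup>2 * ((F0\<^sup>2 + dot_pol (\<psi> t) (\<psi> t) R \<phi> Z) / R\<^sup>2) / (2 * R)) R \<phi> Z
        = 1 / R * \<partial>\<^sub>\<phi> h3 R \<phi> Z"
    proof -
      have "(\<lambda>R \<phi> Z. (v t R \<phi> Z)\<^sup>2 * ((F0\<^sup>2 + dot_pol (\<psi> t) (\<psi> t) R \<phi> Z) / R\<^sup>2) / (2 * R))
          = (\<lambda>R \<phi> Z. h3 R \<phi> Z / R)"
        by (simp add: h3_def fun_eq_iff)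
      then show ?thesis using partial_divide_R(2)[of h3, OF _ U] sf by simp
    qed
    \<comment> \<open>The toroidal part of |B|^2 / 2 depends on R alone, so it only adds a multiple
      of \<open>\<partial>\<^sub>Z (u t)\<close>. The last term of the parallel momentum equation
      cancels exactly this contribution.\<close>
    have F5: "pbracket (u t) bt R \<phi> Z = pbracket (u t) bp R \<phi> Z + F0\<^sup>2 / R ^ 3 * \<partial>\<^sub>Z (u t) R \<phi> Z"
    proof -
      let ?c = "\<lambda>R \<phi> Z. F0\<^sup>2 / 2 / R\<^sup>2"
      have bt: "bt = (\<lambda>R \<phi> Z. bp R \<phi> Z + ?c R \<phi> Z)"
        by (simp add: bt_def bp_def fun_eq_iff add_divide_distrib)
      have sc: "sm (Suc 0) ?c" by (intro sm_intros)
      have "\<partial>\<^sub>R ?c R \<phi> Z = - (F0\<^sup>2 / R ^ 3)"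
        using partial_divide_R_power(1)[OF sm_const[where c="F0\<^sup>2 / 2"] U, where n=2 and \<phi>=\<phi>]
        by (simp add: partial_const power3_eq_cube power2_eq_square)
      moreover have "\<partial>\<^sub>Z ?c R \<phi> Z = 0"
        using partial_divide_R_power(3)[OF sm_const[where c="F0\<^sup>2 / 2"] U, where n=2 and \<phi>=\<phi>] by (simp add:
            partial_const)
      moreover have "\<partial>\<^sub>R bt R \<phi> Z = \<partial>\<^sub>R bp R \<phi> Z + \<partial>\<^sub>R ?c R \<phi> Z"
        "\<partial>\<^sub>Z bt R \<phi> Z = \<partial>\<^sub>Z bp R \<phi> Z + \<partial>\<^sub>Z ?c R \<phi> Z"
        unfolding bt using partial_add[OF _ sc U, of bp] sf by blast+
      ultimately have d: "\<partial>\<^sub>R bt R \<phi> Z = \<partial>\<^sub>R bp R \<phi> Z - F0\<^sup>2 / R ^ 3" "\<partial>\<^sub>Z bt R \<phi> Z = \<partial>\<^sub>Z bp R \<phi> Z"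
        by simp_all
      show ?thesis unfolding pbracket_def d by (simp add: algebra_simps)
    qed
    have F6: "pbracket (rho_hat (\<rho> t)) (u t) R \<phi> Z = R\<^sup>2 * pbracket (\<rho> t) (u t) R \<phi> Z + 2 * R * \<rho> t R \<phi> Z
        * \<partial>\<^sub>Z (u t) R \<phi> Z"
      unfolding rho_hat_eq pbracket_def using U sm
      by (simp add: partial_mult partial_coord_power sm_intros algebra_simps)
    have F8: "pbracket h20 (u t) R \<phi> Z = F0\<^sup>2 / R\<^sup>2 * (2 * v t R \<phi> Z * - pbracket (u t) (v t) R \<phi> Z)
        - (v t R \<phi> Z)\<^sup>2 * (2 * F0\<^sup>2 / R ^ 3) * \<partial>\<^sub>Z (u t) R \<phi> Z"
      unfolding h20_def pbracket_def using U sm R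
      by (simp add: partial_mult partial_power2 partial_divide_R_power partial_const sm_intros)
        (simp add: field_simps power2_eq_square power3_eq_cube)
    have F9: "\<partial>\<^sub>\<phi> h1 R \<phi> Z = R\<^sup>2 * (2 * (\<partial>\<^sub>R (u t) R \<phi> Z * \<partial>\<^sub>R (\<partial>\<^sub>\<phi> (u t)) R \<phi> Z + \<partial>\<^sub>Z (u t) R \<phi> Z
        * \<partial>\<^sub>Z (\<partial>\<^sub>\<phi> (u t)) R \<phi> Z))"
      unfolding h1_def using U sm
      by (simp add: partial_mult partial_coord_power
          partial_dot_pol_phi sm_intros) (simp add: dot_pol_def algebra_simps)
    have F10: "\<partial>\<^sub>\<phi> (\<lambda>R \<phi> Z. v t R \<phi> Z * \<partial>\<^sub>Z (\<psi> t) R \<phi> Z) R \<phi> Z = v t R \<phi> Z * \<partial>\<^sub>Z (\<partial>\<^sub>\<phi> (\<psi> t)) R \<phi> Z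
        + \<partial>\<^sub>Z (\<psi> t) R \<phi> Z * \<partial>\<^sub>\<phi> (v t) R \<phi> Z"
      "\<partial>\<^sub>\<phi> (\<lambda>R \<phi> Z. v t R \<phi> Z * \<partial>\<^sub>R (\<psi> t) R \<phi> Z) R \<phi> Z = v t R \<phi> Z * \<partial>\<^sub>R (\<partial>\<^sub>\<phi> (\<psi> t)) R \<phi> Z + \<partial>\<^sub>R (\<psi> t) R \<phi> Z
          * \<partial>\<^sub>\<phi> (v t) R \<phi> Z"
      using U sm by (simp_all add: partial_mult sm_intros c)
    have F11: "pbracket (\<lambda>R \<phi> Z. R\<^sup>2) (p t) R \<phi> Z = 2 * R * \<partial>\<^sub>Z (p t) R \<phi> Z"
      by (simp add: pbracket_def partial_coord_power)
    have F12: "pbracket (\<lambda>R \<phi> Z. R\<^sup>2 * p t R \<phi> Z) (u t) R \<phi> Z = 2 * R * p t R \<phi> Z * \<partial>\<^sub>Z (u t) R \<phi> Z + R\<^sup>2 *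
        pbracket (p t) (u t) R \<phi> Z"
      unfolding pbracket_def using U sm
      by (simp add: partial_mult partial_coord_power sm_intros algebra_simps)
    have F13: "\<partial>\<^sub>\<phi> (dot_pol (\<psi> t) (u t)) R \<phi> Z = dot_pol (\<partial>\<^sub>\<phi> (\<psi> t)) (u t) R \<phi> Z
        + dot_pol (\<psi> t) (\<partial>\<^sub>\<phi> (u t)) R \<phi> Z"
      using U sm by (simp add: partial_dot_pol_phi)
    have rho_t: "\<partial>\<^sub>t \<rho> t R \<phi> Z = R * pbracket (\<rho> t) (u t) R \<phi> Z + 2 * \<rho> t R \<phi> Z * \<partial>\<^sub>Z (u t) R \<phi> Z
        - v t R \<phi> Z * F0 / R\<^sup>2 * \<partial>\<^sub>\<phi> (\<rho> t) R \<phi> Z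
        - v t R \<phi> Z / R * pbracket (\<rho> t) (\<psi> t) R \<phi> Z - \<rho> t R \<phi> Z / R * pbracket (v t) (\<psi> t) R \<phi> Z
            - \<rho> t R \<phi> Z * F0 / R\<^sup>2 * \<partial>\<^sub>\<phi> (v t) R \<phi> Z"
      using eqs by (simp add: eq_density_def)
    have M: "- ((\<partial>\<^sub>t \<psi> t) R \<phi> Z * j t R \<phi> Z / R) - u t R \<phi> Z * pbracket (\<psi> t) (j t) R \<phi> Z + F0 / R
        * (u t R \<phi> Z * \<partial>\<^sub>\<phi> (j t) R \<phi> Z)
        = N2 R \<phi> Z - \<eta> * (R * ((j t R \<phi> Z)\<^sup>2 / R\<^sup>2)) - \<eta> * (j t R \<phi> Z * \<partial>\<^sub>\<phi> (\<partial>\<^sub>\<phi> (\<psi> t)) R \<phi> Z / R ^ 3)"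
      unfolding N2_def
      by (rule magnetic_terms[OF R pbracket_antisym pbracket_antisym]) (use eqs in \<open>simp add: eq_flux_def\<close>)
    have Pr: "u t R \<phi> Z * (2 * R * \<partial>\<^sub>Z (p t) R \<phi> Z) - v t R \<phi> Z * pbracket (p t) (\<psi> t) R \<phi> Z - F0 / R
        * v t R \<phi> Z * \<partial>\<^sub>\<phi> (p t) R \<phi> Z + R * (1 / (gam - 1) * \<partial>\<^sub>t p t R \<phi> Z) = N4 R \<phi> Z"
      unfolding N4_def F12 using pressure_terms[OF R, of "\<partial>\<^sub>t p t R \<phi> Z"] eqs by (simp add: eq_pressure_def)
    \<comment> \<open>\<open>Bv\<close> is R u times the right side of the vorticity equation
      without its pressure, current and viscous terms. \<open>Gv\<close> is the right side of the
      parallel momentum equation without the pressure gradient. The omitted terms are balanced by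
      \<open>Pr\<close>, \<open>M\<close> and \<open>N5\<close>.\<close>
    define Bv where "Bv = 1 / 2 * u t R \<phi> Z * pbracket h1 (rho_hat (\<rho> t)) R \<phi> Z + u t R \<phi> Z *
        pbracket h2 (u t) R \<phi> Z + u t R \<phi> Z * pbracket h7 (\<psi> t) R \<phi> Z + u t R \<phi> Z * pbracket h8 (\<psi> t) R \<phi> Z
        - (u t R \<phi> Z * \<partial>\<^sub>R n1 R \<phi> Z + R * u t R \<phi> Z * \<partial>\<^sub>Z n2 R \<phi> Z) + u t R \<phi> Z * -
            pbracket h10 (rho_hat (\<rho> t)) R \<phi> Z - 1 / 2 * u t R \<phi> Z * - pbracket h11 (rho_hat (\<rho> t)) R \<phi> Z
        - u t R \<phi> Z * pbracket h12 (\<psi> t) R \<phi> Z + u t R \<phi> Z * - pbracket h13 (u t) R \<phi> Z + u t R \<phi> Z * -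
            pbracket h14 (u t) R \<phi> Z + u t R \<phi> Z * \<partial>\<^sub>Z m15 R \<phi> Z + u t R \<phi> Z * \<partial>\<^sub>R m16 R \<phi> Z - u t R \<phi> Z
            * \<partial>\<^sub>Z m17 R \<phi> Z"
    define Gv where "Gv = \<rho> t R \<phi> Z / R * - pbracket h3 (\<psi> t) R \<phi> Z - F0 / R * \<rho> t R \<phi> Z * (1 / R
        * \<partial>\<^sub>\<phi> h3 R \<phi> Z) - 1 / (2 * R) * \<rho> t R \<phi> Z * pbracket h1 (\<psi> t) R \<phi> Z
        - rho_hat (\<rho> t) R \<phi> Z / R * w t R \<phi> Z * - pbracket (u t) (\<psi> t) R \<phi> Z - R * \<rho> t R \<phi> Z * ((F0\<^sup>2
            + dot_pol (\<psi> t) (\<psi> t) R \<phi> Z) / R\<^sup>2) * pbracket (u t) (v t) R \<phi> Z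
        - R * \<rho> t R \<phi> Z * v t R \<phi> Z * (pbracket (u t) bp R \<phi> Z + F0\<^sup>2 / R ^ 3 * \<partial>\<^sub>Z (u t) R \<phi> Z)
        + R * \<rho> t R \<phi> Z * v t R \<phi> Z * pbracket (u t) bp R \<phi> Z - \<rho> t R \<phi> Z * v t R \<phi> Z * (j t R \<phi> Z / R) *
            pbracket (u t) (\<psi> t) R \<phi> Z - \<rho> t R \<phi> Z * v t R \<phi> Z / R * -
            pbracket (dot_pol (\<psi> t) (u t)) (\<psi> t) R \<phi> Z
        + \<rho> t R \<phi> Z * v t R \<phi> Z * F0 / R\<^sup>2 * dot_pol (\<psi> t) (\<partial>\<^sub>\<phi> (u t)) R \<phi> Z + \<rho> t R \<phi> Z * v t R \<phi> Z
            * (F0\<^sup>2 / R\<^sup>2) * \<partial>\<^sub>Z (u t) R \<phi> Z"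
    have hv: "h1 R \<phi> Z = R\<^sup>2 * dot_pol (u t) (u t) R \<phi> Z" "h2 R \<phi> Z = rho_hat (\<rho> t) R \<phi> Z * R\<^sup>2 * w t R \<phi> Z"
        "h7 R \<phi> Z = \<rho> t R \<phi> Z * (v t R \<phi> Z)\<^sup>2 * j t R \<phi> Z" "h8 R \<phi> Z = \<rho> t R \<phi> Z * v t R \<phi> Z
        * dot_pol (v t) (\<psi> t) R \<phi> Z" "h10 R \<phi> Z = v t R \<phi> Z * dot_pol (\<psi> t) (u t) R \<phi> Z" "h11 R \<phi> Z
        = (v t R \<phi> Z)\<^sup>2 * (dot_pol (\<psi> t) (\<psi> t) R \<phi> Z / R\<^sup>2)" "h12 R \<phi> Z = rho_hat (\<rho> t) R \<phi> Z * v t R \<phi> Z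
        * w t R \<phi> Z" "h13 R \<phi> Z = rho_hat (\<rho> t) R \<phi> Z * v t R \<phi> Z * j t R \<phi> Z" "h20 R \<phi> Z = (v t R \<phi> Z)\<^sup>2
        * (F0\<^sup>2 / R\<^sup>2)" "h3 R \<phi> Z = (v t R \<phi> Z)\<^sup>2 * ((F0\<^sup>2 + dot_pol (\<psi> t) (\<psi> t) R \<phi> Z) / R\<^sup>2) / 2"
        "n1 R \<phi> Z = R * (rho_hat (\<rho> t) R \<phi> Z * (F0 / R\<^sup>2) * v t R \<phi> Z * \<partial>\<^sub>R (\<partial>\<^sub>\<phi> (u t)) R \<phi> Z)" "n2 R \<phi> Z
        = rho_hat (\<rho> t) R \<phi> Z * (F0 / R\<^sup>2) * v t R \<phi> Z * \<partial>\<^sub>Z (\<partial>\<^sub>\<phi> (u t)) R \<phi> Z" "m15 R \<phi> Z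
        = rho_hat (\<rho> t) R \<phi> Z * (F0 / R ^ 3) * v t R \<phi> Z * \<partial>\<^sub>\<phi> (\<lambda>R \<phi> Z. v t R \<phi> Z * \<partial>\<^sub>Z (\<psi> t) R \<phi> Z) R \<phi> Z"
        "m16 R \<phi> Z = rho_hat (\<rho> t) R \<phi> Z * (F0 / R ^ 3) * v t R \<phi> Z * \<partial>\<^sub>\<phi> (\<lambda>R \<phi> Z. v t R \<phi> Z
        * \<partial>\<^sub>R (\<psi> t) R \<phi> Z) R \<phi> Z" "m17 R \<phi> Z = rho_hat (\<rho> t) R \<phi> Z * (F0\<^sup>2 / R ^ 3) * (v t R \<phi> Z)\<^sup>2"
        "rv R \<phi> Z = \<rho> t R \<phi> Z * v t R \<phi> Z" "h14 R \<phi> Z = rho_hat (\<rho> t) R \<phi> Z * dot_pol (v t) (\<psi> t) R \<phi> Z"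
      unfolding fd by (simp_all add: dot_pol_commute[of "\<psi> t" "v t"])
    note anti = pbracket_antisym[of "u t" "rho_hat (\<rho> t)"] pbracket_antisym[of "rho_hat (\<rho> t)" h10]
      pbracket_antisym[of "rho_hat (\<rho> t)" h11] pbracket_antisym[of "u t" h13] pbracket_antisym[of "u t" h14]
      pbracket_antisym[of "\<psi> t" h3] pbracket_antisym[of "\<psi> t" "u t"] pbracket_antisym[of "\<psi> t"
          "dot_pol (\<psi> t) (u t)"]
    have Dn: "R * (\<partial>\<^sub>t \<rho> t R \<phi> Z * ((R\<^sup>2 * dot_pol (u t) (u t) R \<phi> Z - 2 * v t R \<phi> Z
        * dot_pol (\<psi> t) (u t) R \<phi> Z + (v t R \<phi> Z)\<^sup>2 * ((F0\<^sup>2 + dot_pol (\<psi> t) (\<psi> t) R \<phi> Z) / R\<^sup>2)) / 2)) - Bv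
        + v t R \<phi> Z * R * Gv = N7 R \<phi> Z"
      unfolding Bv_def Gv_def N7_def hv F1 F2 F8 anti(1) pbracket_self
      by (rule density_terms[OF R rho_t _ F6 _ _ _ _ _ _ _ F9 F13 _ F10])
        (simp_all add: rho_hat_def dot_pol_def pbracket_def power2_eq_square)
    have Eb0: "(1 / R * \<partial>\<^sub>R e1 R \<phi> Z + \<partial>\<^sub>Z e2 R \<phi> Z) - (1 / R * \<partial>\<^sub>R e3 R \<phi> Z + \<partial>\<^sub>Z e4 R \<phi> Z)
      = 1 / (2 * R) * pbracket h1 (rho_hat (\<rho> t)) R \<phi> Z + 1 / R * pbracket h2 (u t) R \<phi> Z - 1 / R *
          pbracket (\<lambda>R \<phi> Z. R\<^sup>2) (p t) R \<phi> Z + 1 / R * pbracket (\<psi> t) (j t) R \<phi> Z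
        - F0 / R\<^sup>2 * \<partial>\<^sub>\<phi> (j t) R \<phi> Z + \<nu> * lap_pol (w t) R \<phi> Z + 1 / R * pbracket h7 (\<psi> t) R \<phi> Z + 1 / R *
            pbracket h8 (\<psi> t) R \<phi> Z
        - (1 / R * \<partial>\<^sub>R n1 R \<phi> Z + \<partial>\<^sub>Z n2 R \<phi> Z) + 1 / R * pbracket (rho_hat (\<rho> t)) h10 R \<phi> Z - 1 / (2 * R) *
            pbracket (rho_hat (\<rho> t)) h11 R \<phi> Z
        - 1 / R * pbracket h12 (\<psi> t) R \<phi> Z + 1 / R * pbracket (u t) h13 R \<phi> Z + 1 / R *
            pbracket (u t) h14 R \<phi> Z + 1 / R * \<partial>\<^sub>Z m15 R \<phi> Z
        + 1 / R * \<partial>\<^sub>R m16 R \<phi> Z - 1 / R * \<partial>\<^sub>Z m17 R \<phi> Z"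
      \<comment> \<open>Once norms, inner products and abbreviations are unfolded, the claim is
        literally one conjunct of the system; no algebra takes place.\<close>
      using eqs
          unfolding eq_vorticity_def divg_partial_t_grad_pol[OF ev1 ev2 t U] divg_grad_pol inner_grad_pol
        norm_grad_pol norm_B_pol fd by (elim conjE)
    have Eg0: "\<rho> t R \<phi> Z * ((F0\<^sup>2 + dot_pol (\<psi> t) (\<psi> t) R \<phi> Z) / R\<^sup>2) * \<partial>\<^sub>t v t R \<phi> Z
          + \<rho> t R \<phi> Z * v t R \<phi> Z * (1 / R\<^sup>2) * dot_pol (\<psi> t) (\<partial>\<^sub>t \<psi> t) R \<phi> Z - \<rho> t R \<phi> Z
              * dot_pol (\<psi> t) (\<partial>\<^sub>t u t) R \<phi> Z
        = - (1 / R) * pbracket (p t) (\<psi> t) R \<phi> Z - F0 / R\<^sup>2 * \<partial>\<^sub>\<phi> (p t) R \<phi> Z + \<rho> t R \<phi> Z / R *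
            pbracket (\<psi> t) h3 R \<phi> Z
        - F0 / R * \<rho> t R \<phi> Z * \<partial>\<^sub>\<phi> (\<lambda>R \<phi> Z. (v t R \<phi> Z)\<^sup>2 * ((F0\<^sup>2 + dot_pol (\<psi> t) (\<psi> t) R \<phi> Z) / R\<^sup>2) / (2
            * R)) R \<phi> Z - 1 / (2 * R) * \<rho> t R \<phi> Z * pbracket h1 (\<psi> t) R \<phi> Z
        - rho_hat (\<rho> t) R \<phi> Z / R * w t R \<phi> Z * pbracket (\<psi> t) (u t) R \<phi> Z - R * \<rho> t R \<phi> Z * ((F0\<^sup>2
            + dot_pol (\<psi> t) (\<psi> t) R \<phi> Z) / R\<^sup>2) * pbracket (u t) (v t) R \<phi> Z
        - R * \<rho> t R \<phi> Z * v t R \<phi> Z * pbracket (u t) bt R \<phi> Z + R * \<rho> t R \<phi> Z * v t R \<phi> Z *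
            pbracket (u t) bp R \<phi> Z
        - \<rho> t R \<phi> Z * v t R \<phi> Z * (lap_star (\<psi> t) R \<phi> Z / R) * pbracket (u t) (\<psi> t) R \<phi> Z - \<rho> t R \<phi> Z
            * v t R \<phi> Z / R * pbracket (\<psi> t) (dot_pol (\<psi> t) (u t)) R \<phi> Z
        + \<rho> t R \<phi> Z * v t R \<phi> Z * F0 / R\<^sup>2 * dot_pol (\<psi> t) (\<partial>\<^sub>\<phi> (u t)) R \<phi> Z + \<rho> t R \<phi> Z * v t R \<phi> Z
            * (F0\<^sup>2 / R\<^sup>2) * \<partial>\<^sub>Z (u t) R \<phi> Z"
      using eqs unfolding eq_parallel_def inner_grad_pol norm_grad_pol norm_B_pol norm_B_field fd
          by (elim conjE)
    have Eb: "u t R \<phi> Z * \<partial>\<^sub>R e1 R \<phi> Z + R * u t R \<phi> Z * \<partial>\<^sub>Z e2 R \<phi> Z - (u t R \<phi> Z * \<partial>\<^sub>R e3 R \<phi> Z + R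
        * u t R \<phi> Z * \<partial>\<^sub>Z e4 R \<phi> Z)
        = Bv + \<nu> * (R * (u t R \<phi> Z * lap_pol (w t) R \<phi> Z)) - u t R \<phi> Z * (2 * R * \<partial>\<^sub>Z (p t) R \<phi> Z)
            + u t R \<phi> Z * pbracket (\<psi> t) (j t) R \<phi> Z - F0 / R * (u t R \<phi> Z * \<partial>\<^sub>\<phi> (j t) R \<phi> Z)"
      unfolding Bv_def F11[symmetric] by (rule vorticity_terms[OF R Eb0[unfolded anti]])
    have Eg: "v t R \<phi> Z * R * (\<rho> t R \<phi> Z * ((F0\<^sup>2 + dot_pol (\<psi> t) (\<psi> t) R \<phi> Z) / R\<^sup>2) * \<partial>\<^sub>t v t R \<phi> Z
          + \<rho> t R \<phi> Z * v t R \<phi> Z * (1 / R\<^sup>2) * dot_pol (\<psi> t) (\<partial>\<^sub>t \<psi> t) R \<phi> Z - \<rho> t R \<phi> Z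
              * dot_pol (\<psi> t) (\<partial>\<^sub>t u t) R \<phi> Z)
        = v t R \<phi> Z * R * Gv - v t R \<phi> Z * pbracket (p t) (\<psi> t) R \<phi> Z - F0 / R * v t R \<phi> Z * \<partial>\<^sub>\<phi> (p t) R \<phi> Z"
    proof -
      have "\<rho> t R \<phi> Z * ((F0\<^sup>2 + dot_pol (\<psi> t) (\<psi> t) R \<phi> Z) / R\<^sup>2) * \<partial>\<^sub>t v t R \<phi> Z
          + \<rho> t R \<phi> Z * v t R \<phi> Z * (1 / R\<^sup>2) * dot_pol (\<psi> t) (\<partial>\<^sub>t \<psi> t) R \<phi> Z - \<rho> t R \<phi> Z
              * dot_pol (\<psi> t) (\<partial>\<^sub>t u t) R \<phi> Z
        = Gv - 1 / R * pbracket (p t) (\<psi> t) R \<phi> Z - F0 / R\<^sup>2 * \<partial>\<^sub>\<phi> (p t) R \<phi> Z"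
        unfolding Eg0 anti F4 F5 j[OF x, symmetric] Gv_def by (simp only: algebra_simps)
      then show ?thesis using R by (simp only:) (simp add: field_simps power2_eq_square)
    qed
    have X: "R * \<rho> t R \<phi> Z * (R\<^sup>2 * dot_pol (u t) (\<partial>\<^sub>t u t) R \<phi> Z - (\<partial>\<^sub>t (\<lambda>t R \<phi> Z. v t R \<phi> Z
        * \<partial>\<^sub>R (\<psi> t) R \<phi> Z) t R \<phi> Z * \<partial>\<^sub>R (u t) R \<phi> Z + \<partial>\<^sub>t (\<lambda>t R \<phi> Z. v t R \<phi> Z * \<partial>\<^sub>Z (\<psi> t) R \<phi> Z) t R \<phi> Z
        * \<partial>\<^sub>Z (u t) R \<phi> Z))
        = N6 R \<phi> Z - (u t R \<phi> Z * \<partial>\<^sub>R e1 R \<phi> Z + R * u t R \<phi> Z * \<partial>\<^sub>Z e2 R \<phi> Z - (u t R \<phi> Z * \<partial>\<^sub>R e3 R \<phi> Z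
            + R * u t R \<phi> Z * \<partial>\<^sub>Z e4 R \<phi> Z))"
      unfolding N6_def e1_def e2_def e3_def e4_def dot_pol_def rho_hat_def by (simp add: algebra_simps)
    have E: "\<partial>\<^sub>t (\<lambda>t R \<phi> Z. R * energy_density F0 (\<psi> t) (u t) (\<rho> t) (p t) (v t) R \<phi> Z) t R \<phi> Z
        = dot_pol (\<psi> t) (\<partial>\<^sub>t \<psi> t) R \<phi> Z / R + R * (\<partial>\<^sub>t \<rho> t R \<phi> Z * ((R\<^sup>2 * dot_pol (u t) (u t) R \<phi> Z - 2
        * v t R \<phi> Z * dot_pol (\<psi> t) (u t) R \<phi> Z + (v t R \<phi> Z)\<^sup>2 * ((F0\<^sup>2
        + dot_pol (\<psi> t) (\<psi> t) R \<phi> Z) / R\<^sup>2)) / 2))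
        + R * \<rho> t R \<phi> Z * (R\<^sup>2 * dot_pol (u t) (\<partial>\<^sub>t u t) R \<phi> Z - (\<partial>\<^sub>t (\<lambda>t R \<phi> Z. v t R \<phi> Z
            * \<partial>\<^sub>R (\<psi> t) R \<phi> Z) t R \<phi> Z * \<partial>\<^sub>R (u t) R \<phi> Z + \<partial>\<^sub>t (\<lambda>t R \<phi> Z. v t R \<phi> Z
            * \<partial>\<^sub>Z (\<psi> t) R \<phi> Z) t R \<phi> Z * \<partial>\<^sub>Z (u t) R \<phi> Z))
        + v t R \<phi> Z * R * (\<rho> t R \<phi> Z * ((F0\<^sup>2 + dot_pol (\<psi> t) (\<psi> t) R \<phi> Z) / R\<^sup>2) * \<partial>\<^sub>t v t R \<phi> Z
          + \<rho> t R \<phi> Z * v t R \<phi> Z * (1 / R\<^sup>2) * dot_pol (\<psi> t) (\<partial>\<^sub>t \<psi> t) R \<phi> Z - \<rho> t R \<phi> Z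
              * dot_pol (\<psi> t) (\<partial>\<^sub>t u t) R \<phi> Z)
        + R * (1 / (gam - 1) * \<partial>\<^sub>t p t R \<phi> Z)"
      by (rule partial_t_energy[OF ev(1,2,5,6,7) t U])
    have N35: "\<eta> * N3 R \<phi> Z = \<eta> * (j t R \<phi> Z * \<partial>\<^sub>\<phi> (\<partial>\<^sub>\<phi> (\<psi> t)) R \<phi> Z / R ^ 3) - \<eta> * (R
        * (norm (grad_pol (\<lambda>R \<phi> Z. \<partial>\<^sub>\<phi> (\<psi> t) R \<phi> Z / R\<^sup>2) R \<phi> Z))\<^sup>2)"
      "\<nu> * N5 R \<phi> Z = \<nu> * (R * (u t R \<phi> Z * lap_pol (w t) R \<phi> Z)) - \<nu> * (R * (w t R \<phi> Z)\<^sup>2)"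
      unfolding N3_def N5_def by (simp_all only: right_diff_distrib)
    have N1: "N1 R \<phi> Z = dot_pol (\<psi> t) (\<partial>\<^sub>t \<psi> t) R \<phi> Z / R + (\<partial>\<^sub>t \<psi> t) R \<phi> Z * j t R \<phi> Z / R"
        unfolding N1_def ..
    show "N1 R \<phi> Z + N2 R \<phi> Z - \<eta> * N3 R \<phi> Z + N4 R \<phi> Z - \<nu> * N5 R \<phi> Z + N6 R \<phi> Z + N7 R \<phi> Z
        = \<partial>\<^sub>t (\<lambda>t R \<phi> Z. R * energy_density F0 (\<psi> t) (u t) (\<rho> t) (p t) (v t) R \<phi> Z) t R \<phi> Z + (\<nu> * (R
        * (w t R \<phi> Z)\<^sup>2) + \<eta> * (R * ((j t R \<phi> Z)\<^sup>2 / R\<^sup>2)) + \<eta> * (R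
        * (norm (grad_pol (\<lambda>R \<phi> Z. \<partial>\<^sub>\<phi> (\<psi> t) R \<phi> Z / R\<^sup>2) R \<phi> Z))\<^sup>2))"
      \<comment> \<open>All nonlinear work is done: the remaining identities are linear in common
        products, which count as atoms.\<close>
      unfolding E X Eg N35 N1 using M Pr Dn Eb by linarith
  qed
qed

end

section \<open>The energy law\<close>

text \<open>Boundary values are prescribed for angles in one period only, while the
  \<phi>-derivative at angle 0 looks to both sides. Shifting by the integer part of
  \<open>x / (2 * pi)\<close> carries the zero to all angles.\<close>

lemma periodic_zero:
  fixes f :: "real \<Rightarrow> real"
  assumes per: "\<And>x. f (x + 2 * pi) = f x" and zero: "\<And>x. 0 \<le> x \<Longrightarrow> x < 2 * pi \<Longrightarrow> f x = 0"
  shows "f x = 0"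
proof -
  interpret periodic_fun_simple f "2 * pi" by standard (rule per)
  let ?n = "\<lfloor>x / (2 * pi)\<rfloor>"
  have "of_int ?n \<le> x / (2 * pi)" "x / (2 * pi) < of_int ?n + 1" by linarith+
  then have "of_int ?n * (2 * pi) \<le> x" "x < (of_int ?n + 1) * (2 * pi)"
    by (simp_all only: pos_le_divide_eq pos_divide_less_eq mult_pos_pos zero_less_numeral pi_gt_zero)
  then have "f (x - of_int ?n * (2 * pi)) = 0" by (intro zero) (simp_all add: algebra_simps)
  then show ?thesis using minus_of_int[of x ?n] by simp
qed

section \<open>From the local balance to the derivative of the total energy\<close>

context poloidal_domain
begin

lemma integral_over_dV: "integral_over D dV f = (LINT x:cyl D|lborel. uncurry3 f x)"
  by (simp add: integral_over_def dV_def)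

text \<open>\<open>ennreal\<close> cuts negative values of R to 0, so the density is the positive
  part of R. On \<open>cyl D\<close> it is R itself, and elsewhere the indicator is zero.\<close>

lemma integral_over_dW:
  assumes f: "sm k f"
  shows "integral_over D dW f = (LINT x:cyl D|lborel. uncurry3 (\<lambda>R \<phi> Z. R * f R \<phi> Z) x)"
proof -
  let ?g = "\<lambda>x. indicat_real (cyl D) x *\<^sub>R uncurry3 f x"
  have meas: "?g \<in> borel_measurable lborel"
    using sm_integrable[OF f] by (auto simp: set_integrable_def dest: borel_measurable_integrable)
  have fst: "(\<lambda>x::real \<times> real \<times> real. max 0 (fst x)) \<in> borel_measurable lborel"
    using borel_measurable_continuous_onI[of "\<lambda>x::real \<times> real \<times> real. max 0 (fst x)"]
    by (simp add: continuous_intros)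
  have "dW = density lborel (\<lambda>x. ennreal (max 0 (fst x)))"
    unfolding dW_def dV_def by (rule arg_cong[where f="density lborel"]) (auto simp: fun_eq_iff
        max_def ennreal_neg)
  then have "integral_over D dW f = (LINT x|lborel. max 0 (fst x) *\<^sub>R ?g x)"
    unfolding integral_over_def set_lebesgue_integral_def using integral_density[OF meas fst] by simp
  also have "\<dots> = (LINT x:cyl D|lborel. uncurry3 (\<lambda>R \<phi> Z. R * f R \<phi> Z) x)"
    unfolding set_lebesgue_integral_def
  proof (rule Bochner_Integration.integral_cong[OF refl])
    fix x :: "real \<times> real \<times> real"
    show "max 0 (fst x) *\<^sub>R ?g x = indicat_real (cyl D) x *\<^sub>R uncurry3 (\<lambda>R \<phi> Z. R * f R \<phi> Z) x"
      using cyl_\<Omega> R_pos by (cases x) (force simp: indicator_def)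
  qed
  finally show ?thesis .
qed

lemma sm_energy_density:
  assumes "ev 3 \<psi>" "ev 3 u" "ev 3 \<rho>" "ev 3 p" "ev 3 v" "t \<in> J"
  shows "sm 1 (energy_density F0 (\<psi> t) (u t) (\<rho> t) (p t) (v t))"
proof (rule sm_cong)
  show "sm 1 (\<lambda>R \<phi> Z. R * energy_density F0 (\<psi> t) (u t) (\<rho> t) (p t) (v t) R \<phi> Z / R)"
    by (rule sm_divide_R) (rule ev_slice[OF ev_energy[OF assms(1-5)] assms(6)])
qed (use R_pos in force)

text \<open>The null field of the local balance is integrated. Its first term is the derivative of
  the total energy by \<open>integral_time_derivative\<close>, and integrability of the separate
  terms splits off the three dissipation integrals.\<close>

lemma energy_dissipation:
  assumes t: "t \<in> J"
    and ev: "ev 3 \<psi>" "ev 3 u" "ev 3 w" "ev 3 j" "ev 3 \<rho>" "ev 3 p" "ev 3 v"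
    and per: "per (\<psi> t)" "per (u t)" "per (w t)" "per (j t)" "per (\<rho> t)" "per (p t)" "per (v t)"
    and van: "vanish (u t)" "vanish (\<partial>\<^sub>R (u t))" "vanish (\<partial>\<^sub>Z (u t))" "vanish (\<rho> t)" "vanish (p t)"
      "vanish (\<partial>\<^sub>t \<psi> t)" "vanish (\<partial>\<^sub>\<phi> (\<psi> t))" "vanish (\<partial>\<^sub>\<phi> (\<partial>\<^sub>\<phi> (\<psi> t)))"
    and mhd: "\<And>R \<phi> Z. (R, \<phi>, Z) \<in> cyl D \<Longrightarrow> reduced_mhd \<eta> \<nu> F0 \<psi> u w j \<rho> p v t R \<phi> Z"
  defines "E \<equiv> \<lambda>s. energy_density F0 (\<psi> s) (u s) (\<rho> s) (p s) (v s)"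
    and "d \<equiv> - \<nu> * integral_over D dW (\<lambda>R \<phi> Z. (w t R \<phi> Z)\<^sup>2)
       - \<eta> * integral_over D dW (\<lambda>R \<phi> Z. (j t R \<phi> Z)\<^sup>2 / R\<^sup>2)
       - \<eta> * integral_over D dW (\<lambda>R \<phi> Z. (norm (grad_pol (\<lambda>R \<phi> Z. \<partial>\<^sub>\<phi> (\<psi> t) R \<phi> Z / R\<^sup>2) R \<phi> Z))\<^sup>2)"
  shows "((\<lambda>s. integral_over D dW (E s)) has_real_derivative d) (at t)"
    and "((\<lambda>s. integral_over D dV (\<lambda>R \<phi> Z. R * E s R \<phi> Z)) has_real_derivative d) (at t)"
proof -
  let ?E = "\<lambda>s R \<phi> Z. R * E s R \<phi> Z"
  let ?w = "\<lambda>R \<phi> Z. (w t R \<phi> Z)\<^sup>2" and ?j = "\<lambda>R \<phi> Z. (j t R \<phi> Z)\<^sup>2 / R\<^sup>2"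
    and ?n = "\<lambda>R \<phi> Z. (norm (grad_pol (\<lambda>R \<phi> Z. \<partial>\<^sub>\<phi> (\<psi> t) R \<phi> Z / R\<^sup>2) R \<phi> Z))\<^sup>2"
  let ?I = "\<lambda>f. LINT x:cyl D|lborel. uncurry3 f x" and ?int = "\<lambda>f. set_integrable lborel (cyl D) (uncurry3 f)"
  have evE: "ev 1 ?E" unfolding E_def by (rule ev_energy[OF ev(1,2,5,6,7)])
  have s: "sm (Suc 0) (w t)" "sm (Suc 0) (j t)" "sm 3 (\<psi> t)"
    using ev_slice[OF ev(3) t] ev_slice[OF ev(4) t] ev_slice[OF ev(1) t] by (auto intro: sm_lower)
  have sw: "sm (Suc 0) ?w" and sj: "sm (Suc 0) ?j" and sn: "sm (Suc 0) ?n"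
    unfolding norm_grad_pol by (intro sm_intros s)+
  have int: "?int (\<lambda>R \<phi> Z. R * f R \<phi> Z)" if "sm (Suc 0) f" for f
    by (rule sm_integrable[OF sm_mult[OF sm_R that]])
  have intE: "?int (\<partial>\<^sub>t ?E t)"
    using sm_integrable[OF ev_slice[OF ev_partial(1)[of 0] t]] evE by simp
  have "?I (\<lambda>R \<phi> Z. \<partial>\<^sub>t ?E t R \<phi> Z + (\<nu> * (R * ?w R \<phi> Z) + \<eta> * (R * ?j R \<phi> Z) + \<eta> * (R * ?n R \<phi> Z))) = 0"
    using null_energy_balance[OF t ev per van mhd] unfolding null_def E_def by (rule conjunct2)
  moreover have "?I (\<lambda>R \<phi> Z. \<partial>\<^sub>t ?E t R \<phi> Z + (\<nu> * (R * ?w R \<phi> Z) + \<eta> * (R * ?j R \<phi> Z) + \<eta> * (R * ?n R \<phi> Z)))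
    = ?I (\<partial>\<^sub>t ?E t) + (\<nu> * ?I (\<lambda>R \<phi> Z. R * ?w R \<phi> Z) + \<eta> * ?I (\<lambda>R \<phi> Z. R * ?j R \<phi> Z) + \<eta> * ?I (\<lambda>R \<phi> Z. R
        * ?n R \<phi> Z))"
  proof -
    have "(LINT x:cyl D|lborel. a x + (\<nu> * b x + \<eta> * c x + \<eta> * e x)) = (LINT x:cyl D|lborel. a x)
        + (\<nu> * (LINT x:cyl D|lborel. b x) + \<eta> * (LINT x:cyl D|lborel. c x) + \<eta> * (LINT x:cyl D|lborel. e x))"
      if "set_integrable lborel (cyl D) a" "set_integrable lborel (cyl D) b"
        "set_integrable lborel (cyl D) c" "set_integrable lborel (cyl D) e" for a b c e ::
            "real \<times> real \<times> real \<Rightarrow> real"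
      using that by (simp add: set_integral_add)
    from this[OF intE int[OF sw] int[OF sj] int[OF sn]] show ?thesis
      by (simp only: case_prod_unfold)
  qed
  ultimately have I: "?I (\<partial>\<^sub>t ?E t) = d"
    unfolding d_def integral_over_dW[OF sw] integral_over_dW[OF sj] integral_over_dW[OF sn] by linarith
  have der: "((\<lambda>s. ?I (?E s)) has_real_derivative d) (at t)"
    using integral_time_derivative[OF evE t] unfolding I .
  show "((\<lambda>s. integral_over D dV (?E s)) has_real_derivative d) (at t)"
    using der by (simp add: integral_over_dV)
  \<comment> \<open>The two forms of the total energy are identified only for times in
    \<open>J\<close>; since \<open>J\<close> is open, this determines the derivative at
    \<open>t\<close>.\<close>
  have "integral_over D dW (E s) = ?I (?E s)" if "s \<in> J" for s
    unfolding E_def by (rule integral_over_dW[OF sm_energy_density[OF ev(1,2,5,6,7) that]])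
  then show "((\<lambda>s. integral_over D dW (E s)) has_real_derivative d) (at t)"
    using has_field_derivative_transform_within_open[OF der open_J t] by simp
qed

end

theorem lemma2p1:
  fixes J :: "real set" and D :: "(real \<times> real) set"
    and F0 \<eta> \<nu> :: real
    and \<psi> u w j \<rho> p T v :: "real \<Rightarrow> real \<Rightarrow> real \<Rightarrow> real \<Rightarrow> real"
  assumes "open J"
    and "regular_domain D"
    and "\<forall>f\<in>{\<psi>, u, w, j, \<rho>, p, v}. sufficiently_smooth J D f \<and> phi_periodic J D f"
    and "\<forall>t\<in>J. \<forall>(R, \<phi>, Z)\<in>cyl D. reduced_mhd \<eta> \<nu> F0 \<psi> u w j \<rho> p v t R \<phi> Z"
    and "\<forall>t\<in>J. \<forall>(R, \<phi>, Z)\<in>cyl (closure D). p t R \<phi> Z = \<rho> t R \<phi> Z * T t R \<phi> Z"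
    and "\<forall>t\<in>J. \<forall>(R, \<phi>, Z)\<in>cyl (frontier D).
           \<psi> t R \<phi> Z = 0 \<and> u t R \<phi> Z = 0 \<and> T t R \<phi> Z = 0 \<and> \<rho> t R \<phi> Z = 0"
    and "\<forall>t\<in>J. \<forall>(R, \<phi>, Z)\<in>cyl (frontier D). \<forall>n. outward_normal D (R, Z) n \<longrightarrow>
           normal_derivative (u t) n R \<phi> Z = 0 \<and> normal_derivative (\<psi> t) n R \<phi> Z = 0"
  defines "E \<equiv> \<lambda>t. energy_density F0 (\<psi> t) (u t) (\<rho> t) (p t) (v t)"
  shows "(\<eta> = 0 \<and> \<nu> = 0 \<longrightarrow>
           (\<forall>t\<in>J. ((\<lambda>s. integral_over D dW (E s)) has_real_derivative 0) (at t)
              \<and> ((\<lambda>s. integral_over D dV (\<lambda>R \<phi> Z. R * E s R \<phi> Z)) has_real_derivative 0) (at t)))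
       \<and> (\<eta> \<noteq> 0 \<and> \<nu> \<noteq> 0 \<longrightarrow>
           (\<forall>t\<in>J. ((\<lambda>s. integral_over D dW (E s)) has_real_derivative
              (- \<nu> * integral_over D dW (\<lambda>R \<phi> Z. (w t R \<phi> Z)^2)
               - \<eta> * integral_over D dW (\<lambda>R \<phi> Z. (j t R \<phi> Z)^2 / R^2)
               - \<eta> * integral_over D dW (\<lambda>R \<phi> Z.
                   (norm (grad_pol (\<lambda>R \<phi> Z. \<partial>\<^sub>\<phi> (\<psi> t) R \<phi> Z / R^2) R \<phi> Z))^2))) (at t)))"
proof -
  let ?fields = "{\<psi>, u, w, j, \<rho>, p, v}"
  have D: "open D" "bounded D" "closure D \<subseteq> {(R, Z). R > 0}"
    and dense: "frontier D \<subseteq> closure {x. \<exists>n. outward_normal D x n}"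
    using assms(2) by (auto simp: regular_domain_def)
  have "\<forall>f\<in>?fields. \<exists>V. open V \<and> closure D \<subseteq> V
      \<and> C_k_on 3 {(t, R, \<phi>, Z). t \<in> J \<and> (R, Z) \<in> V} (\<lambda>(t, R, \<phi>, Z). f t R \<phi> Z)"
    using assms(3) unfolding sufficiently_smooth_def by blast
  then obtain V where V: "\<And>f. f \<in> ?fields \<Longrightarrow> open (V f)" "\<And>f. f \<in> ?fields \<Longrightarrow> closure D \<subseteq> V f"
    "\<And>f. f \<in> ?fields \<Longrightarrow> C_k_on 3 {(t, R, \<phi>, Z). t \<in> J \<and> (R, Z) \<in> V f} (\<lambda>(t, R, \<phi>, Z). f t R \<phi> Z)"
    by metis
  \<comment> \<open>Each field comes with its own neighbourhood of the closed domain. Their finite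
    intersection, cut with R > 0, is a common one.\<close>
  define U where "U = {(R, Z). R > (0::real)} \<inter> (\<Inter>f\<in>?fields. V f)"
  have "open ({x. fst x > (0::real)} :: (real \<times> real) set)"
    by (intro open_Collect_less continuous_intros)
  then have "open U" unfolding U_def using V(1) by (intro open_Int open_INT) (auto simp: case_prod_unfold)
  interpret poloidal_domain U J D
  proof
    show "closure D \<subseteq> U" unfolding U_def using D(3) V(2) by blast
  qed (use \<open>open U\<close> assms(1) D in \<open>auto simp: U_def\<close>)
  have ev: "ev 3 f" if "f \<in> ?fields" for f
    unfolding smooth_evolution_def by (rule C_k_on_subset[OF V(3)[OF that]]) (use that in \<open>auto simp: U_def\<close>)
  have per0: "f t R (\<phi> + 2 * pi) Z = f t R \<phi> Z" if "f \<in> ?fields" "t \<in> J" "(R, Z) \<in> closure D" for f t R \<phi> Z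
    using assms(3) that unfolding phi_periodic_def by blast
  have per: "per (f t)" if "f \<in> ?fields" "t \<in> J" for f t
    unfolding per_def using per0[OF that] closure_subset by blast
  have bd: "\<psi> t R \<phi> Z = 0" "u t R \<phi> Z = 0" "\<rho> t R \<phi> Z = 0" "p t R \<phi> Z = 0"
    if "t \<in> J" "(R, \<phi>, Z) \<in> cyl (frontier D)" for t R \<phi> Z
  proof -
    show "\<psi> t R \<phi> Z = 0" "u t R \<phi> Z = 0" and \<rho>: "\<rho> t R \<phi> Z = 0"
      using assms(6) that by blast+
    have "(R, \<phi>, Z) \<in> cyl (closure D)"
      using that(2) by (auto simp: cyl_def frontier_def)
    \<comment> \<open>The pressure inherits the boundary value of the density through p = \<rho> T,
      which is assumed up to the closure.\<close>
    then show "p t R \<phi> Z = 0" using assms(5) that(1) \<rho> by fastforce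
  qed
  \<comment> \<open>One law for arbitrary \<eta> and \<nu>, in both forms of the integral; the
    conservative and the dissipative claim are instances.\<close>
  have main: "((\<lambda>s. integral_over D dW (E s)) has_real_derivative
              (- \<nu> * integral_over D dW (\<lambda>R \<phi> Z. (w t R \<phi> Z)^2)
               - \<eta> * integral_over D dW (\<lambda>R \<phi> Z. (j t R \<phi> Z)^2 / R^2)
               - \<eta> * integral_over D dW (\<lambda>R \<phi> Z.
                   (norm (grad_pol (\<lambda>R \<phi> Z. \<partial>\<^sub>\<phi> (\<psi> t) R \<phi> Z / R^2) R \<phi> Z))^2))) (at t)"
    "((\<lambda>s. integral_over D dV (\<lambda>R \<phi> Z. R * E s R \<phi> Z)) has_real_derivative
              (- \<nu> * integral_over D dW (\<lambda>R \<phi> Z. (w t R \<phi> Z)^2)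
               - \<eta> * integral_over D dW (\<lambda>R \<phi> Z. (j t R \<phi> Z)^2 / R^2)
               - \<eta> * integral_over D dW (\<lambda>R \<phi> Z.
                   (norm (grad_pol (\<lambda>R \<phi> Z. \<partial>\<^sub>\<phi> (\<psi> t) R \<phi> Z / R^2) R \<phi> Z))^2))) (at t)"
    if t: "t \<in> J" for t
  proof -
    have van: "vanish (u t)" "vanish (\<rho> t)" "vanish (p t)"
      unfolding vanish_def using bd[OF t] by auto
    have u1: "sm 1 (u t)" using ev_slice[OF ev t, of u] by (auto intro: sm_lower)
    have grad: "\<partial>\<^sub>R (u t) R \<phi> Z = 0 \<and> \<partial>\<^sub>Z (u t) R \<phi> Z = 0" if x: "(R, \<phi>, Z) \<in> cyl (frontier D)" for R \<phi> Z
    proof -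
      \<comment> \<open>The argument for the gradient moves along the frontier at a fixed angle, so
        the boundary conditions are needed at every frontier point with this angle.\<close>
      have \<phi>: "(R', \<phi>, Z') \<in> cyl (frontier D)" if "(R', Z') \<in> frontier D" for R' Z'
        using x that by (auto simp: cyl_def)
      have "normal_derivative (u t) n R' \<phi> Z' = 0" if n: "outward_normal D (R', Z') n" for R' Z' n
      proof -
        have "(R', Z') \<in> frontier D" using n by (simp add: outward_normal_def)
        then show ?thesis using assms(7) t \<phi> n by blast
      qed
      then show ?thesis
        using gradient_eq_0_on_frontier[OF u1 bd(2)[OF t \<phi>] _ dense, of R Z] x by (auto simp: cyl_def)
    qed
    then have vgrad: "vanish (\<partial>\<^sub>R (u t))" "vanish (\<partial>\<^sub>Z (u t))" by (auto simp: vanish_def)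
    \<comment> \<open>At a frontier point \<psi> is zero for all times in the open set
      \<open>J\<close>, hence so is its time derivative.\<close>
    have vt: "vanish (\<partial>\<^sub>t \<psi> t)"
      unfolding vanish_def
    proof clarify
      fix R \<phi> Z assume x: "(R, \<phi>, Z) \<in> cyl (frontier D)"
      show "\<partial>\<^sub>t \<psi> t R \<phi> Z = 0"
        by (rule partial_t_eqI, rule has_field_derivative_transform_within_open[OF DERIV_const assms(1) t])
          (simp add: bd(1)[OF _ x])
    qed
    \<comment> \<open>Extended to all angles, the zero boundary value can be differentiated twice in
      \<phi>, also at angle 0.\<close>
    have \<psi>0: "\<psi> t R \<phi> Z = 0" if x: "(R, Z) \<in> frontier D" for R \<phi> Z
      by (rule periodic_zero[where f="\<lambda>\<phi>. \<psi> t R \<phi> Z"])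
        (use per0[of \<psi> t R Z] bd(1)[OF t, of R _ Z] t x in \<open>auto simp: cyl_def frontier_def\<close>)
    have \<psi>1: "\<partial>\<^sub>\<phi> (\<psi> t) R \<phi> Z = 0" if x: "(R, Z) \<in> frontier D" for R \<phi> Z
      unfolding partial_phi_def using \<psi>0[OF x] by simp
    have \<psi>2: "\<partial>\<^sub>\<phi> (\<partial>\<^sub>\<phi> (\<psi> t)) R \<phi> Z = 0" if x: "(R, Z) \<in> frontier D" for R \<phi> Z
      unfolding partial_phi_def[of "\<partial>\<^sub>\<phi> (\<psi> t)"] using \<psi>1[OF x] by simp
    have v\<phi>: "vanish (\<partial>\<^sub>\<phi> (\<psi> t))" "vanish (\<partial>\<^sub>\<phi> (\<partial>\<^sub>\<phi> (\<psi> t)))"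
      unfolding vanish_def using \<psi>1 \<psi>2 by (auto simp: cyl_def)
    have mhd: "reduced_mhd \<eta> \<nu> F0 \<psi> u w j \<rho> p v t R \<phi> Z" if "(R, \<phi>, Z) \<in> cyl D" for R \<phi> Z
      using assms(4) t that by blast
    have f: "ev 3 \<psi>" "ev 3 u" "ev 3 w" "ev 3 j" "ev 3 \<rho>" "ev 3 p" "ev 3 v"
      "per (\<psi> t)" "per (u t)" "per (w t)" "per (j t)" "per (\<rho> t)" "per (p t)" "per (v t)"
      using ev per[OF _ t] by auto
    note res = energy_dissipation[OF t f van(1) vgrad van(2,3) vt v\<phi> mhd]
    show "((\<lambda>s. integral_over D dW (E s)) has_real_derivative
              (- \<nu> * integral_over D dW (\<lambda>R \<phi> Z. (w t R \<phi> Z)^2)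
               - \<eta> * integral_over D dW (\<lambda>R \<phi> Z. (j t R \<phi> Z)^2 / R^2)
               - \<eta> * integral_over D dW (\<lambda>R \<phi> Z.
                   (norm (grad_pol (\<lambda>R \<phi> Z. \<partial>\<^sub>\<phi> (\<psi> t) R \<phi> Z / R^2) R \<phi> Z))^2))) (at t)"
      unfolding E_def by (rule res(1))
    show "((\<lambda>s. integral_over D dV (\<lambda>R \<phi> Z. R * E s R \<phi> Z)) has_real_derivative
              (- \<nu> * integral_over D dW (\<lambda>R \<phi> Z. (w t R \<phi> Z)^2)
               - \<eta> * integral_over D dW (\<lambda>R \<phi> Z. (j t R \<phi> Z)^2 / R^2)
               - \<eta> * integral_over D dW (\<lambda>R \<phi> Z.
                   (norm (grad_pol (\<lambda>R \<phi> Z. \<partial>\<^sub>\<phi> (\<psi> t) R \<phi> Z / R^2) R \<phi> Z))^2))) (at t)"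
      unfolding E_def by (rule res(2))
  qed
  show ?thesis
  proof (intro conjI impI ballI)
    fix t assume t: "t \<in> J" and 0: "\<eta> = 0 \<and> \<nu> = 0"
    show "((\<lambda>s. integral_over D dW (E s)) has_real_derivative 0) (at t)"
      using main(1)[OF t] 0 by simp
    show "((\<lambda>s. integral_over D dV (\<lambda>R \<phi> Z. R * E s R \<phi> Z)) has_real_derivative 0) (at t)"
      using main(2)[OF t] 0 by simp
  qed (rule main(1))
qed

end
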